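(* There exist universal constants $c,C_1,C_2>0$ such that for every $d\ge1$, every positive definite $\Sigma\in\mathbb R^{d\times d}$, every $\sigma>0$, every $n\ge1$ and every $\boldsymbol\lambda\in[0,1]^n$ with $m_d(\boldsymbol\lambda):=\min_{t\in[0,1]}\big(t^2+\frac d{N(t)}\big)\le c$, \[ \frac{C_1\sigma^2}{\sqrt d}\,m_d(\boldsymbol\lambda)\le L_{\mathsf{reg}}(\boldsymbol\lambda,\mathcal D(\Sigma,\sigma^2))\le C_2\sigma^2\,m_d(\boldsymbol\lambda). \] Moreover, with $t^*\in\arg\min_{t\in[0,1]}\big(t^2+\frac d{N(t)}\big)$, the estimator $\hat\beta_{\mathsf S}(\mathbf Z,t^* )$ satisfies $\Pr[\|\hat\beta_{\mathsf S}(\mathbf Z,t^* )-\beta_P\|_\Sigma^2\ge C_2\sigma^2 m_d(\boldsymbol\lambda)]\le1/5$ for every $P\in\mathcal D(\Sigma,\sigma^2)$ and every adversary.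
   Context: $\mathcal D(\Sigma,\sigma^2)$ is the family of distributions of $(W,Y)\in\mathbb R^d\times\mathbb R$ with $W\sim\mathcal N(0,\Sigma)$ and, conditionally on $W$, $Y\sim\mathcal N(W^\top\beta,\sigma^2)$, for some $\beta\in\mathbb R^d$; $\beta_P$ denotes this $\beta$. $\|x\|_\Sigma=\sqrt{x^\top\Sigma x}$. $\boldsymbol\lambda$-contamination: $Z_i=(1-B_i)X_i+B_i\tilde X_i$ with $X_i=(W_i,Y_i)$ i.i.d. from $P$, $B_i\sim\mathrm{Bernoulli}(\lambda_i)$ independent and independent of the $X_i$, outliers drawn from an arbitrary joint distribution (adversary) that may depend on all $X_j,B_j$; write $Z_i=(\hat W_i,\hat Y_i)$, $\mathbf Z\sim_{\boldsymbol\lambda}P$. $L_{\mathsf{reg}}(\boldsymbol\lambda,\mathcal D)=\inf\{s:\inf_M\sup\Pr[\|M(\mathbf Z)-\beta_P\|_\Sigma^2>s]\le1/5\}$, infimum over estimators, supremum over $P\in\mathcal D$ and all adversaries. $N(t)=|\{i:\lambda_i\le t\}|$ with $d/0=+\infty$. Weighted regression depth $D_w(\eta,\mathbf Z)=\min_{v\in\mathbb S^{d-1}}\sum_iw_i\mathbb I\{(\hat Y_i-\eta^\top\hat W_i)(v^\top\hat W_i)\ge0\}$ for $w$ in the probability simplex, $\hat\beta_{\mathsf{TC}}(\mathbf Z,w)\in\arg\max_\eta D_w(\eta,\mathbf Z)$; threshold weights $w(t)_i=\mathbb I\{\lambda_i\le t\}/N(t)$ and $\hat\beta_{\mathsf S}(\mathbf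 Z,t)=\hat\beta_{\mathsf{TC}}(\mathbf Z,w(t))$. *)

theory Defs
  imports "HOL-Probability.Probability"
begin

text \<open>Vectors in R^d are functions nat => real, only coordinates i < d matter.
  Matrices are nat => nat => real, only entries i,j < d matter.
  An observation is a pair (W, Y) :: (nat => real) * real; a data set of size n
  is a function nat => observation (indices i < n).\<close>

type_synonym obs = "(nat \<Rightarrow> real) \<times> real"

definition Rd :: "nat \<Rightarrow> (nat \<Rightarrow> real) measure" where
  "Rd d = PiM {..<d} (\<lambda>_. (borel :: real measure))"

definition obs_space :: "nat \<Rightarrow> obs measure" where
  "obs_space d = Rd d \<Otimes>\<^sub>M (borel :: real measure)"

definition sample_space :: "nat \<Rightarrow> nat \<Rightarrow> (nat \<Rightarrow> obs) measure" where
  "sample_space d n = PiM {..<n} (\<lambda>_. obs_space d)"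

definition bit_space :: "nat \<Rightarrow> (nat \<Rightarrow> bool) measure" where
  "bit_space n = PiM {..<n} (\<lambda>_. count_space (UNIV :: bool set))"

definition pos_def :: "nat \<Rightarrow> (nat \<Rightarrow> nat \<Rightarrow> real) \<Rightarrow> bool" where
  "pos_def d S \<longleftrightarrow> (\<forall>i<d. \<forall>j<d. S i j = S j i) \<and>
     (\<forall>x. (\<exists>i<d. x i \<noteq> 0) \<longrightarrow> 0 < (\<Sum>i<d. \<Sum>j<d. x i * S i j * x j))"

definition sqnormS :: "nat \<Rightarrow> (nat \<Rightarrow> nat \<Rightarrow> real) \<Rightarrow> (nat \<Rightarrow> real) \<Rightarrow> real" where
  "sqnormS d S x = (\<Sum>i<d. \<Sum>j<d. x i * S i j * x j)"

definition std_normal :: "real measure" where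
  "std_normal = density lborel std_normal_density"

definition sqrt_cov :: "nat \<Rightarrow> (nat \<Rightarrow> nat \<Rightarrow> real) \<Rightarrow> nat \<Rightarrow> nat \<Rightarrow> real" where
  "sqrt_cov d S = (SOME A. \<forall>i<d. \<forall>j<d. (\<Sum>k<d. A i k * A j k) = S i j)"

definition gauss_vec :: "nat \<Rightarrow> (nat \<Rightarrow> nat \<Rightarrow> real) \<Rightarrow> (nat \<Rightarrow> real) measure" where
  "gauss_vec d S = distr (PiM {..<d} (\<lambda>_. std_normal)) (Rd d)
      (\<lambda>g. \<lambda>i\<in>{..<d}. \<Sum>j<d. sqrt_cov d S i j * g j)"

definition lin_model :: "nat \<Rightarrow> (nat \<Rightarrow> nat \<Rightarrow> real) \<Rightarrow> real \<Rightarrow> (nat \<Rightarrow> real) \<Rightarrow> obs measure" where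
  "lin_model d S \<sigma> \<beta> = distr (gauss_vec d S \<Otimes>\<^sub>M density lborel (normal_density 0 \<sigma>)) (obs_space d)
      (\<lambda>(w, e). (w, (\<Sum>i<d. \<beta> i * w i) + e))"

text \<open>Underlying space of (X, B, X~): clean data, contamination bits, outliers.\<close>
definition contam_space :: "nat \<Rightarrow> nat \<Rightarrow> (((nat \<Rightarrow> obs) \<times> (nat \<Rightarrow> bool)) \<times> (nat \<Rightarrow> obs)) measure" where
  "contam_space d n = (sample_space d n \<Otimes>\<^sub>M bit_space n) \<Otimes>\<^sub>M sample_space d n"

text \<open>An adversary: a Markov kernel giving the joint law of the outliers given all (X_j, B_j).\<close>
definition adversary :: "nat \<Rightarrow> nat \<Rightarrow> ((nat \<Rightarrow> obs) \<times> (nat \<Rightarrow> bool) \<Rightarrow> (nat \<Rightarrow> obs) measure) \<Rightarrow> bool" where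
  "adversary d n K \<longleftrightarrow> K \<in> sample_space d n \<Otimes>\<^sub>M bit_space n \<rightarrow>\<^sub>M prob_algebra (sample_space d n)"

definition contam_prob :: "nat \<Rightarrow> nat \<Rightarrow> (nat \<Rightarrow> nat \<Rightarrow> real) \<Rightarrow> real \<Rightarrow> (nat \<Rightarrow> real) \<Rightarrow> (nat \<Rightarrow> real)
     \<Rightarrow> ((nat \<Rightarrow> obs) \<times> (nat \<Rightarrow> bool) \<Rightarrow> (nat \<Rightarrow> obs) measure)
     \<Rightarrow> (((nat \<Rightarrow> obs) \<times> (nat \<Rightarrow> bool)) \<times> (nat \<Rightarrow> obs)) measure" where
  "contam_prob d n S \<sigma> lam \<beta> K =
     (PiM {..<n} (\<lambda>_. lin_model d S \<sigma> \<beta>) \<Otimes>\<^sub>M PiM {..<n} (\<lambda>i. measure_pmf (bernoulli_pmf (lam i))))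
       \<bind> (\<lambda>xb. K xb \<bind> (\<lambda>xt. return (contam_space d n) (xb, xt)))"

definition observed :: "nat \<Rightarrow> ((nat \<Rightarrow> obs) \<times> (nat \<Rightarrow> bool)) \<times> (nat \<Rightarrow> obs) \<Rightarrow> (nat \<Rightarrow> obs)" where
  "observed n \<omega> = (case \<omega> of ((x, b), xt) \<Rightarrow> (\<lambda>i\<in>{..<n}. if b i then xt i else x i))"

definition outer_prob :: "'a measure \<Rightarrow> ('a \<Rightarrow> bool) \<Rightarrow> real" where
  "outer_prob M E = Inf {measure M A | A. A \<in> sets M \<and> {\<omega> \<in> space M. E \<omega>} \<subseteq> A}"

definition Lreg :: "nat \<Rightarrow> nat \<Rightarrow> (nat \<Rightarrow> nat \<Rightarrow> real) \<Rightarrow> real \<Rightarrow> (nat \<Rightarrow> real) \<Rightarrow> ereal" where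
  "Lreg d n S \<sigma> lam = Inf {ereal s | s.
     (INF M \<in> (sample_space d n \<rightarrow>\<^sub>M Rd d).
        SUP \<beta>K \<in> {(\<beta>, K). adversary d n K}.
          ereal (outer_prob (contam_prob d n S \<sigma> lam (fst \<beta>K) (snd \<beta>K))
            (\<lambda>\<omega>. s < sqnormS d S (\<lambda>i. M (observed n \<omega>) i - fst \<beta>K i)))) \<le> ereal (1/5)}"

definition Ncount :: "nat \<Rightarrow> (nat \<Rightarrow> real) \<Rightarrow> real \<Rightarrow> nat" where
  "Ncount n lam t = card {i. i < n \<and> lam i \<le> t}"

definition mobj :: "nat \<Rightarrow> nat \<Rightarrow> (nat \<Rightarrow> real) \<Rightarrow> real \<Rightarrow> ereal" where
  "mobj d n lam t = (if Ncount n lam t = 0 then \<infinity>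
      else ereal (t\<^sup>2 + real d / real (Ncount n lam t)))"

definition md :: "nat \<Rightarrow> nat \<Rightarrow> (nat \<Rightarrow> real) \<Rightarrow> ereal" where
  "md d n lam = (INF t \<in> {0..1}. mobj d n lam t)"

definition thr_weights :: "nat \<Rightarrow> (nat \<Rightarrow> real) \<Rightarrow> real \<Rightarrow> nat \<Rightarrow> real" where
  "thr_weights n lam t i = (if lam i \<le> t then 1 / real (Ncount n lam t) else 0)"

definition depth :: "nat \<Rightarrow> nat \<Rightarrow> (nat \<Rightarrow> real) \<Rightarrow> (nat \<Rightarrow> real) \<Rightarrow> (nat \<Rightarrow> obs) \<Rightarrow> real" where
  "depth d n w \<eta> z = Inf {(\<Sum>i<n. w i *
        (if 0 \<le> (snd (z i) - (\<Sum>j<d. \<eta> j * fst (z i) j)) * (\<Sum>j<d. v j * fst (z i) j) then 1 else 0))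
      | v. (\<Sum>j<d. (v j)\<^sup>2) = 1}"

end

(* Idea. Upper bound: with e = Y - <beta, W>, the depth of beta is governed by the half-spaces
   {e <u, W> < 0} and the depth of eta by the slabs of points with <eta - beta, W> between 0 and e,
   whose probability falls below 1/2 by a multiple of the distance of eta to beta. Half-spaces in R^D
   have VC dimension D, so Dudley's packing bound and chaining make all empirical frequencies
   uniformly sqrt(d/N)-accurate, without a logarithm; among the N points with lambda_i <= t at most
   O(t N) are corrupted, by Markov's inequality.

   Lower bound: take beta in a hypercube of dimension k ~ sqrt d and side a. The pointwise supremum
   of all the conditional densities of Y is a normal density with a flat top, so its total mass is
   1 + O(a k); hence an adversary with lambda_i > t ~ a k can give Z_i the same law for every vertex.
   The remaining N(t) <= 2 d / m points carry too little information to find a sign, by a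
   Hellinger affinity bound, and Assouad's argument gives the squared error k a^2 ~ m / sqrt d. *)

theory Submission
  imports Defs
begin

section \<open>Finite linear systems and shattering\<close>

text \<open>Upper bound: at distance s \<sigma> from \<beta> the slab probability is s / 192 below
  1/2, while sampling perturbs the frequencies by O(sqrt (d / N)) and corruption by O(t). If t \<le>
  r and d / N \<le> r^2, both are O(r), so s = 6000000 r suffices, and the best r^2 is the minimum
  of t^2 + d / N. The obstacle is measurability: uncountably many directions are involved, and a
  depth maximizer may fail to be measurable. Hence directions are reduced to the countable family
  \<open>qvec\<close>, with a margin in the slab that absorbs the approximation, and errors are
  measured by outer probability. Lower bound: sqrt d is the outcome of two constraints. Masking
  needs a k \<le> \<sigma> t, since the envelope may exceed mass 1 by t only. Confusing neighbouring
  vertices needs N a^2 = O(\<sigma>^2), where N is of order d / t^2. With a = \<sigma> t / k the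
  latter reads d / k^2 = O(1), so k is at least of order sqrt d. The error k a^2 = \<sigma>^2 t^2 /
  k decreases in k, so the smallest admissible k is taken.\<close>

lemma underdetermined_system:
  fixes a :: "'i \<Rightarrow> 'j \<Rightarrow> real"
  assumes "finite I" "finite J" "card I < card J"
  shows "\<exists>x. (\<exists>j\<in>J. x j \<noteq> 0) \<and> (\<forall>i\<in>I. (\<Sum>j\<in>J. a i j * x j) = 0)"
  using assms
proof (induction I arbitrary: J a rule: finite_induct)
  case empty
  then obtain j where "j \<in> J" by fastforce
  then show ?case by (intro exI[of _ "\<lambda>_. 1"]) auto
next
  case (insert i0 I)
  show ?case
  proof (cases "\<forall>j\<in>J. a i0 j = 0")
    case True
    obtain x where "\<exists>j\<in>J. x j \<noteq> 0" "\<forall>i\<in>I. (\<Sum>j\<in>J. a i j * x j) = 0"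
      using insert.IH[of J a] insert.hyps insert.prems by fastforce
    with True show ?thesis by (intro exI[of _ x]) auto
  next
    case False
    then obtain p where p: "p \<in> J" "a i0 p \<noteq> 0" by auto
    define J' where "J' = J - {p}"
    have J': "finite J'" "card I < card J'"
      using insert p by (auto simp: J'_def)
    \<comment> \<open>Gaussian elimination: equation \<open>i0\<close> is solved for the unknown
      \<open>p\<close>, and \<open>a'\<close> is the system that remains for the other unknowns. The
      value of \<open>x' p\<close> below restores equation \<open>i0\<close>.\<close>
    define a' where "a' i j = a i j - a i p * a i0 j / a i0 p" for i j
    obtain x where x: "\<exists>j\<in>J'. x j \<noteq> 0" "\<forall>i\<in>I. (\<Sum>j\<in>J'. a' i j * x j) = 0"
      using insert.IH[OF J', of a'] by auto
    define S where "S = (\<Sum>j\<in>J'. a i0 j * x j)"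
    define x' where "x' = x(p := - S / a i0 p)"
    have sp: "(\<Sum>j\<in>J. a i j * x' j) = (\<Sum>j\<in>J'. a i j * x j) - a i p * S / a i0 p" for i
    proof -
      have "(\<Sum>j\<in>J. a i j * x' j) = a i p * x' p + (\<Sum>j\<in>J'. a i j * x' j)"
        unfolding J'_def using p insert.prems by (subst sum.remove[of J p]) auto
      also have "(\<Sum>j\<in>J'. a i j * x' j) = (\<Sum>j\<in>J'. a i j * x j)"
        by (intro sum.cong) (auto simp: x'_def J'_def)
      finally show ?thesis by (simp add: x'_def)
    qed
    have "(\<Sum>j\<in>J. a i j * x' j) = 0" if "i \<in> insert i0 I" for i
    proof (cases "i = i0")
      case True
      then show ?thesis using p sp[of i0] by (simp add: S_def)
    next
      case False
      then have "(\<Sum>j\<in>J'. a' i j * x j) = 0" using that x by auto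
      moreover have "(\<Sum>j\<in>J'. a' i j * x j) = (\<Sum>j\<in>J'. a i j * x j) - a i p * S / a i0 p"
        by (simp add: a'_def S_def sum_subtractf algebra_simps sum_distrib_left sum_divide_distrib)
      ultimately show ?thesis using sp[of i] by simp
    qed
    moreover have "\<exists>j\<in>J. x' j \<noteq> 0" using x(1) by (auto simp: x'_def J'_def)
    ultimately show ?thesis by blast
  qed
qed

section \<open>Shattered sets and the Sauer-Shelah bound\<close>

definition shatters :: "'a set set \<Rightarrow> 'a set \<Rightarrow> bool" where
  "shatters F S \<longleftrightarrow> (\<forall>T\<subseteq>S. \<exists>A\<in>F. A \<inter> S = T)"

lemma shattersD: "shatters F S \<Longrightarrow> T \<subseteq> S \<Longrightarrow> \<exists>A\<in>F. A \<inter> S = T"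
  by (auto simp: shatters_def)

text \<open>Pajor's form of the Sauer-Shelah lemma, which admits induction on \<open>card F\<close>.
  Split \<open>F\<close> by membership of a point \<open>x\<close>. A set \<open>S\<close> shattered
  by both halves is counted twice when the induction hypotheses are added; the second count is
  charged to \<open>insert x S\<close>, which \<open>F\<close> shatters as well.\<close>

lemma card_le_card_shattered:
  assumes "finite I" "F \<subseteq> Pow I"
  shows "card F \<le> card {S \<in> Pow I. shatters F S}"
  using assms(2)
proof (induction "card F" arbitrary: F rule: less_induct)
  case less
  let ?sh = "\<lambda>F. {S \<in> Pow I. shatters F S}"
  have fin: "finite G" if "G \<subseteq> Pow I" for G using that assms(1) finite_subset by auto
  have finsh: "finite (?sh G)" for G using assms(1) by auto
  show ?case
  proof (cases "\<exists>A\<in>F. \<exists>B\<in>F. A \<noteq> B")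
    case nd: False
    show ?thesis
    proof (cases "F = {}")
      case False
      then obtain A where "F = {A}" using nd by blast
      moreover have "{} \<in> ?sh F" using False by (auto simp: shatters_def)
      then have "card (?sh F) \<ge> 1" using finsh[of F] by (metis One_nat_def Suc_leI card_gt_0_iff empty_iff)
      ultimately show ?thesis by simp
    qed simp
  next
    case True
    then obtain x where x: "\<exists>A\<in>F. x \<in> A" "\<exists>A\<in>F. x \<notin> A" by blast
    define F0 where "F0 = {A\<in>F. x \<notin> A}"
    define F1 where "F1 = {A\<in>F. x \<in> A}"
    have sub: "F0 \<subset> F" "F1 \<subset> F" using x by (auto simp: F0_def F1_def)
    have "card F = card F0 + card F1"
      using fin[OF less.prems] by (subst card_Un_disjoint[symmetric]) (auto simp: F0_def F1_def intro!: arg_cong[of _ _ card])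
    moreover have "card F0 \<le> card (?sh F0)" "card F1 \<le> card (?sh F1)"
      using less.prems less.hyps[OF psubset_card_mono[OF fin[OF less.prems] sub(1)]]
        less.hyps[OF psubset_card_mono[OF fin[OF less.prems] sub(2)]] sub by blast+
    moreover have "card (?sh F0) + card (?sh F1) = card (?sh F0 \<union> ?sh F1) + card (?sh F0 \<inter> ?sh F1)"
      using finsh by (intro card_Un_Int) auto
    moreover have nx: "x \<notin> S" if S: "S \<in> ?sh F0 \<union> ?sh F1" for S
    proof
      assume "x \<in> S"
      from S show False
      proof
        assume "S \<in> ?sh F0"
        then obtain A where "A\<in>F0" "A \<inter> S = {x}" using shattersD[of F0 S "{x}"] \<open>x \<in> S\<close> by auto
        then show False by (auto simp: F0_def)
      next
        assume "S \<in> ?sh F1"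
        then obtain A where "A\<in>F1" "A \<inter> S = {}" using shattersD[of F1 S "{}"] by auto
        then show False using \<open>x \<in> S\<close> by (auto simp: F1_def)
      qed
    qed
    moreover have "card (insert x ` (?sh F0 \<inter> ?sh F1)) = card (?sh F0 \<inter> ?sh F1)"
      using nx by (intro card_image inj_onI) (metis Int_iff UnI1 insert_ident)
    moreover have "card (?sh F0 \<union> ?sh F1) + card (insert x ` (?sh F0 \<inter> ?sh F1)) =
        card ((?sh F0 \<union> ?sh F1) \<union> insert x ` (?sh F0 \<inter> ?sh F1))"
      using finsh nx by (intro card_Un_disjoint[symmetric]) auto
    moreover have "card ((?sh F0 \<union> ?sh F1) \<union> insert x ` (?sh F0 \<inter> ?sh F1)) \<le> card (?sh F)"
    proof (intro card_mono finsh subsetI)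
      fix S assume "S \<in> (?sh F0 \<union> ?sh F1) \<union> insert x ` (?sh F0 \<inter> ?sh F1)"
      then consider "S \<in> ?sh F0 \<union> ?sh F1" | S' where "S = insert x S'" "S' \<in> ?sh F0 \<inter> ?sh F1" by blast
      then show "S \<in> ?sh F"
      proof cases
        case 1
        then show ?thesis using sub unfolding shatters_def
          by (smt (verit, best) Un_iff mem_Collect_eq psubsetE subsetD)
      next
        case 2
        have "x \<in> I" using x(1) less.prems by auto
        have "\<exists>A\<in>F. A \<inter> S = T" if "T \<subseteq> S" for T
        proof (cases "x \<in> T")
          case True
          have "T - {x} \<subseteq> S'" using that 2 by auto
          moreover have "shatters F1 S'" using 2 by blast
          ultimately obtain A where A: "A\<in>F1" "A \<inter> S' = T - {x}" using shattersD by meson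
          then have "A \<inter> S = T" using 2 True by (auto simp: F1_def)
          then show ?thesis using A by (auto simp: F1_def)
        next
          case False
          have "T \<subseteq> S'" using that 2 False by auto
          moreover have "shatters F0 S'" using 2 by blast
          ultimately obtain A where A: "A\<in>F0" "A \<inter> S' = T" using shattersD by meson
          then have "A \<inter> S = T" using 2 False by (auto simp: F0_def)
          then show ?thesis using A by (auto simp: F0_def)
        qed
        then show ?thesis using 2 \<open>x \<in> I\<close> by (auto simp: shatters_def)
      qed
    qed
    ultimately show ?thesis by linarith
  qed
qed

lemma card_le_sum_choose:
  assumes "finite I" "F \<subseteq> Pow I" and "\<And>S. shatters F S \<Longrightarrow> S \<subseteq> I \<Longrightarrow> card S \<le> D"
  shows "card F \<le> (\<Sum>j\<le>D. card I choose j)"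
proof -
  have "card F \<le> card {S \<in> Pow I. shatters F S}" by (rule card_le_card_shattered[OF assms(1,2)])
  also have "\<dots> \<le> card (\<Union>j\<le>D. {S. S \<subseteq> I \<and> card S = j})"
    using assms by (intro card_mono) (auto intro!: finite_UN_I)
  also have "\<dots> \<le> (\<Sum>j\<le>D. card {S. S \<subseteq> I \<and> card S = j})" by (intro card_UN_le) auto
  also have "\<dots> = (\<Sum>j\<le>D. card I choose j)" using assms(1) by (simp add: n_subsets)
  finally show ?thesis .
qed

text \<open>The classical bound (e m / D)^D in exponential form. Weighting by q = D / m turns the
  partial sum into a part of (1 + q)^m \<le> exp D, at the price of the factor q^D.\<close>

lemma sum_choose_le_exp:
  assumes "1 \<le> D" "D \<le> m"
  shows "real (\<Sum>j\<le>D. m choose j) \<le> exp (real D * (1 + ln (real m / real D)))"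
proof -
  define q where "q = real D / real m"
  have q: "0 < q" "q \<le> 1" using assms by (auto simp: q_def)
  have "q ^ D * real (\<Sum>j\<le>D. m choose j) = (\<Sum>j\<le>D. real (m choose j) * q ^ D)"
    by (simp add: sum_distrib_left sum_distrib_right mult.commute)
  also have "\<dots> \<le> (\<Sum>j\<le>D. real (m choose j) * q ^ j)"
    using q by (intro sum_mono mult_left_mono power_decreasing) auto
  also have "\<dots> \<le> (\<Sum>j\<le>m. real (m choose j) * q ^ j)"
    using q assms by (intro sum_mono2) auto
  also have "\<dots> = (q + 1) ^ m" by (subst binomial_ring) simp
  also have "\<dots> \<le> exp q ^ m" using q by (intro power_mono) (auto simp: add.commute)
  also have "\<dots> = exp (real D)" using assms by (simp add: exp_of_nat_mult[symmetric] q_def)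
  finally have "real (\<Sum>j\<le>D. m choose j) \<le> exp (real D) / q ^ D" using q by (simp add: field_simps)
  also have "\<dots> = exp (real D) * (1/q) ^ D" by (simp add: power_divide)
  also have "(1/q) ^ D = exp (real D * ln (1/q))" using q by (simp add: exp_of_nat_mult)
  also have "exp (real D) * \<dots> = exp (real D * (1 + ln (real m / real D)))"
    by (simp add: exp_add[symmetric] q_def algebra_simps)
  finally show ?thesis .
qed

section \<open>Growth functions of classes of predicates\<close>

definition traces :: "('p \<Rightarrow> bool) set \<Rightarrow> 'i set \<Rightarrow> ('i \<Rightarrow> 'p) \<Rightarrow> 'i set set" where
  "traces G I x = (\<lambda>g. {i\<in>I. g (x i)}) ` G"

text \<open>A VC dimension of at most \<open>D\<close> is used only through the number of traces it
  allows, so this count is taken as the definition. Samples are sequences because the points drawn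
  in \<open>packing_bound\<close> may repeat.\<close>

definition vc_bounded :: "('p \<Rightarrow> bool) set \<Rightarrow> nat \<Rightarrow> bool" where
  "vc_bounded G D \<longleftrightarrow> (\<forall>m (x::nat \<Rightarrow> 'p). card (traces G {..<m} x) \<le> (\<Sum>j\<le>D. m choose j))"

lemma traces_subset: "traces G I x \<subseteq> Pow I" by (auto simp: traces_def)

lemma finite_traces: "finite I \<Longrightarrow> finite (traces G I x)"
  using traces_subset finite_Pow_iff finite_subset by metis

lemma vc_bounded_mono: "vc_bounded G D \<Longrightarrow> H \<subseteq> G \<Longrightarrow> vc_bounded H D"
  unfolding vc_bounded_def
proof (intro allI)
  fix m and x :: "nat \<Rightarrow> 'a"
  assume a: "\<forall>m x. card (traces G {..<m} x) \<le> (\<Sum>j\<le>D. m choose j)" "H \<subseteq> G"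
  have "card (traces H {..<m} x) \<le> card (traces G {..<m} x)"
    using a(2) by (intro card_mono finite_traces) (auto simp: traces_def)
  then show "card (traces H {..<m} x) \<le> (\<Sum>j\<le>D. m choose j)" using a(1) le_trans by blast
qed

text \<open>Among more than \<open>D\<close> points the feature vectors are linearly dependent, say
  with coefficients \<open>c\<close>. No half-space selects exactly the points with
  \<open>c i > 0\<close>: otherwise all products \<open>c i * h i\<close> would be nonnegative and
  one of them positive, although their sum is 0. The half-spaces are homogeneous, so affine terms
  have to be supplied as features.\<close>

lemma vc_bounded_halfspaces:
  fixes \<phi> :: "'p \<Rightarrow> nat \<Rightarrow> real"
  shows "vc_bounded ((\<lambda>u p. 0 < (\<Sum>j<D. u j * \<phi> p j)) ` U) D"
  unfolding vc_bounded_def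
proof (intro allI)
  fix m and x :: "nat \<Rightarrow> 'p"
  let ?G = "(\<lambda>u p. 0 < (\<Sum>j<D. u j * \<phi> p j)) ` U"
  have "card (traces ?G {..<m} x) \<le> (\<Sum>j\<le>D. card {..<m} choose j)"
  proof (rule card_le_sum_choose)
    fix S assume sh: "shatters (traces ?G {..<m} x) S" and S: "S \<subseteq> {..<m}"
    show "card S \<le> D"
    proof (rule ccontr)
      assume "\<not> card S \<le> D"
      then have "card {..<D} < card S" by simp
      moreover have fS: "finite S" using S finite_subset by auto
      ultimately obtain c where c: "\<exists>i\<in>S. c i \<noteq> 0" "\<forall>j\<in>{..<D}. (\<Sum>i\<in>S. \<phi> (x i) j * c i) = 0"
        using underdetermined_system[of "{..<D}" S "\<lambda>j i. \<phi> (x i) j"] by auto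
      \<comment> \<open>Replacing \<open>c\<close> by its negative if necessary makes some
        coefficient positive. This point yields the strictly positive term of the final
        contradiction.\<close>
      obtain c where c: "\<exists>i\<in>S. c i > 0" "\<forall>j\<in>{..<D}. (\<Sum>i\<in>S. \<phi> (x i) j * c i) = 0"
      proof (cases "\<exists>i\<in>S. c i > 0")
        case True then show ?thesis using c that by auto
      next
        case False
        then have "\<exists>i\<in>S. - c i > 0" using c(1) by (metis neg_0_less_iff_less linorder_neqE_linordered_idom)
        then show ?thesis using c(2) that[of "\<lambda>i. - c i"] by (auto simp: sum_negf)
      qed
      obtain A where A: "A \<in> traces ?G {..<m} x" "A \<inter> S = {i\<in>S. c i > 0}"
        using shattersD[OF sh, of "{i\<in>S. c i > 0}"] by auto
      then obtain u where u: "A = {i\<in>{..<m}. 0 < (\<Sum>j<D. u j * \<phi> (x i) j)}" by (auto simp: traces_def)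
      define h where "h i = (\<Sum>j<D. u j * \<phi> (x i) j)" for i
      have h: "h i > 0 \<longleftrightarrow> c i > 0" if "i \<in> S" for i using A(2) u S that by (auto simp: h_def)
      have "(\<Sum>i\<in>S. c i * h i) = (\<Sum>j<D. u j * (\<Sum>i\<in>S. \<phi> (x i) j * c i))"
        unfolding h_def sum_distrib_left by (subst sum.swap) (simp add: algebra_simps)
      also have "\<dots> = 0" using c(2) by simp
      finally have 0: "(\<Sum>i\<in>S. c i * h i) = 0" .
      obtain i where i: "i\<in>S" "c i > 0" using c by auto
      have nn: "c k * h k \<ge> 0" if "k\<in>S" for k
        using h[OF that] by (cases "c k > 0") (auto intro: mult_nonpos_nonpos simp: not_less)
      have "c i * h i = 0" using 0 sum_nonneg_eq_0_iff[OF fS, of "\<lambda>i. c i * h i"] nn i by auto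
      then show False using i h[of i] by auto
    qed
  qed (auto simp: traces_def)
  then show "card (traces ?G {..<m} x) \<le> (\<Sum>j\<le>D. m choose j)" by simp
qed

section \<open>Packing numbers and sign averages\<close>

text \<open>The probabilistic method: a random sequence of \<open>m\<close> points separates all pairs.\<close>

lemma separating_sample:
  fixes \<Delta> :: "'v \<Rightarrow> 'v \<Rightarrow> 'i set"
  assumes I: "finite I" "I \<noteq> {}" and T: "finite T" "T \<noteq> {}"
    and sub: "\<And>A B. A \<in> T \<Longrightarrow> B \<in> T \<Longrightarrow> \<Delta> A B \<subseteq> I"
    and sep: "\<And>A B. A \<in> T \<Longrightarrow> B \<in> T \<Longrightarrow> A \<noteq> B \<Longrightarrow> \<epsilon> * real (card I) \<le> real (card (\<Delta> A B))"
    and m: "2 * ln (real (card T)) \<le> \<epsilon> * real m" and \<epsilon>: "0 < \<epsilon>"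
  shows "\<exists>f\<in>{..<m} \<rightarrow> I. \<forall>A\<in>T. \<forall>B\<in>T. A \<noteq> B \<longrightarrow> (\<exists>l<m. f l \<in> \<Delta> A B)"
proof (rule ccontr)
  assume neg: "\<not> ?thesis"
  let ?N = "real (card I)" and ?M = "card T"
  have N: "?N > 0" using I by (simp add: card_gt_0_iff)
  have M: "?M > 0" using T by (simp add: card_gt_0_iff)
  let ?P = "{p \<in> T \<times> T. fst p \<noteq> snd p}"
  let ?bad = "\<lambda>p. PiE {..<m} (\<lambda>_. I - \<Delta> (fst p) (snd p))"
  have "PiE {..<m} (\<lambda>_. I) \<subseteq> (\<Union>p\<in>?P. ?bad p)"
  proof
    fix f assume f: "f \<in> PiE {..<m} (\<lambda>_. I)"
    then have "f \<in> {..<m} \<rightarrow> I" by auto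
    then obtain A B where AB: "A\<in>T" "B\<in>T" "A \<noteq> B" "\<forall>l<m. f l \<notin> \<Delta> A B" using neg by blast
    then show "f \<in> (\<Union>p\<in>?P. ?bad p)" using f by (intro UN_I[of "(A,B)"]) (auto simp: PiE_iff)
  qed
  then have "card (PiE {..<m} (\<lambda>_. I)) \<le> card (\<Union>p\<in>?P. ?bad p)"
    using I T by (intro card_mono finite_UN_I finite_PiE) auto
  also have "\<dots> \<le> (\<Sum>p\<in>?P. card (?bad p))" using T by (intro card_UN_le) auto
  finally have "real (card (PiE {..<m} (\<lambda>_. I))) \<le> real (\<Sum>p\<in>?P. card (?bad p))"
    by (rule of_nat_mono)
  then have "real (card (PiE {..<m} (\<lambda>_. I))) \<le> (\<Sum>p\<in>?P. real (card (?bad p)))"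
    by (simp only: of_nat_sum)
  also have "\<dots> \<le> (\<Sum>p\<in>?P. (?N * exp (-\<epsilon>)) ^ m)"
  proof (intro sum_mono)
    fix p assume p: "p \<in> ?P"
    have "real (card (I - \<Delta> (fst p) (snd p))) = ?N - real (card (\<Delta> (fst p) (snd p)))"
      using sub[of "fst p" "snd p"] p I finite_subset[OF sub I(1)]
      by (subst card_Diff_subset) (auto simp: of_nat_diff card_mono)
    also have "\<dots> \<le> ?N * (1 - \<epsilon>)" using sep[of "fst p" "snd p"] p by (auto simp: algebra_simps)
    also have "\<dots> \<le> ?N * exp (-\<epsilon>)" using N exp_ge_add_one_self[of "-\<epsilon>"] by (intro mult_left_mono) auto
    finally show "real (card (?bad p)) \<le> (?N * exp (-\<epsilon>)) ^ m"
      by (auto simp: card_PiE intro!: power_mono)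
  qed
  also have "\<dots> = real (card ?P) * exp (-\<epsilon> * real m) * ?N ^ m"
    by (simp add: power_mult_distrib exp_of_nat_mult[symmetric] mult.commute)
  finally have 1: "1 \<le> real (card ?P) * exp (-\<epsilon> * real m)" using N by (simp add: card_PiE)
  \<comment> \<open>The diagonal is missing from \<open>?P\<close>. The contradiction rests on this
    strict inequality, since the hypothesis on \<open>m\<close> allows equality.\<close>
  have "card ?P < card (T \<times> T)"
  proof (intro psubset_card_mono psubsetI)
    obtain A where "A \<in> T" using T by blast
    then have "(A, A) \<in> T \<times> T" "(A, A) \<notin> ?P" by auto
    then show "?P \<noteq> T \<times> T" by metis
  qed (use T in auto)
  then have 2: "real (card ?P) < real ?M * real ?M" by (simp add: card_cartesian_product flip: of_nat_mult)
  have "exp (-\<epsilon> * real m) \<le> exp (- (ln (real ?M) + ln (real ?M)))" using m by simp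
  also have "\<dots> = 1 / (real ?M * real ?M)" using M by (simp only: exp_minus exp_add exp_ln of_nat_0_less_iff divide_inverse mult_1)
  finally have "real (card ?P) * exp (-\<epsilon> * real m) \<le> real (card ?P) * (1 / (real ?M * real ?M))"
    by (intro mult_left_mono) auto
  also have "\<dots> < 1"
  proof -
    have "0 < real ?M * real ?M" using M by simp
    then show ?thesis using 2 by (simp only: times_divide_eq_right mult_1_right pos_divide_less_eq mult_1)
  qed
  finally show False using 1 by simp
qed

text \<open>The slope 1/2 lets \<open>packing_bound\<close> absorb the term ln (L / D) into L /
  D.\<close>

lemma ln_le_half: "0 < x \<Longrightarrow> ln x \<le> (x::real) / 2"
proof -
  assume x: "0 < x"
  have "ln (x/2) \<le> x/2 - 1" using x by (intro ln_le_minus_one) auto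
  moreover have "ln (x/2) = ln x - ln 2" using x by (simp add: ln_div)
  moreover have "ln (2::real) \<le> 1" using ln_le_minus_one[of "2::real"] by simp
  ultimately show ?thesis by simp
qed

text \<open>With L = ln (card T), some sequence of m = O(L / \<epsilon>) points separates the
  members of \<open>T\<close>. So \<open>T\<close> embeds into the traces on these points, and L
  \<le> D (1 + ln (m / D)). Here m depends on L itself; ln x \<le> x / 2 resolves the recursion and
  leaves a bound that is free of \<open>card I\<close>.\<close>

lemma packing_bound:
  assumes vc: "vc_bounded G D" and D: "1 \<le> D" and I: "finite I" "I \<noteq> {}"
    and T: "T \<subseteq> traces G I x" "T \<noteq> {}" and \<epsilon>: "0 < \<epsilon>" "\<epsilon> \<le> 1"
    and sep: "\<And>A B. A \<in> T \<Longrightarrow> B \<in> T \<Longrightarrow> A \<noteq> B \<Longrightarrow> \<epsilon> * real (card I) \<le> real (card (sym_diff A B))"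
  shows "ln (real (card T)) \<le> real D * (5 + 2 * ln (1/\<epsilon>))"
proof -
  let ?M = "card T"
  have fT: "finite T" using T(1) finite_traces[OF I(1)] finite_subset by blast
  have M: "real ?M \<ge> 1" using fT T(2) by (simp add: Suc_le_eq card_gt_0_iff)
  define L where "L = ln (real ?M)"
  have l0: "0 \<le> ln (1/\<epsilon>)" using \<epsilon> by simp
  show ?thesis
  \<comment> \<open>The binomial estimate requires \<open>D \<le> m\<close>. This follows when
    \<open>L\<close> exceeds \<open>D\<close>; otherwise the claim is immediate because the second
    factor of the bound is at least 1.\<close>
  proof (cases "L \<le> real D")
    case True
    also have "real D \<le> real D * (5 + 2 * ln (1/\<epsilon>))" using D l0 mult_left_mono[of 1 "5 + 2 * ln (1/\<epsilon>)" "real D"] by simp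
    finally show ?thesis by (simp add: L_def)
  next
    case False
    define m where "m = nat \<lceil>2 * L / \<epsilon>\<rceil>"
    have Lp: "L > 1" using False D by linarith
    have Le: "L / \<epsilon> \<ge> L" using \<epsilon> Lp by (simp add: field_simps)
    have m1: "2 * L / \<epsilon> \<le> real m" unfolding m_def by linarith
    have m2: "real m \<le> 2 * L / \<epsilon> + 1" unfolding m_def using Lp \<epsilon> by (simp add: of_nat_nat)  
    have m3: "real m \<le> 3 * L / \<epsilon>" using m2 Le Lp by linarith
    have mD: "D \<le> m" using m1 Le False by linarith
    have "\<exists>f\<in>{..<m} \<rightarrow> I. \<forall>A\<in>T. \<forall>B\<in>T. A \<noteq> B \<longrightarrow> (\<exists>l<m. f l \<in> sym_diff A B)"
    proof (rule separating_sample[OF I fT T(2)])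
      show "sym_diff A B \<subseteq> I" if "A\<in>T" "B\<in>T" for A B using that T(1) traces_subset[of G I x] by blast
      show "2 * ln (real ?M) \<le> \<epsilon> * real m" using m1 \<epsilon> by (simp add: L_def field_simps)
    qed (use sep \<epsilon> in auto)
    then obtain f where f: "f \<in> {..<m} \<rightarrow> I"
      and dist: "\<forall>A\<in>T. \<forall>B\<in>T. A \<noteq> B \<longrightarrow> (\<exists>l<m. f l \<in> sym_diff A B)" by (elim bexE)
    have "inj_on (\<lambda>A. {l\<in>{..<m}. f l \<in> A}) T"
    proof (intro inj_onI, rule ccontr)
      fix A B assume AB: "A \<in> T" "B \<in> T" "{l\<in>{..<m}. f l \<in> A} = {l\<in>{..<m}. f l \<in> B}" "A \<noteq> B"
      then obtain l where "l < m" "f l \<in> sym_diff A B" using dist by meson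
      then show False using AB(3) by blast
    qed
    then have "?M = card ((\<lambda>A. {l\<in>{..<m}. f l \<in> A}) ` T)" by (simp add: card_image)
    also have "\<dots> \<le> card (traces G {..<m} (x \<circ> f))"
    proof (intro card_mono finite_traces image_subsetI)
      fix A assume "A \<in> T"
      then obtain g where "g\<in>G" "A = {i\<in>I. g (x i)}" using T(1) by (auto simp: traces_def)
      then show "{l\<in>{..<m}. f l \<in> A} \<in> traces G {..<m} (x \<circ> f)"
        using f by (auto simp: traces_def intro!: image_eqI[of _ _ g])
    qed auto
    also have "\<dots> \<le> (\<Sum>j\<le>D. m choose j)" using vc by (auto simp: vc_bounded_def)
    finally have "real ?M \<le> real (\<Sum>j\<le>D. m choose j)" by (rule of_nat_mono)
    also have "\<dots> \<le> exp (real D * (1 + ln (real m / real D)))" by (rule sum_choose_le_exp[OF D mD])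
    finally have "L \<le> real D * (1 + ln (real m / real D))"
      using M ln_mono[of "real ?M" "exp (real D * (1 + ln (real m / real D)))"] unfolding L_def by simp
    then have "L / real D \<le> 1 + ln (real m / real D)" using D by (simp add: field_simps)
    also have "ln (real m / real D) \<le> ln ((L / real D) * (3 / \<epsilon>))"
      using m3 mD D Lp \<epsilon> by (intro ln_mono) (auto simp: field_simps)
    also have "\<dots> = ln (L / real D) + (ln 3 + ln (1/\<epsilon>))"
      using \<epsilon> Lp D by (simp add: ln_mult ln_div)
    also have "ln (L / real D) \<le> L / real D / 2" using Lp D by (intro ln_le_half) auto
    also have "ln (3::real) \<le> 3/2" by (rule ln_le_half) simp
    finally have "L / real D \<le> 5 + 2 * ln (1/\<epsilon>)" by simp
    then show ?thesis using D by (simp add: L_def field_simps)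
  qed
qed

section \<open>Sub-Gaussian bounds for random signs\<close>

lemma sinh_le_mult_cosh:
  assumes "0 \<le> (x::real)" shows "sinh x \<le> x * cosh x"
proof -
  have "(\<lambda>x. x * cosh x - sinh x) 0 \<le> (\<lambda>x. x * cosh x - sinh x) x"
  proof (rule DERIV_nonneg_imp_nondecreasing[OF assms])
    fix y :: real assume "0 \<le> y" "y \<le> x"
    have "((\<lambda>x. x * cosh x - sinh x) has_real_derivative y * sinh y) (at y)"
      by (auto intro!: derivative_eq_intros)
    then show "\<exists>z. ((\<lambda>x. x * cosh x - sinh x) has_real_derivative z) (at y) \<and> 0 \<le> z"
      using \<open>0 \<le> y\<close> by (intro exI[of _ "y * sinh y"]) auto
  qed
  then show ?thesis by simp
qed

text \<open>The moment generating function of a random sign is at most that of a standard normal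
  variable: by \<open>sinh_le_mult_cosh\<close> the function exp (- x^2 / 2) cosh x does not
  increase for nonnegative x.\<close>

lemma cosh_le_exp_half_sq: "cosh (x::real) \<le> exp (x\<^sup>2 / 2)"
proof -
  have pos: "cosh y \<le> exp (y\<^sup>2 / 2)" if "0 \<le> y" for y :: real
  proof -
    let ?g = "\<lambda>x::real. exp (-(x\<^sup>2/2)) * cosh x"
    have "?g y \<le> ?g 0"
    proof (rule DERIV_nonpos_imp_nonincreasing[OF that])
      fix z :: real assume "0 \<le> z" "z \<le> y"
      have "(?g has_real_derivative exp (-(z\<^sup>2/2)) * (sinh z - z * cosh z)) (at z)"
        by (auto intro!: derivative_eq_intros simp: algebra_simps)
      then show "\<exists>y. (?g has_real_derivative y) (at z) \<and> y \<le> 0"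
        using sinh_le_mult_cosh[OF \<open>0 \<le> z\<close>] by (intro exI[of _ "exp (-(z\<^sup>2/2)) * (sinh z - z * cosh z)"]) (auto simp: mult_nonneg_nonpos)
    qed
    then show ?thesis by (simp add: exp_minus field_simps)
  qed
  show ?thesis using pos[of "\<bar>x\<bar>"] by (cases "x \<ge> 0") auto
qed

text \<open>Extensional functions form a finite set, so an average over random signs is a finite sum
  and involves no second probability space.\<close>

definition signs :: "'i set \<Rightarrow> ('i \<Rightarrow> real) set" where
  "signs I = PiE I (\<lambda>_. {-1, 1})"

lemma finite_signs: "finite I \<Longrightarrow> finite (signs I)"
  by (auto simp: signs_def intro: finite_PiE)

lemma card_signs: "finite I \<Longrightarrow> card (signs I) = 2 ^ card I"
  by (simp add: signs_def card_PiE numeral_2_eq_2)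

lemma sum_signs_exp:
  assumes "finite I"
  shows "(\<Sum>\<rho>\<in>signs I. exp (\<Sum>i\<in>I. \<rho> i * c i)) \<le> 2 ^ card I * exp ((\<Sum>i\<in>I. (c i)\<^sup>2) / 2)"
proof -
  have "(\<Sum>\<rho>\<in>signs I. exp (\<Sum>i\<in>I. \<rho> i * c i)) = (\<Sum>\<rho>\<in>signs I. \<Prod>i\<in>I. exp (\<rho> i * c i))"
    using assms by (simp add: exp_sum)
  also have "\<dots> = (\<Prod>i\<in>I. \<Sum>r\<in>{-1,1}. exp (r * c i))"
    unfolding signs_def using assms by (subst prod_sum_PiE) auto
  also have "\<dots> = (\<Prod>i\<in>I. 2 * cosh (c i))" by (intro prod.cong) (auto simp: cosh_def)
  also have "\<dots> \<le> (\<Prod>i\<in>I. 2 * exp ((c i)\<^sup>2 / 2))"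
    using cosh_le_exp_half_sq by (intro prod_mono) auto
  also have "\<dots> = 2 ^ card I * exp ((\<Sum>i\<in>I. (c i)\<^sup>2) / 2)"
    using assms by (simp add: prod.distrib exp_sum sum_divide_distrib)
  finally show ?thesis .
qed

text \<open>Massart's finite class lemma. The supremum over the class is expressed by an arbitrary
  selection \<open>v \<rho>\<close>, whose exponential is at most the sum of the exponentials over
  \<open>V\<close>. \<open>L\<close> may be any positive bound on ln (card V), so classes with one
  element are covered.\<close>

lemma finite_class_bound:
  fixes a :: "'v \<Rightarrow> 'i \<Rightarrow> real"
  assumes I: "finite I" and V: "finite V" and sel: "\<And>\<rho>. \<rho> \<in> signs I \<Longrightarrow> v \<rho> \<in> V"
    and R: "0 < R" "\<And>w. w \<in> V \<Longrightarrow> (\<Sum>i\<in>I. (a w i)\<^sup>2) \<le> R" and L: "0 < L" "ln (real (card V)) \<le> L"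
  shows "(\<Sum>\<rho>\<in>signs I. \<Sum>i\<in>I. \<rho> i * a (v \<rho>) i) \<le> 2 ^ card I * sqrt (2 * R * L)"
proof -
  \<comment> \<open>This \<open>l\<close> balances the exponents: l^2 R / 2 equals L, so the
    cardinality of \<open>V\<close> and the moment generating function contribute a factor exp L
    each.\<close>
  define l where "l = sqrt (2 * L / R)"
  have l: "0 < l" using R L by (simp add: l_def)
  have l2: "l\<^sup>2 * R = 2 * L" using R L by (simp add: l_def)
  have ne: "signs I \<noteq> {}" using card_signs[OF I] by (metis card.empty power_not_zero zero_neq_numeral)
  then have "V \<noteq> {}" using sel by blast
  then have cV: "real (card V) > 0" using V by (simp add: card_gt_0_iff)
  then have V_le: "real (card V) \<le> exp L" using L(2) by (metis exp_le_cancel_iff exp_ln)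
  let ?S = "\<lambda>\<rho>. \<Sum>i\<in>I. \<rho> i * a (v \<rho>) i"
  have "(\<Sum>\<rho>\<in>signs I. exp (l * ?S \<rho>)) \<le> (\<Sum>\<rho>\<in>signs I. \<Sum>w\<in>V. exp (l * (\<Sum>i\<in>I. \<rho> i * a w i)))"
    using sel V by (intro sum_mono member_le_sum) auto
  also have "\<dots> = (\<Sum>w\<in>V. \<Sum>\<rho>\<in>signs I. exp (\<Sum>i\<in>I. \<rho> i * (l * a w i)))"
    by (subst sum.swap) (simp add: sum_distrib_left algebra_simps)
  also have "\<dots> \<le> (\<Sum>w\<in>V. 2 ^ card I * exp L)"
  proof (intro sum_mono)
    fix w assume "w \<in> V"
    have "(\<Sum>i\<in>I. (l * a w i)\<^sup>2) = l\<^sup>2 * (\<Sum>i\<in>I. (a w i)\<^sup>2)" by (simp add: power_mult_distrib sum_distrib_left)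
    also have "\<dots> \<le> l\<^sup>2 * R" using R(2)[OF \<open>w\<in>V\<close>] by (intro mult_left_mono) auto
    finally have "(\<Sum>i\<in>I. (l * a w i)\<^sup>2) / 2 \<le> L" using l2 by simp
    then have "2 ^ card I * exp ((\<Sum>i\<in>I. (l * a w i)\<^sup>2) / 2) \<le> 2 ^ card I * exp L" by simp
    then show "(\<Sum>\<rho>\<in>signs I. exp (\<Sum>i\<in>I. \<rho> i * (l * a w i))) \<le> 2 ^ card I * exp L"
      using sum_signs_exp[OF I, of "\<lambda>i. l * a w i"] by linarith
  qed
  also have "\<dots> \<le> 2 ^ card I * exp (2 * L)"
  proof -
    have "real (card V) * exp L \<le> exp (2 * L)"
      using mult_right_mono[OF V_le, of "exp L"] by (simp only: mult_2 exp_add exp_ge_zero)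
    then have "2 ^ card I * (real (card V) * exp L) \<le> 2 ^ card I * exp (2 * L)" by (intro mult_left_mono) auto
    then show ?thesis by (simp only: sum_constant ac_simps)
  qed
  finally have E: "(\<Sum>\<rho>\<in>signs I. exp (l * ?S \<rho>)) \<le> 2 ^ card I * exp (2 * L)" .
  \<comment> \<open>The tangent of the exponential at \<open>2 * L\<close> replaces Jensen's inequality.\<close>
  have "(\<Sum>\<rho>\<in>signs I. l * ?S \<rho>) \<le> (\<Sum>\<rho>\<in>signs I. 2 * L - 1 + exp (- (2 * L)) * exp (l * ?S \<rho>))"
  proof (intro sum_mono)
    fix \<rho>
    show "l * ?S \<rho> \<le> 2 * L - 1 + exp (- (2 * L)) * exp (l * ?S \<rho>)"
      using exp_ge_add_one_self[of "l * ?S \<rho> - 2 * L"] by (simp add: exp_diff exp_minus field_simps)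
  qed
  also have "\<dots> = 2 ^ card I * (2 * L - 1) + exp (- (2 * L)) * (\<Sum>\<rho>\<in>signs I. exp (l * ?S \<rho>))"
    by (simp add: sum.distrib card_signs[OF I] sum_distrib_left)
  also have "\<dots> \<le> 2 ^ card I * (2 * L - 1) + exp (- (2 * L)) * (2 ^ card I * exp (2 * L))"
    using E by (intro add_left_mono mult_left_mono) auto
  also have "\<dots> = 2 ^ card I * (2 * L)" by (simp add: exp_minus algebra_simps)
  finally have "(\<Sum>\<rho>\<in>signs I. ?S \<rho>) \<le> 2 ^ card I * (2 * L / l)"
    using l by (simp add: sum_distrib_left[symmetric] field_simps)
  also have "2 * L / l = sqrt (2 * R * L)"
  proof -
    have "2 * R * L = (2 * L / l)\<^sup>2"
    proof -
      have "(2 * L / l)\<^sup>2 = (2*L)^2 / l^2" by (simp add: power_divide)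
      also have "l^2 = 2 * L / R" using R L by (simp add: l_def)
      also have "(2*L)^2 / (2 * L / R) = 2 * R * L" using R L by (simp add: field_simps power2_eq_square)
      finally show ?thesis by simp
    qed
    then show ?thesis using l L by (simp add: real_sqrt_abs)
  qed
  finally show ?thesis .
qed

section \<open>Chaining\<close>

text \<open>A separated subset of largest cardinality is a net, because a member of \<open>F\<close>
  at distance at least \<open>e\<close> from all its elements could be added to it.\<close>

lemma separated_net:
  fixes F :: "'i set set"
  assumes "finite F" "F \<noteq> {}" "0 < (e::real)" 
  shows "\<exists>T\<subseteq>F. T \<noteq> {} \<and> (\<forall>A\<in>T. \<forall>B\<in>T. A \<noteq> B \<longrightarrow> e \<le> real (card (sym_diff A B))) \<and>
     (\<forall>A\<in>F. \<exists>B\<in>T. real (card (sym_diff A B)) < e)"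
proof -
  define P where "P T \<longleftrightarrow> T \<subseteq> F \<and> (\<forall>A\<in>T. \<forall>B\<in>T. A \<noteq> B \<longrightarrow> e \<le> real (card (sym_diff A B)))" for T
  have "\<exists>T. P T \<and> (\<forall>T'. P T' \<longrightarrow> card T' \<le> card T)"
  proof (rule ex_has_greatest_nat[of P "{}" card "card F + 1"])
    show "P {}" by (simp add: P_def)
    show "\<forall>T. P T \<longrightarrow> card T < card F + 1" using assms(1) by (auto simp: P_def less_Suc_eq_le card_mono)
  qed
  then obtain T where T: "P T" "\<And>T'. P T' \<Longrightarrow> card T' \<le> card T" by blast
  have fT: "finite T" using T(1) assms(1) finite_subset by (auto simp: P_def)
  have cov: "\<exists>B\<in>T. real (card (sym_diff A B)) < e" if A: "A \<in> F" for A
  proof (rule ccontr)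
    assume n: "\<not> ?thesis"
    then have "A \<notin> T" using assms(3) by force
    have comm: "sym_diff B A = sym_diff A B" for B by blast
    have "e \<le> real (card (sym_diff A B))" if "B \<in> T" for B using n that by (simp add: not_less)
    then have "P (insert A T)" using T(1) A comm unfolding P_def by (metis (no_types, lifting) insert_iff insert_subset)
    from T(2)[OF this] show False using fT \<open>A \<notin> T\<close> by simp
  qed
  then have "T \<noteq> {}" using assms(2) by blast
  moreover have "\<forall>A\<in>F. \<exists>B\<in>T. real (card (sym_diff A B)) < e" using cov by (rule ballI)
  ultimately show ?thesis
    using T(1)[unfolded P_def] by (intro exI[of _ T] conjI) (elim conjE, assumption)+
qed

text \<open>The numerator is the entropy of two consecutive nets, (5 + 2 (k + 1)) + (5 + 2 k), and
  2^k comes from the squared length of a link. The numbers fit because (81/50) / 2 = (9/10)^2, while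
  Bernoulli's inequality for 81/50 = 1 + 62/100 dominates the linear growth.\<close>

lemma chaining_weight: "sqrt ((12 + 4 * real k) / 2 ^ k) \<le> 4 * (9/10) ^ k"
proof -
  have "1 + real k * (62/100) \<le> (1 + 62/100 :: real) ^ k"
    by (rule Bernoulli_inequality) simp
  then have "12 + 4 * real k \<le> 16 * (81/50 :: real) ^ k" by simp
  then have "(12 + 4 * real k) / 2 ^ k \<le> 16 * (81/50) ^ k / 2 ^ k" by (simp add: divide_right_mono)
  also have "\<dots> = (4 * (9/10) ^ k)\<^sup>2"
  proof -
    have "(81/50 :: real) ^ k / 2 ^ k = ((9/10)^2) ^ k" by (simp add: power_divide[symmetric] power2_eq_square)
    also have "\<dots> = ((9/10)^k)^2" by (simp add: power_mult[symmetric] mult.commute)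
    finally show ?thesis by (simp add: power_mult_distrib)
  qed
  finally show ?thesis by (intro real_le_lsqrt) auto
qed

lemma sum_indicator_diff_sq:
  assumes "finite I" "B \<subseteq> I" "C \<subseteq> I"
  shows "(\<Sum>i\<in>I. (indicator B i - indicator C i :: real)\<^sup>2) = real (card (sym_diff B C))"
proof -
  have "(\<Sum>i\<in>I. (indicator B i - indicator C i :: real)\<^sup>2) = (\<Sum>i\<in>I. indicator (sym_diff B C) i)"
    by (intro sum.cong) (auto simp: indicator_def)
  also have "\<dots> = real (card (I \<inter> sym_diff B C))"
    using assms(1) by (simp add: indicator_def sum_of_bool_eq del: Diff_iff Un_iff)
  also have "I \<inter> sym_diff B C = sym_diff B C" using assms by blast
  finally show ?thesis .
qed

text \<open>Chaining: \<open>p k (A \<rho>)\<close> approximates \<open>A \<rho>\<close> in a net of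
  scale N / 2^k, and the sum splits into its first approximation and the links between consecutive
  levels. The links of one level form a finite class with squared norms O(N / 2^k), so
  \<open>finite_class_bound\<close> applies and the levels add up to a geometric series. A single
  union bound over all traces would cost a factor sqrt (ln N) instead. The constant is 4 + 8 * 10,
  from level 0 and the series of ratio 9/10.\<close>

theorem rademacher_vc_bound:
  assumes vc: "vc_bounded G D" and D: "1 \<le> D" and I: "finite I" "I \<noteq> {}"
    and A: "\<And>\<rho>. \<rho> \<in> signs I \<Longrightarrow> A \<rho> \<in> traces G I x"
  shows "(\<Sum>\<rho>\<in>signs I. \<Sum>i\<in>A \<rho>. \<rho> i) \<le> 2 ^ card I * (84 * sqrt (real D * real (card I)))"
proof -
  let ?F = "traces G I x"
  let ?N = "real (card I)"
  have N: "?N \<ge> 1" using I by (simp add: Suc_le_eq card_gt_0_iff)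
  have "signs I \<noteq> {}" using card_signs[OF I(1)] by (metis card.empty power_not_zero zero_neq_numeral)
  then have F: "finite ?F" "?F \<noteq> {}" using A finite_traces[OF I(1)] by blast+
  have "\<exists>T\<subseteq>?F. T \<noteq> {} \<and> (\<forall>A\<in>T. \<forall>B\<in>T. A \<noteq> B \<longrightarrow> ?N / 2 ^ k \<le> real (card (sym_diff A B))) \<and>
     (\<forall>A\<in>?F. \<exists>B\<in>T. real (card (sym_diff A B)) < ?N / 2 ^ k)" for k :: nat
    using separated_net[OF F, of "?N / 2 ^ k"] N by simp
  then obtain T where T: "\<And>k. T k \<subseteq> ?F" "\<And>k. T k \<noteq> {}"
    "\<And>k A B. A\<in>T k \<Longrightarrow> B\<in>T k \<Longrightarrow> A \<noteq> B \<Longrightarrow> ?N / 2 ^ k \<le> real (card (sym_diff A B))"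
    "\<And>k A. A \<in> ?F \<Longrightarrow> \<exists>B\<in>T k. real (card (sym_diff A B)) < ?N / 2 ^ k"
    by metis
  define p where "p k A = (SOME B. B \<in> T k \<and> real (card (sym_diff A B)) < ?N / 2 ^ k)" for k A
  have pk: "p k A \<in> T k \<and> real (card (sym_diff A (p k A))) < ?N / 2 ^ k" if "A \<in> ?F" for k A
    unfolding p_def using T(4)[OF that, of k] unfolding Bex_def by (rule someI_ex)
  have p: "p k A \<in> T k" "real (card (sym_diff A (p k A))) < ?N / 2 ^ k" if "A \<in> ?F" for k A
    using pk[OF that, of k] by simp_all
  have TI: "B \<subseteq> I" if "B \<in> T k" for B k
    using subsetD[OF traces_subset subsetD[OF T(1) that]] by simp
  have AI: "A \<rho> \<subseteq> I" if "\<rho> \<in> signs I" for \<rho>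
    using subsetD[OF traces_subset A[OF that]] by simp
  have finT: "finite (T k)" for k using T(1) F finite_subset by blast
  have cardT: "1 \<le> card (T k)" for k using T(2)[of k] finT[of k] by (simp add: Suc_le_eq card_gt_0_iff)
  have lnT: "ln (real (card (T k))) \<le> real D * (5 + 2 * real k)" for k
  proof -
    have "ln (real (card (T k))) \<le> real D * (5 + 2 * ln (1 / (1 / 2 ^ k)))"
      by (rule packing_bound[OF vc D I T(1) T(2)]) (use T(3) in auto)
    also have "ln (1 / (1 / 2 ^ k)) = real k * ln (2::real)" by (simp add: ln_realpow)
    also have "\<dots> \<le> real k * 1" using ln_le_minus_one[of "2::real"] by (intro mult_left_mono) auto
    finally show ?thesis by (simp add: mult_left_mono)
  qed
  define X where "X \<rho> B = (\<Sum>i\<in>I. \<rho> i * indicator B i)" for \<rho> :: "_ \<Rightarrow> real" and B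
  have XA: "(\<Sum>i\<in>B. \<rho> i) = X \<rho> B" if "B \<subseteq> I" for \<rho> B
  proof -
    have "X \<rho> B = (\<Sum>i\<in>I. if i \<in> B then \<rho> i else 0)"
      unfolding X_def by (intro sum.cong) (auto simp: indicator_def)
    also have "\<dots> = (\<Sum>i\<in>I \<inter> B. \<rho> i)" using I(1) by (simp add: sum.inter_restrict)
    finally show ?thesis using that by (simp add: Int_absorb1)
  qed
  have base: "(\<Sum>\<rho>\<in>signs I. X \<rho> (p 0 (A \<rho>))) \<le> 2 ^ card I * sqrt (2 * ?N * (real D * 5))"
    unfolding X_def
  proof (rule finite_class_bound[OF I(1) finT[of 0]])
    show "(\<Sum>i\<in>I. (indicator w i)\<^sup>2) \<le> ?N" if "w \<in> T 0" for w
    proof -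
      have "(\<Sum>i\<in>I. (indicator w i :: real)\<^sup>2) \<le> (\<Sum>i\<in>I. 1)" by (intro sum_mono) (auto simp: indicator_def)
      then show ?thesis by simp
    qed
    show "ln (real (card (T 0))) \<le> real D * 5" using lnT[of 0] by simp
  qed (use p A N D in auto)
  have step: "(\<Sum>\<rho>\<in>signs I. X \<rho> (p (Suc k) (A \<rho>)) - X \<rho> (p k (A \<rho>)))
      \<le> 2 ^ card I * (2 * sqrt (real D * ?N) * (4 * (9/10) ^ k))" for k
  proof -
    define V where "V = {q \<in> T (Suc k) \<times> T k. real (card (sym_diff (fst q) (snd q))) \<le> 2 * ?N / 2 ^ k}"
    have V: "finite V" unfolding V_def using finT by auto
    have sel: "(p (Suc k) (A \<rho>), p k (A \<rho>)) \<in> V" if \<rho>: "\<rho> \<in> signs I" for \<rho>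
    proof -
      let ?B = "p (Suc k) (A \<rho>)" and ?C = "p k (A \<rho>)"
      have "finite (sym_diff (A \<rho>) ?B \<union> sym_diff (A \<rho>) ?C)"
        using AI[OF \<rho>] TI[OF p(1)[OF A[OF \<rho>]]]
        by (intro finite_subset[OF _ I(1)]) blast
      then have "card (sym_diff ?B ?C) \<le> card (sym_diff (A \<rho>) ?B \<union> sym_diff (A \<rho>) ?C)"
        by (intro card_mono) auto
      also have "\<dots> \<le> card (sym_diff (A \<rho>) ?B) + card (sym_diff (A \<rho>) ?C)" by (rule card_Un_le)
      finally have "real (card (sym_diff ?B ?C)) \<le> real (card (sym_diff (A \<rho>) ?B)) + real (card (sym_diff (A \<rho>) ?C))"
        by (simp flip: of_nat_add)
      also have "\<dots> \<le> ?N / 2 ^ Suc k + ?N / 2 ^ k"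
        using p(2)[OF A[OF \<rho>], of "Suc k"] p(2)[OF A[OF \<rho>], of k] by simp
      also have "\<dots> \<le> 2 * ?N / 2 ^ k" using N by (simp add: field_simps)
      finally show ?thesis using p(1)[OF A[OF \<rho>]] by (simp add: V_def)
    qed
    have "(\<Sum>\<rho>\<in>signs I. X \<rho> (p (Suc k) (A \<rho>)) - X \<rho> (p k (A \<rho>)))
      = (\<Sum>\<rho>\<in>signs I. \<Sum>i\<in>I. \<rho> i * (\<lambda>q i. indicator (fst q) i - indicator (snd q) i) (p (Suc k) (A \<rho>), p k (A \<rho>)) i)"
      by (simp add: X_def sum_subtractf algebra_simps)
    also have "\<dots> \<le> 2 ^ card I * sqrt (2 * (2 * ?N / 2 ^ k) * (real D * (12 + 4 * real k)))"
    proof (rule finite_class_bound[OF I(1) V sel])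
      show "(\<Sum>i\<in>I. (indicator (fst w) i - indicator (snd w) i)\<^sup>2) \<le> 2 * ?N / 2 ^ k" if "w \<in> V" for w
      proof -
        have w: "fst w \<in> T (Suc k)" "snd w \<in> T k" using that by (auto simp: V_def)
        then show ?thesis using that by (subst sum_indicator_diff_sq[OF I(1) TI TI]) (simp_all add: V_def)
      qed
      have "card V \<le> card (T (Suc k) \<times> T k)" unfolding V_def using finT by (intro card_mono) auto
      moreover have "0 < card V"
        using V sel \<open>signs I \<noteq> {}\<close> by (auto simp: card_gt_0_iff)
      ultimately have "ln (real (card V)) \<le> ln (real (card (T (Suc k))) * real (card (T k)))"
        by (intro ln_mono) (auto simp: card_cartesian_product simp flip: of_nat_mult)
      also have "\<dots> = ln (real (card (T (Suc k)))) + ln (real (card (T k)))"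
        using cardT[of k] cardT[of "Suc k"] by (subst ln_mult) auto
      also have "\<dots> \<le> real D * (12 + 4 * real k)" using lnT[of k] lnT[of "Suc k"] by (simp add: algebra_simps)
      finally show "ln (real (card V)) \<le> real D * (12 + 4 * real k)" .
    qed (use N D in auto)
    also have "2 * (2 * ?N / 2 ^ k) * (real D * (12 + 4 * real k)) = 4 * (real D * ?N) * ((12 + 4 * real k) / 2 ^ k)"
      by simp
    also have "sqrt \<dots> = 2 * sqrt (real D * ?N) * sqrt ((12 + 4 * real k) / 2 ^ k)"
      by (simp only: real_sqrt_mult real_sqrt_four)
    also have "\<dots> \<le> 2 * sqrt (real D * ?N) * (4 * (9/10) ^ k)"
      by (rule mult_left_mono[OF chaining_weight]) simp
    finally show ?thesis by - (simp only: mult_le_cancel_left_pos zero_less_power zero_less_numeral)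
  qed
  \<comment> \<open>At this level the distance to the net is below 1, hence 0: the chain ends
    exactly at \<open>A \<rho>\<close> and leaves no remainder.\<close>
  obtain K where K: "?N < 2 ^ K" using real_arch_pow[of 2 ?N] by auto
  have last: "p K (A \<rho>) = A \<rho>" if \<rho>: "\<rho> \<in> signs I" for \<rho>
  proof -
    have "real (card (sym_diff (A \<rho>) (p K (A \<rho>)))) < ?N / 2 ^ K" by (rule p(2)[OF A[OF \<rho>]])
    also have "\<dots> < 1" using K by simp
    finally have "card (sym_diff (A \<rho>) (p K (A \<rho>))) = 0" by simp
    moreover have "finite (sym_diff (A \<rho>) (p K (A \<rho>)))"
      using AI[OF \<rho>] TI[OF p(1)[OF A[OF \<rho>]]]
      by (intro finite_subset[OF _ I(1)]) blast
    ultimately show ?thesis by auto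
  qed
  have "(\<Sum>\<rho>\<in>signs I. \<Sum>i\<in>A \<rho>. \<rho> i) = (\<Sum>\<rho>\<in>signs I. X \<rho> (p K (A \<rho>)))"
    by (intro sum.cong refl) (simp add: last XA AI)
  also have "\<dots> = (\<Sum>\<rho>\<in>signs I. X \<rho> (p 0 (A \<rho>)) + (\<Sum>k<K. X \<rho> (p (Suc k) (A \<rho>)) - X \<rho> (p k (A \<rho>))))"
    by (intro sum.cong refl) (simp only: sum_lessThan_telescope[of "\<lambda>k. X _ (p k (A _))"] add_diff_cancel_left' diff_add_cancel add.commute[of "X _ (p 0 (A _))"])
  also have "\<dots> = (\<Sum>\<rho>\<in>signs I. X \<rho> (p 0 (A \<rho>))) + (\<Sum>k<K. \<Sum>\<rho>\<in>signs I. X \<rho> (p (Suc k) (A \<rho>)) - X \<rho> (p k (A \<rho>)))"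
    by (simp only: sum.distrib sum.swap[of _ "signs I" "{..<K}"])
  also have "\<dots> \<le> 2 ^ card I * sqrt (2 * ?N * (real D * 5)) + (\<Sum>k<K. 2 ^ card I * (2 * sqrt (real D * ?N) * (4 * (9/10) ^ k)))"
    by (intro add_mono sum_mono base step)
  also have "\<dots> = 2 ^ card I * (sqrt (2 * ?N * (real D * 5)) + 8 * sqrt (real D * ?N) * (\<Sum>k<K. (9/10) ^ k))"
  proof -
    have "(\<Sum>k<K. 2 ^ card I * (2 * sqrt (real D * ?N) * (4 * (9/10) ^ k))) =
        2 ^ card I * (8 * sqrt (real D * ?N) * (\<Sum>k<K. (9/10) ^ k))"
      unfolding sum_distrib_left by (intro sum.cong refl) simp
    then show ?thesis by (simp only: distrib_left)
  qed
  also have "\<dots> \<le> 2 ^ card I * (4 * sqrt (real D * ?N) + 8 * sqrt (real D * ?N) * 10)"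
  proof (intro mult_left_mono add_mono)
    have "2 * ?N * (real D * 5) \<le> 16 * (real D * ?N)" using D N by simp
    then have "sqrt (2 * ?N * (real D * 5)) \<le> sqrt (16 * (real D * ?N))" by (rule real_sqrt_le_mono)
    also have "\<dots> = 4 * sqrt (real D * ?N)" by (simp only: real_sqrt_mult[of 16]) simp
    finally show "sqrt (2 * ?N * (real D * 5)) \<le> 4 * sqrt (real D * ?N)" .
    have "(\<Sum>k<K. (9/10 :: real) ^ k) = (1 - (9/10)^K) / (1 - 9/10)" by (subst sum_gp_strict) auto
    also have "\<dots> \<le> 10" by simp
    finally show "(\<Sum>k<K. (9/10 :: real) ^ k) \<le> 10" .
  qed auto
  finally show ?thesis by simp
qed

section \<open>Symmetrization\<close>

text \<open>Equality is checked on rectangles, where Fubini's theorem and the product formula factor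
  the integral over the coordinates. The lemma serves to exchange a sample with its independent
  copy, and later to assemble the contaminated sample from data, bits and outliers.\<close>

lemma distr_PiM_pair:
  assumes fin: "finite I" and M: "\<And>i. prob_space (M i)" and N: "\<And>i. prob_space (N i)"
    and h[measurable]: "\<And>i. h i \<in> M i \<Otimes>\<^sub>M N i \<rightarrow>\<^sub>M L i"
  shows "distr (PiM I M \<Otimes>\<^sub>M PiM I N) (PiM I L) (\<lambda>p. \<lambda>i\<in>I. h i (fst p i, snd p i)) =
    PiM I (\<lambda>i. distr (M i \<Otimes>\<^sub>M N i) (L i) (h i))" (is "?D = PiM I ?L")
proof -
  interpret M: product_prob_space M by (rule product_prob_spaceI[OF M])
  interpret N: product_prob_space N by (rule product_prob_spaceI[OF N])
  interpret PN: prob_space "PiM I N" by (rule prob_space_PiM) (rule N)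
  have pL: "prob_space (?L i)" for i
  proof -
    interpret pair_prob_space "M i" "N i" by (intro pair_prob_space.intro pair_sigma_finite.intro prob_space_imp_sigma_finite M N)
    show ?thesis by (rule prob_space_distr) (rule h)
  qed
  interpret L: product_prob_space ?L by (rule product_prob_spaceI[OF pL])
  show ?thesis
  proof (rule L.PiM_eqI[OF fin])
    show "sets ?D = sets (PiM I ?L)" by (simp cong: sets_PiM_cong)
    fix A assume A': "\<And>i. i \<in> I \<Longrightarrow> A i \<in> sets (?L i)"
    then have A[measurable]: "\<And>i. i \<in> I \<Longrightarrow> A i \<in> sets (L i)" by simp
    have hm: "(\<lambda>p. \<lambda>i\<in>I. h i (fst p i, snd p i)) \<in> PiM I M \<Otimes>\<^sub>M PiM I N \<rightarrow>\<^sub>M PiM I L"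
      by (rule measurable_restrict) measurable
    have PA: "Pi\<^sub>E I A \<in> sets (PiM I L)" using fin A by (intro sets_PiM_I_finite) auto
    have "emeasure ?D (Pi\<^sub>E I A) = (\<integral>\<^sup>+p. indicator (Pi\<^sub>E I A) (\<lambda>i\<in>I. h i (fst p i, snd p i)) \<partial>(PiM I M \<Otimes>\<^sub>M PiM I N))"
      using hm PA by (simp add: nn_integral_distr flip: nn_integral_indicator)
    also have "\<dots> = (\<integral>\<^sup>+p. (\<Prod>i\<in>I. indicator (A i) (h i (fst p i, snd p i))) \<partial>(PiM I M \<Otimes>\<^sub>M PiM I N))"
    proof (intro nn_integral_cong)
      fix p assume "p \<in> space (PiM I M \<Otimes>\<^sub>M PiM I N)"
      show "indicator (Pi\<^sub>E I A) (\<lambda>i\<in>I. h i (fst p i, snd p i)) = (\<Prod>i\<in>I. indicator (A i) (h i (fst p i, snd p i)) :: ennreal)"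
      proof (cases "\<forall>i\<in>I. h i (fst p i, snd p i) \<in> A i")
        case True
        then have "(\<lambda>i\<in>I. h i (fst p i, snd p i)) \<in> Pi\<^sub>E I A" by auto
        then show ?thesis using True by simp
      next
        case False
        then obtain i where i: "i\<in>I" "h i (fst p i, snd p i) \<notin> A i" by auto
        have "(\<lambda>i\<in>I. h i (fst p i, snd p i)) \<notin> Pi\<^sub>E I A"
        proof
          assume "(\<lambda>i\<in>I. h i (fst p i, snd p i)) \<in> Pi\<^sub>E I A"
          from PiE_mem[OF this i(1)] show False using i by simp
        qed
        moreover have "indicator (A i) (h i (fst p i, snd p i)) = (0::ennreal)" using i(2) by (rule indicator_simps)
        then have "(\<Prod>i\<in>I. indicator (A i) (h i (fst p i, snd p i)) :: ennreal) = 0"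
          by (intro prod_zero[OF fin] bexI[OF _ i(1)])
        ultimately show ?thesis by (simp only: indicator_simps not_False_eq_True)
      qed
    qed
    also have "\<dots> = (\<integral>\<^sup>+x. \<integral>\<^sup>+y. (\<Prod>i\<in>I. indicator (A i) (h i (x i, y i))) \<partial>PiM I N \<partial>PiM I M)"
    proof (subst sigma_finite_measure.nn_integral_fst[OF prob_space_imp_sigma_finite[OF prob_space_PiM[OF N]], symmetric])
      show "(\<lambda>p. \<Prod>i\<in>I. indicator (A i) (h i (fst p i, snd p i)) :: ennreal) \<in> borel_measurable (PiM I M \<Otimes>\<^sub>M PiM I N)"
        by (intro borel_measurable_prod_ennreal) measurable
    qed simp
    also have "\<dots> = (\<integral>\<^sup>+x. (\<Prod>i\<in>I. \<integral>\<^sup>+b. indicator (A i) (h i (x i, b)) \<partial>N i) \<partial>PiM I M)"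
    proof (intro nn_integral_cong)
      fix x assume x: "x \<in> space (PiM I M)"
      show "(\<integral>\<^sup>+y. (\<Prod>i\<in>I. indicator (A i) (h i (x i, y i))) \<partial>PiM I N) = (\<Prod>i\<in>I. \<integral>\<^sup>+b. indicator (A i) (h i (x i, b)) \<partial>N i)"
      proof (rule N.product_nn_integral_prod[OF fin])
        fix i assume i: "i \<in> I"
        then have "x i \<in> space (M i)" using x by (auto simp: space_PiM)
        then show "(\<lambda>b. indicator (A i) (h i (x i, b)) :: ennreal) \<in> borel_measurable (N i)" using i by measurable
      qed
    qed
    also have "\<dots> = (\<Prod>i\<in>I. \<integral>\<^sup>+a. \<integral>\<^sup>+b. indicator (A i) (h i (a, b)) \<partial>N i \<partial>M i)"
    proof (rule M.product_nn_integral_prod[OF fin])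
      fix i assume i[measurable]: "i \<in> I"
      interpret Ni: prob_space "N i" by (rule N)
      show "(\<lambda>a. \<integral>\<^sup>+b. indicator (A i) (h i (a, b)) \<partial>N i) \<in> borel_measurable (M i)" by measurable
    qed
    also have "\<dots> = (\<Prod>i\<in>I. emeasure (?L i) (A i))"
    proof (intro prod.cong refl)
      fix i assume i: "i \<in> I"
      interpret Ni: prob_space "N i" by (rule N)
      have "emeasure (?L i) (A i) = (\<integral>\<^sup>+p. indicator (A i) (h i p) \<partial>(M i \<Otimes>\<^sub>M N i))"
        using A[OF i] by (simp add: nn_integral_distr flip: nn_integral_indicator)
      also have "\<dots> = (\<integral>\<^sup>+a. \<integral>\<^sup>+b. indicator (A i) (h i (a, b)) \<partial>N i \<partial>M i)"
      proof (subst sigma_finite_measure.nn_integral_fst[OF prob_space_imp_sigma_finite[OF N], symmetric])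
        show "(\<lambda>p. indicator (A i) (h i p) :: ennreal) \<in> borel_measurable (M i \<Otimes>\<^sub>M N i)"
          using A[OF i] by measurable
      qed simp
      finally show "(\<integral>\<^sup>+a. \<integral>\<^sup>+b. indicator (A i) (h i (a, b)) \<partial>N i \<partial>M i) = emeasure (?L i) (A i)" ..
    qed
    finally show "emeasure ?D (Pi\<^sub>E I A) = (\<Prod>i\<in>I. emeasure (?L i) (A i))" .
  qed
qed

text \<open>The exchangeability behind the insertion of random signs in
  \<open>symmetrization_expectation\<close>.\<close>

lemma distr_pair_swap_if:
  assumes "prob_space P"
  shows "distr (P \<Otimes>\<^sub>M P) (P \<Otimes>\<^sub>M P) (\<lambda>p. if c then p else (snd p, fst p)) = P \<Otimes>\<^sub>M P"
proof (cases c)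
  case True then show ?thesis by (simp add: distr_id)
next
  case False
  interpret pair_prob_space P P by (intro pair_prob_space.intro pair_sigma_finite.intro prob_space_imp_sigma_finite assms)
  have *: "(\<lambda>p. if c then p else (snd p, fst p)) = (\<lambda>(x, y). (y, x))" using False by auto
  show ?thesis unfolding * by (rule distr_pair_swap[symmetric])
qed

lemma Max_image_attained:
  assumes "finite G" "G \<noteq> {}"
  shows "\<exists>g. g \<in> G \<and> (MAX g\<in>G. F g) = (F g :: real)"
proof -
  have "(MAX g\<in>G. F g) \<in> F ` G" using assms by (intro Max_in) auto
  then show ?thesis by auto
qed

text \<open>Symmetrization by an independent copy of the sample. Exchanging the two copies at any
  set of indices preserves their joint law, so the expectation may be averaged over all sign
  vectors. For a fixed pair of samples \<open>rademacher_vc_bound\<close> applies to each of them,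
  whence 168 = 2 * 84. \<open>G\<close> is finite, so the maximum is measurable and attained. The
  sample is indexed by \<open>J\<close> although only \<open>I\<close> is counted, because it will
  be the whole data set.\<close>

theorem symmetrization_expectation:
  fixes P :: "'p measure" and I J :: "'i set"
  assumes P: "prob_space P" and J: "finite J" and I: "I \<subseteq> J" "I \<noteq> {}" and G: "finite G" "G \<noteq> {}"
    and Gm[measurable]: "\<And>g. g \<in> G \<Longrightarrow> Measurable.pred P g" and vc: "vc_bounded G D" and D: "1 \<le> D"
  shows "(\<integral>x. (MAX g\<in>G. \<Sum>i\<in>I. of_bool (g (x i)) - measure P {p\<in>space P. g p}) \<partial>PiM J (\<lambda>_. P))
     \<le> 168 * sqrt (real D * real (card I))" (is "?E \<le> ?B")
proof -
  interpret P: prob_space P by fact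
  interpret PJ: product_prob_space "\<lambda>_. P" by (rule product_prob_spaceI) fact
  let ?\<mu> = "PiM J (\<lambda>_. P)"
  interpret \<mu>: prob_space ?\<mu> by (rule prob_space_PiM) (rule P)
  interpret \<mu>\<mu>: pair_prob_space ?\<mu> ?\<mu>
    by (intro pair_prob_space.intro pair_sigma_finite.intro prob_space_imp_sigma_finite \<mu>.prob_space_axioms)
  let ?q = "\<lambda>g. measure P {p\<in>space P. g p}"
  let ?\<nu> = "PiM J (\<lambda>_. P \<Otimes>\<^sub>M P)"
  have fI: "finite I" using I J finite_subset by blast
  have IJ[measurable]: "i \<in> I \<Longrightarrow> i \<in> J" for i using I by auto
  let ?N = "real (card I)"
  define S where "S x = (MAX g\<in>G. \<Sum>i\<in>I. of_bool (g (x i)) - ?q g)" for x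
  define T where "T z = (MAX g\<in>G. \<Sum>i\<in>I. of_bool (g (fst (z i))) - of_bool (g (snd (z i))) :: real)" for z :: "'i \<Rightarrow> 'p \<times> 'p"
  define pr where "pr c p = (\<lambda>i\<in>J. (\<lambda>q. if c i then q else (snd q, fst q)) (fst p i, snd p i))"
    for c :: "'i \<Rightarrow> bool" and p :: "('i \<Rightarrow> 'p) \<times> ('i \<Rightarrow> 'p)"
  have Sm[measurable]: "S \<in> borel_measurable ?\<mu>"
    unfolding S_def[abs_def] using G by (intro borel_measurable_Max borel_measurable_sum) measurable
  have Tm[measurable]: "T \<in> borel_measurable ?\<nu>"
    unfolding T_def[abs_def] using G by (intro borel_measurable_Max borel_measurable_sum) measurable
  have prm[measurable]: "pr c \<in> ?\<mu> \<Otimes>\<^sub>M ?\<mu> \<rightarrow>\<^sub>M ?\<nu>" for c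
    unfolding pr_def[abs_def] by measurable
  have pr: "distr (?\<mu> \<Otimes>\<^sub>M ?\<mu>) ?\<nu> (pr c) = ?\<nu>" for c
  proof -
    have "distr (?\<mu> \<Otimes>\<^sub>M ?\<mu>) ?\<nu> (pr c) = PiM J (\<lambda>i. distr (P \<Otimes>\<^sub>M P) (P \<Otimes>\<^sub>M P) (\<lambda>q. if c i then q else (snd q, fst q)))"
      unfolding pr_def[abs_def] by (rule distr_PiM_pair[OF J P P]) simp
    then show ?thesis by (simp only: distr_pair_swap_if[OF P])
  qed
  have abs_le: "\<bar>(\<Sum>i\<in>I. f i)\<bar> \<le> ?N" if "\<And>i. i\<in>I \<Longrightarrow> \<bar>f i :: real\<bar> \<le> 1" for f
  proof -
    have "\<bar>(\<Sum>i\<in>I. f i)\<bar> \<le> (\<Sum>i\<in>I. \<bar>f i\<bar>)" by (rule sum_abs)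
    also have "\<dots> \<le> (\<Sum>i\<in>I. 1)" using that by (intro sum_mono) auto
    finally show ?thesis by simp
  qed
  have Sb: "\<bar>S x\<bar> \<le> ?N" for x
  proof -
    obtain g where g: "S x = (\<Sum>i\<in>I. of_bool (g (x i)) - ?q g)"
      unfolding S_def using Max_image_attained[OF G, of "\<lambda>g. \<Sum>i\<in>I. of_bool (g (x i)) - ?q g"] by blast
    have ob: "\<bar>of_bool b - m\<bar> \<le> 1" if "0 \<le> m" "m \<le> 1" for b and m :: real
      using that by (auto simp: of_bool_def)
    have "\<bar>of_bool (g (x i)) - ?q g\<bar> \<le> 1" for i
      by (rule ob) (rule measure_nonneg, rule P.prob_le_1)
    then show ?thesis unfolding g by (intro abs_le)
  qed
  have Tb: "\<bar>T z\<bar> \<le> ?N" for z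
  proof -
    obtain g where g: "T z = (\<Sum>i\<in>I. of_bool (g (fst (z i))) - of_bool (g (snd (z i))))"
      unfolding T_def using Max_image_attained[OF G, of "\<lambda>g. \<Sum>i\<in>I. of_bool (g (fst (z i))) - of_bool (g (snd (z i)))"] by blast
    show ?thesis unfolding g by (intro abs_le) (simp add: of_bool_def)
  qed
  have Tint: "integrable (?\<mu> \<Otimes>\<^sub>M ?\<mu>) (\<lambda>p. T (pr c p))" for c
    by (rule \<mu>\<mu>.P.integrable_const_bound[of _ ?N]) (use Tb in auto)
  have q: "(\<integral>y. of_bool (g (y i)) \<partial>?\<mu>) = ?q g" if "g \<in> G" "i \<in> I" for g i
  proof -
    have gm: "{p\<in>space P. g p} \<in> sets P" using that by measurable
    have "(\<integral>y. of_bool (g (y i)) \<partial>?\<mu>) = (\<integral>y. indicat_real {p\<in>space P. g p} (y i) \<partial>?\<mu>)"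
      using that I by (intro Bochner_Integration.integral_cong refl) (auto simp: space_PiM indicator_def PiE_iff)
    also have "\<dots> = (\<integral>p. indicat_real {p\<in>space P. g p} p \<partial>(distr ?\<mu> P (\<lambda>y. y i)))"
    proof -
      have 1: "(\<lambda>y. y i) \<in> ?\<mu> \<rightarrow>\<^sub>M P" using that I by (intro measurable_component_singleton) auto
      have 2: "(indicator {p\<in>space P. g p} :: 'p \<Rightarrow> real) \<in> borel_measurable P" using gm by measurable
      show ?thesis using integral_distr[OF 1 2] by (simp only:)
    qed
    also have "distr ?\<mu> P (\<lambda>y. y i) = P" using that I by (intro distr_PiM_component P) auto
    finally show ?thesis using gm by simp
  qed
  \<comment> \<open>Jensen's inequality by hand: the class member that attains the maximum at
    \<open>x\<close> is kept fixed while the copy \<open>y\<close> is averaged out.\<close>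
  have step1: "S x \<le> (\<integral>y. T (pr (\<lambda>_. True) (x, y)) \<partial>?\<mu>)" if x: "x \<in> space ?\<mu>" for x
  proof -
    obtain g where g: "g \<in> G" "S x = (\<Sum>i\<in>I. of_bool (g (x i)) - ?q g)"
      unfolding S_def using Max_image_attained[OF G, of "\<lambda>g. \<Sum>i\<in>I. of_bool (g (x i)) - ?q g"] by blast
    have ob: "integrable ?\<mu> (\<lambda>y. of_bool (g (y i)) :: real)" if "i \<in> I" for i
      by (rule \<mu>.integrable_const_bound[of _ 1]) (use g that in auto)
    have "S x = (\<Sum>i\<in>I. \<integral>y. of_bool (g (x i)) - of_bool (g (y i)) \<partial>?\<mu>)"
      unfolding g(2) using q[OF g(1)] ob by (intro sum.cong refl) (simp add: \<mu>.prob_space)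
    also have "\<dots> = (\<integral>y. (\<Sum>i\<in>I. of_bool (g (x i)) - of_bool (g (y i))) \<partial>?\<mu>)"
      using ob by (subst Bochner_Integration.integral_sum) auto
    also have "\<dots> \<le> (\<integral>y. T (pr (\<lambda>_. True) (x, y)) \<partial>?\<mu>)"
    proof (rule integral_mono)
      show "integrable ?\<mu> (\<lambda>y. \<Sum>i\<in>I. of_bool (g (x i)) - of_bool (g (y i)) :: real)"
        using ob by (intro Bochner_Integration.integrable_sum Bochner_Integration.integrable_diff) auto
      show "integrable ?\<mu> (\<lambda>y. T (pr (\<lambda>_. True) (x, y)))"
        by (rule \<mu>.integrable_const_bound[of _ ?N]) (use Tb x in auto)
      fix y
      have "(\<Sum>i\<in>I. of_bool (g (x i)) - of_bool (g (y i)) :: real) =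
        (\<Sum>i\<in>I. of_bool (g (fst (pr (\<lambda>_. True) (x, y) i))) - of_bool (g (snd (pr (\<lambda>_. True) (x, y) i))))"
        using I by (intro sum.cong refl) (auto simp: pr_def)
      also have "\<dots> \<le> T (pr (\<lambda>_. True) (x, y))"
        unfolding T_def using G g by (intro Max_ge) auto
      finally show "(\<Sum>i\<in>I. of_bool (g (x i)) - of_bool (g (y i))) \<le> T (pr (\<lambda>_. True) (x, y))" .
    qed
    finally show ?thesis .
  qed
  have sym: "(\<integral>z. T z \<partial>?\<nu>) = (\<integral>p. T (pr c p) \<partial>(?\<mu> \<Otimes>\<^sub>M ?\<mu>))" for c
  proof -
    have "(\<integral>z. T z \<partial>?\<nu>) = (\<integral>z. T z \<partial>(distr (?\<mu> \<Otimes>\<^sub>M ?\<mu>) ?\<nu> (pr c)))" by (simp only: pr)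
    also have "\<dots> = (\<integral>p. T (pr c p) \<partial>(?\<mu> \<Otimes>\<^sub>M ?\<mu>))" by (rule integral_distr[OF prm Tm])
    finally show ?thesis .
  qed
  have "?E = (\<integral>x. S x \<partial>?\<mu>)" by (simp add: S_def)
  also have "\<dots> \<le> (\<integral>x. \<integral>y. T (pr (\<lambda>_. True) (x, y)) \<partial>?\<mu> \<partial>?\<mu>)"
  proof (rule integral_mono)
    show "integrable ?\<mu> S" by (rule \<mu>.integrable_const_bound[of _ ?N]) (use Sb in auto)
    show "integrable ?\<mu> (\<lambda>x. \<integral>y. T (pr (\<lambda>_. True) (x, y)) \<partial>?\<mu>)"
      using \<mu>\<mu>.integrable_fst'[OF Tint] by simp
  qed (rule step1)
  also have "\<dots> = (\<integral>p. T (pr (\<lambda>_. True) p) \<partial>(?\<mu> \<Otimes>\<^sub>M ?\<mu>))"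
    by (rule \<mu>\<mu>.integral_fst'[OF Tint])
  also have "\<dots> = (\<integral>z. T z \<partial>?\<nu>)" by (rule sym[symmetric])
  finally have E1: "?E \<le> (\<integral>z. T z \<partial>?\<nu>)" .
  have fs: "finite (signs I)" by (rule finite_signs[OF fI])
  have "2 ^ card I * ?E \<le> 2 ^ card I * (\<integral>z. T z \<partial>?\<nu>)" using E1 by simp
  also have "\<dots> = (\<Sum>\<rho>\<in>signs I. \<integral>z. T z \<partial>?\<nu>)" by (simp add: card_signs[OF fI])
  also have "\<dots> = (\<Sum>\<rho>\<in>signs I. \<integral>p. T (pr (\<lambda>i. \<rho> i = 1) p) \<partial>(?\<mu> \<Otimes>\<^sub>M ?\<mu>))" by (intro sum.cong refl sym)
  also have "\<dots> = (\<integral>p. (\<Sum>\<rho>\<in>signs I. T (pr (\<lambda>i. \<rho> i = 1) p)) \<partial>(?\<mu> \<Otimes>\<^sub>M ?\<mu>))"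
    using Tint by (subst Bochner_Integration.integral_sum) auto
  also have "\<dots> \<le> (\<integral>p. 2 ^ card I * ?B \<partial>(?\<mu> \<Otimes>\<^sub>M ?\<mu>))"
  proof (rule integral_mono)
    show "integrable (?\<mu> \<Otimes>\<^sub>M ?\<mu>) (\<lambda>p. \<Sum>\<rho>\<in>signs I. T (pr (\<lambda>i. \<rho> i = 1) p))" using Tint by auto
    fix p :: "('i \<Rightarrow> 'p) \<times> ('i \<Rightarrow> 'p)"
    obtain x y where p: "p = (x, y)" by (cases p)
    let ?F = "\<lambda>(\<rho> :: 'i \<Rightarrow> real) g. \<Sum>i\<in>I. of_bool (g (fst (pr (\<lambda>i. \<rho> i = 1) p i))) - of_bool (g (snd (pr (\<lambda>i. \<rho> i = 1) p i))) :: real"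
    have "\<forall>\<rho>. \<exists>g. g \<in> G \<and> (MAX g\<in>G. ?F \<rho> g) = ?F \<rho> g"
      by (intro allI Max_image_attained[OF G])
    from choice[OF this] obtain g where gg: "\<forall>\<rho> :: 'i \<Rightarrow> real. g \<rho> \<in> G \<and> (MAX g\<in>G. ?F \<rho> g) = ?F \<rho> (g \<rho>)" by (elim exE)
    then have g: "\<And>\<rho>. g \<rho> \<in> G" "\<And>\<rho>. T (pr (\<lambda>i. \<rho> i = 1) p) = ?F \<rho> (g \<rho>)"
      unfolding T_def by (blast, simp only: gg)
    have mult_ob: "r * of_bool b = (if b then r else 0)" for r :: real and b by simp
    have sel: "(\<Sum>\<rho>\<in>signs I. \<Sum>i\<in>I. \<rho> i * of_bool (h \<rho> (w i))) \<le> 2 ^ card I * (84 * sqrt (real D * ?N))"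
      if h: "\<And>\<rho>. \<rho> \<in> signs I \<Longrightarrow> h \<rho> \<in> G" for h w
    proof -
      have "(\<Sum>\<rho>\<in>signs I. \<Sum>i\<in>I. \<rho> i * of_bool (h \<rho> (w i))) = (\<Sum>\<rho>\<in>signs I. \<Sum>i\<in>{i\<in>I. h \<rho> (w i)}. \<rho> i)"
        by (simp only: sum.inter_filter[OF fI] mult_ob)
      also have "\<dots> \<le> 2 ^ card I * (84 * sqrt (real D * ?N))"
        by (rule rademacher_vc_bound[OF vc D fI I(2), where x = w]) (use h in \<open>auto simp: traces_def\<close>)
      finally show ?thesis .
    qed
    have "(\<Sum>\<rho>\<in>signs I. T (pr (\<lambda>i. \<rho> i = 1) p)) =
        (\<Sum>\<rho>\<in>signs I. (\<Sum>i\<in>I. \<rho> i * of_bool (g \<rho> (x i))) + (\<Sum>i\<in>I. - \<rho> i * of_bool (g \<rho> (y i))))"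
    proof (intro sum.cong refl)
      fix \<rho> assume \<rho>: "\<rho> \<in> signs I"
      show "T (pr (\<lambda>i. \<rho> i = 1) p) = (\<Sum>i\<in>I. \<rho> i * of_bool (g \<rho> (x i))) + (\<Sum>i\<in>I. - \<rho> i * of_bool (g \<rho> (y i)))"
        unfolding g(2) sum.distrib[symmetric]
      proof (intro sum.cong refl)
        fix i assume i: "i \<in> I"
        have "\<rho> i = 1 \<or> \<rho> i = -1" using \<rho> i by (auto simp: signs_def PiE_iff)
        then show "of_bool (g \<rho> (fst (pr (\<lambda>i. \<rho> i = 1) p i))) - of_bool (g \<rho> (snd (pr (\<lambda>i. \<rho> i = 1) p i))) =
            \<rho> i * of_bool (g \<rho> (x i)) + - \<rho> i * of_bool (g \<rho> (y i))"
          using IJ[OF i] by (auto simp: pr_def p)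
      qed
    qed
    also have "\<dots> = (\<Sum>\<rho>\<in>signs I. \<Sum>i\<in>I. \<rho> i * of_bool (g \<rho> (x i))) + (\<Sum>\<rho>\<in>signs I. \<Sum>i\<in>I. - \<rho> i * of_bool (g \<rho> (y i)))"
      by (rule sum.distrib)
    \<comment> \<open>Negating \<rho> turns the sum over the second sample into one of the form
      bounded by \<open>sel\<close>, with the selection \<open>g\<close> composed with the
      negation.\<close>
    also have "(\<Sum>\<rho>\<in>signs I. \<Sum>i\<in>I. - \<rho> i * of_bool (g \<rho> (y i))) =
       (\<Sum>\<rho>\<in>signs I. \<Sum>i\<in>I. \<rho> i * of_bool (g (\<lambda>i\<in>I. - \<rho> i) (y i)))"
    proof (rule sum.reindex_bij_witness[of _ "\<lambda>\<rho>. \<lambda>i\<in>I. - \<rho> i" "\<lambda>\<rho>. \<lambda>i\<in>I. - \<rho> i"])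
      fix \<rho> assume \<rho>: "\<rho> \<in> signs I"
      then have e: "\<rho> \<in> extensional I" by (auto simp: signs_def PiE_iff)
      show 1: "(\<lambda>i\<in>I. - (\<lambda>i\<in>I. - \<rho> i) i) = \<rho>" using e by (auto simp: fun_eq_iff extensional_def)
      show "(\<lambda>i\<in>I. - \<rho> i) \<in> signs I" using \<rho> by (auto simp: signs_def PiE_iff)
      show "(\<lambda>i\<in>I. - (\<lambda>i\<in>I. - \<rho> i) i) = \<rho>" by (rule 1)
      show "(\<lambda>i\<in>I. - \<rho> i) \<in> signs I" using \<rho> by (auto simp: signs_def PiE_iff)
      show "(\<Sum>i\<in>I. (\<lambda>i\<in>I. - \<rho> i) i * of_bool (g (\<lambda>i\<in>I. - (\<lambda>i\<in>I. - \<rho> i) i) (y i))) = (\<Sum>i\<in>I. - \<rho> i * of_bool (g \<rho> (y i)))"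
        unfolding 1 by (intro sum.cong refl) simp
    qed
    also have "(\<Sum>\<rho>\<in>signs I. \<Sum>i\<in>I. \<rho> i * of_bool (g \<rho> (x i))) + \<dots> \<le>
       2 ^ card I * (84 * sqrt (real D * ?N)) + 2 ^ card I * (84 * sqrt (real D * ?N))"
      using g(1) by (intro add_mono sel) auto
    finally show "(\<Sum>\<rho>\<in>signs I. T (pr (\<lambda>i. \<rho> i = 1) p)) \<le> 2 ^ card I * ?B" by simp
  qed auto
  also have "\<dots> = 2 ^ card I * ?B" by (simp add: \<mu>\<mu>.P.prob_space)
  finally show ?thesis by simp
qed

section \<open>Uniform deviations and Cholesky factors\<close>

text \<open>The event for a countable class is the increasing union of the events for its first k
  members. For these, Markov's inequality is applied at 40 times the bound on the expected maximum:
  6720 = 40 * 168, with probability 1/40. The always false predicate makes the maximum nonnegative,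
  as Markov's inequality requires.\<close>

theorem vc_deviation:
  fixes P :: "'p measure" and I J :: "'i set"
  assumes P: "prob_space P" and J: "finite J" and I: "I \<subseteq> J" "I \<noteq> {}" and C: "countable C" "(\<lambda>_. False) \<in> C"
    and Cm: "\<And>g. g \<in> C \<Longrightarrow> Measurable.pred P g" and vc: "vc_bounded C D" and D: "1 \<le> D"
  defines "bad \<equiv> {x \<in> space (PiM J (\<lambda>_. P)). \<exists>g\<in>C. real (card I) * measure P {p\<in>space P. g p} +
      6720 * sqrt (real D * real (card I)) < (\<Sum>i\<in>I. of_bool (g (x i)))}"
  shows "bad \<in> sets (PiM J (\<lambda>_. P))" "measure (PiM J (\<lambda>_. P)) bad \<le> 1/40"
proof -
  let ?\<mu> = "PiM J (\<lambda>_. P)"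
  interpret P: prob_space P by fact
  interpret \<mu>: prob_space ?\<mu> by (rule prob_space_PiM) (rule P)
  let ?q = "\<lambda>g. measure P {p\<in>space P. g p}"
  have fI: "finite I" using I J finite_subset by blast
  have N: "0 < real (card I)" using fI I by (simp add: card_gt_0_iff)
  define B where "B = 168 * sqrt (real D * real (card I))"
  have B: "B > 0" using N D by (simp add: B_def)
  have Cne: "C \<noteq> {}" using C by blast
  define e where "e = from_nat_into C"
  have eC: "range e = C" unfolding e_def by (rule range_from_nat_into[OF Cne C(1)])
  define bk where "bk k = {x \<in> space ?\<mu>. \<exists>g\<in>e ` {..<k}. real (card I) * ?q g + 40 * B < (\<Sum>i\<in>I. of_bool (g (x i)))}" for k :: nat
  have em: "Measurable.pred P (e k)" for k using Cm eC by blast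
  have cm: "(\<lambda>x. x i) \<in> ?\<mu> \<rightarrow>\<^sub>M P" if "i \<in> I" for i using that I by (intro measurable_component_singleton) auto
  have gm: "(\<lambda>x. \<Sum>i\<in>I. of_bool (g (x i)) :: real) \<in> borel_measurable ?\<mu>" if "g \<in> C" for g
  proof (intro borel_measurable_sum)
    fix i assume i: "i \<in> I"
    have "Measurable.pred ?\<mu> (\<lambda>x. g (x i))" by (rule measurable_compose[OF cm[OF i] Cm[OF that]])
    then show "(\<lambda>x. of_bool (g (x i)) :: real) \<in> borel_measurable ?\<mu>" by measurable
  qed
  have bks: "bk k \<in> sets ?\<mu>" for k
  proof -
    have "bk k = (\<Union>g\<in>e ` {..<k}. {x \<in> space ?\<mu>. real (card I) * ?q g + 40 * B < (\<Sum>i\<in>I. of_bool (g (x i)))})"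
      by (auto simp: bk_def)
    moreover have "{x \<in> space ?\<mu>. real (card I) * ?q g + 40 * B < (\<Sum>i\<in>I. of_bool (g (x i)))} \<in> sets ?\<mu>" if "g \<in> C" for g
      by (rule borel_measurable_less[OF _ gm[OF that]]) simp
    ultimately show ?thesis using eC by (auto intro!: sets.finite_UN)
  qed
  have bkm: "measure ?\<mu> (bk k) \<le> 1/40" for k
  proof -
    define G where "G = insert (\<lambda>_. False) (e ` {..<k})"
    have G: "finite G" "G \<noteq> {}" "G \<subseteq> C" using C eC by (auto simp: G_def)
    define S where "S x = (MAX g\<in>G. \<Sum>i\<in>I. of_bool (g (x i)) - ?q g)" for x
    have Ssum: "(\<Sum>i\<in>I. of_bool (g (x i)) - ?q g) = (\<Sum>i\<in>I. of_bool (g (x i))) - real (card I) * ?q g" for g x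
      by (simp add: sum_subtractf)
    have Sge: "(\<Sum>i\<in>I. of_bool (g (x i))) - real (card I) * ?q g \<le> S x" if "g \<in> G" for g x
      unfolding S_def Ssum[symmetric] using G that by (intro Max_ge) auto
    have S0: "0 \<le> S x" for x using Sge[of "\<lambda>_. False" x] by (simp add: G_def)
    have SN: "S x \<le> real (card I)" for x
    proof -
      obtain g where "S x = (\<Sum>i\<in>I. of_bool (g (x i)) - ?q g)"
        unfolding S_def using Max_image_attained[OF G(1,2), of "\<lambda>g. \<Sum>i\<in>I. of_bool (g (x i)) - ?q g"] by blast
      also have "\<dots> \<le> (\<Sum>i\<in>I. 1)"
      proof (intro sum_mono)
        fix i
        have ob: "of_bool b - m \<le> 1" if "0 \<le> m" for b and m :: real using that by (auto simp: of_bool_def)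
        show "of_bool (g (x i)) - ?q g \<le> 1" by (rule ob) (rule measure_nonneg)
      qed
      finally show ?thesis by simp
    qed
    have Sm: "S \<in> borel_measurable ?\<mu>"
      unfolding S_def[abs_def] Ssum using G gm
      by (intro borel_measurable_Max borel_measurable_diff) auto
    have Sint: "integrable ?\<mu> S"
      by (rule \<mu>.integrable_const_bound[of _ "real (card I)"]) (use S0 SN Sm in auto)
    have ES: "(\<integral>x. S x \<partial>?\<mu>) \<le> B"
      unfolding S_def B_def
      by (rule symmetrization_expectation[OF P J I G(1,2) _ vc_bounded_mono[OF vc G(3)] D]) (use Cm G in auto)
    have "measure ?\<mu> (bk k) \<le> measure ?\<mu> {x \<in> space ?\<mu>. 40 * B \<le> S x}"
    proof (rule \<mu>.finite_measure_mono)
      show "{x \<in> space ?\<mu>. 40 * B \<le> S x} \<in> sets ?\<mu>" using Sm by measurable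
      show "bk k \<subseteq> {x \<in> space ?\<mu>. 40 * B \<le> S x}"
      proof
        fix x assume "x \<in> bk k"
        then obtain g where g: "x \<in> space ?\<mu>" "g \<in> G" "real (card I) * ?q g + 40 * B < (\<Sum>i\<in>I. of_bool (g (x i)))"
          unfolding bk_def G_def by blast
        then show "x \<in> {x \<in> space ?\<mu>. 40 * B \<le> S x}" using Sge[OF g(2), of x] by simp
      qed
    qed
    also have "\<dots> \<le> (\<integral>x. S x \<partial>?\<mu>) / (40 * B)"
      using B S0 by (intro integral_Markov_inequality_measure[OF Sint, of "{}"]) auto
    also have "\<dots> \<le> B / (40 * B)" using ES B by (intro divide_right_mono) auto
    finally show ?thesis using B by simp
  qed
  have inc: "incseq bk" unfolding incseq_def bk_def by (auto simp: le_fun_def)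
  have bad: "bad = (\<Union>k. bk k)"
  proof
    show "(\<Union>k. bk k) \<subseteq> bad" using eC by (auto simp: bk_def bad_def B_def)
    show "bad \<subseteq> (\<Union>k. bk k)"
    proof
      fix x assume "x \<in> bad"
      then obtain g where g: "g \<in> C" "x \<in> space ?\<mu>" "real (card I) * ?q g + 40 * B < (\<Sum>i\<in>I. of_bool (g (x i)))"
        by (auto simp: bad_def B_def)
      then obtain k where "g = e k" using eC by blast
      then have "x \<in> bk (Suc k)" using g by (auto simp: bk_def)
      then show "x \<in> (\<Union>k. bk k)" by blast
    qed
  qed
  show "bad \<in> sets ?\<mu>" unfolding bad using bks by blast
  have "(\<lambda>k. measure ?\<mu> (bk k)) \<longlonglongrightarrow> measure ?\<mu> (\<Union>k. bk k)"
    using bks inc by (intro \<mu>.finite_Lim_measure_incseq) auto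
  then show "measure ?\<mu> bad \<le> 1/40" unfolding bad
    by (rule LIMSEQ_le_const2) (use bkm in blast)
qed

section \<open>Square linear systems and the Cholesky factorization\<close>

lemma square_system_solvable:
  fixes a :: "nat \<Rightarrow> nat \<Rightarrow> real"
  assumes inj: "\<And>x. (\<forall>i<d. (\<Sum>j<d. a i j * x j) = 0) \<Longrightarrow> \<forall>j<d. x j = 0"
  shows "\<exists>x. \<forall>i<d. (\<Sum>j<d. a i j * x j) = u i"
proof -
  \<comment> \<open>Homogenization: the right-hand side becomes an additional column, which gives d
    equations in d + 1 unknowns. Injectivity excludes a solution with last coordinate 0, and
    division by that coordinate solves the system.\<close>
  define a' where "a' i j = (if j < d then a i j else - u i)" for i j
  obtain x where x: "\<exists>j\<in>{..<Suc d}. x j \<noteq> 0" "\<forall>i\<in>{..<d}. (\<Sum>j<Suc d. a' i j * x j) = 0"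
    using underdetermined_system[of "{..<d}" "{..<Suc d}" a'] by auto
  have eq: "(\<Sum>j<d. a i j * x j) = u i * x d" if "i < d" for i
    using x(2) that by (simp add: a'_def)
  have xd: "x d \<noteq> 0"
  proof
    assume "x d = 0"
    then have "\<forall>j<d. x j = 0" using eq by - (rule inj, simp)
    then show False using x(1) \<open>x d = 0\<close> by (auto simp: less_Suc_eq)
  qed
  have "(\<Sum>j<d. a i j * (x j / x d)) = u i" if "i < d" for i
    using eq[OF that] xd by (simp add: sum_divide_distrib[symmetric])
  then show ?thesis by (intro exI[of _ "\<lambda>j. x j / x d"]) auto
qed

lemma pos_defD: "pos_def d S \<Longrightarrow> i < d \<Longrightarrow> x i \<noteq> 0 \<Longrightarrow> 0 < (\<Sum>i<d. \<Sum>j<d. x i * S i j * x j)"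
  by (auto simp: pos_def_def)

lemma pos_def_solvable:
  assumes S: "pos_def d S"
  shows "\<exists>x. \<forall>i<d. (\<Sum>j<d. S i j * x j) = u i"
proof (rule square_system_solvable)
  fix x assume 0: "\<forall>i<d. (\<Sum>j<d. S i j * x j) = 0"
  show "\<forall>j<d. x j = 0"
  proof (rule ccontr)
    assume "\<not> ?thesis"
    then obtain i where "i < d" "x i \<noteq> 0" by auto
    then have "0 < (\<Sum>i<d. \<Sum>j<d. x i * S i j * x j)" by (rule pos_defD[OF S])
    also have "\<dots> = (\<Sum>i<d. x i * (\<Sum>j<d. S i j * x j))" by (simp add: sum_distrib_left mult.assoc)
    also have "\<dots> = 0" using 0 by simp
    finally show False by simp
  qed
qed

lemma pos_def_SucD:
  assumes S: "pos_def (Suc d) S"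
  shows "pos_def d S"
  unfolding pos_def_def
proof (intro conjI allI impI)
  show "S i j = S j i" if "i < d" "j < d" for i j using S that by (auto simp: pos_def_def)
  fix x :: "nat \<Rightarrow> real" assume "\<exists>i<d. x i \<noteq> 0"
  then obtain i where i: "i < d" "x i \<noteq> 0" by blast
  have "0 < (\<Sum>i<Suc d. \<Sum>j<Suc d. (x(d := 0)) i * S i j * (x(d := 0)) j)"
    by (rule pos_defD[OF S, of i]) (use i in auto)
  also have "\<dots> = (\<Sum>i<d. \<Sum>j<d. x i * S i j * x j)" by simp
  finally show "0 < (\<Sum>i<d. \<Sum>j<d. x i * S i j * x j)" .
qed

text \<open>Cholesky factorization by induction on the dimension. The new row \<open>l\<close> is
  built from the solution \<open>x\<close> of the system whose right-hand side is the last column.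
  The new pivot is the root of the Schur complement, which is positive because it is the quadratic
  form at (x, -1). Existence of a factor gives meaning to the choice in
  \<open>sqrt_cov\<close>.\<close>

lemma pos_def_factor:
  "pos_def d S \<Longrightarrow> \<exists>A. \<forall>i<d. \<forall>j<d. (\<Sum>k<d. A i k * A j k) = S i j"
proof (induction d)
  case (Suc d)
  have Sd: "pos_def d S" by (rule pos_def_SucD[OF Suc.prems])
  have sym: "S i j = S j i" if "i < Suc d" "j < Suc d" for i j using Suc.prems that by (auto simp: pos_def_def)
  obtain A where A: "\<And>i j. i < d \<Longrightarrow> j < d \<Longrightarrow> (\<Sum>k<d. A i k * A j k) = S i j" using Suc.IH[OF Sd] by blast
  obtain x where x: "\<And>i. i < d \<Longrightarrow> (\<Sum>j<d. S i j * x j) = S i d" using pos_def_solvable[OF Sd, of "\<lambda>i. S i d"] by blast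
  define l where "l k = (\<Sum>j<d. A j k * x j)" for k
  have Al: "(\<Sum>k<d. A i k * l k) = S i d" if i: "i < d" for i
  proof -
    have "(\<Sum>k<d. A i k * l k) = (\<Sum>j<d. (\<Sum>k<d. A i k * A j k) * x j)"
      unfolding l_def sum_distrib_left sum_distrib_right by (subst sum.swap) (simp add: mult.assoc)
    also have "\<dots> = (\<Sum>j<d. S i j * x j)" using A i by simp
    finally show ?thesis using x i by simp
  qed
  define s where "s = (\<Sum>j<d. x j * S j d)"
  have ll: "(\<Sum>k<d. l k * l k) = s"
  proof -
    have "(\<Sum>k<d. l k * l k) = (\<Sum>k<d. \<Sum>j<d. A j k * x j * l k)"
      by (rule sum.cong[OF refl], subst (1) l_def, rule sum_distrib_right)
    also have "\<dots> = (\<Sum>j<d. \<Sum>k<d. A j k * x j * l k)" by (rule sum.swap)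
    also have "\<dots> = (\<Sum>j<d. x j * (\<Sum>k<d. A j k * l k))" by (simp add: sum_distrib_left ac_simps)
    also have "\<dots> = s" unfolding s_def by (intro sum.cong refl) (simp add: Al)
    finally show ?thesis .
  qed
  define z where "z = x(d := -1)"
  have "0 < (\<Sum>i<Suc d. \<Sum>j<Suc d. z i * S i j * z j)" by (rule pos_defD[OF Suc.prems, of d]) (auto simp: z_def)
  also have "\<dots> = (\<Sum>i<d. \<Sum>j<d. x i * S i j * x j) - s - (\<Sum>j<d. S d j * x j) + S d d"
    by (simp add: z_def s_def sum.distrib sum_negf sum_subtractf)
  also have "(\<Sum>i<d. \<Sum>j<d. x i * S i j * x j) = s"
  proof -
    have "(\<Sum>i<d. \<Sum>j<d. x i * S i j * x j) = (\<Sum>i<d. x i * (\<Sum>j<d. S i j * x j))" by (simp add: sum_distrib_left mult.assoc)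
    also have "\<dots> = s" unfolding s_def by (intro sum.cong refl) (simp add: x)
    finally show ?thesis .
  qed
  also have "(\<Sum>j<d. S d j * x j) = s" unfolding s_def by (intro sum.cong refl) (simp add: sym[of d] mult.commute)
  finally have q: "0 < S d d - s" by simp
  define A' where "A' i k = (if i < d then (if k < d then A i k else 0) else (if k < d then l k else sqrt (S d d - s)))" for i k
  have "(\<Sum>k<Suc d. A' i k * A' j k) = S i j" if "i < Suc d" "j < Suc d" for i j
  proof (cases "i < d"; cases "j < d")
    assume "i < d" "j < d" then show ?thesis using A by (simp add: A'_def)
  next
    assume "i < d" "\<not> j < d" then show ?thesis using that Al less_Suc_eq by (simp add: A'_def)
  next
    assume "\<not> i < d" "j < d" then show ?thesis using that Al[of j] sym[of d j] less_Suc_eq by (simp add: A'_def mult.commute)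
  next
    assume "\<not> i < d" "\<not> j < d"
    then have "i = d" "j = d" using that by auto
    then show ?thesis using ll q by (simp add: A'_def)
  qed
  then show ?case by blast
qed simp

lemma sqrt_cov_eq:
  assumes "pos_def d S" "i < d" "j < d"
  shows "(\<Sum>k<d. sqrt_cov d S i k * sqrt_cov d S j k) = S i j"
  using someI_ex[OF pos_def_factor[OF assms(1)]] assms(2,3) unfolding sqrt_cov_def by blast

lemma sqnormS_eq_sum_sq:
  assumes "pos_def d S"
  shows "sqnormS d S x = (\<Sum>k<d. (\<Sum>i<d. x i * sqrt_cov d S i k)\<^sup>2)"
proof -
  have "(\<Sum>k<d. (\<Sum>i<d. x i * sqrt_cov d S i k)\<^sup>2) = (\<Sum>k<d. \<Sum>i<d. \<Sum>j<d. x i * sqrt_cov d S i k * (x j * sqrt_cov d S j k))"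
    by (simp add: power2_eq_square sum_product)
  also have "\<dots> = (\<Sum>i<d. \<Sum>j<d. \<Sum>k<d. x i * sqrt_cov d S i k * (x j * sqrt_cov d S j k))"
    by (subst sum.swap, rule sum.cong[OF refl], rule sum.swap)
  also have "\<dots> = (\<Sum>i<d. \<Sum>j<d. x i * (\<Sum>k<d. sqrt_cov d S i k * sqrt_cov d S j k) * x j)"
    by (simp add: sum_distrib_left sum_distrib_right ac_simps)
  also have "\<dots> = sqnormS d S x"
    unfolding sqnormS_def using sqrt_cov_eq[OF assms] by (intro sum.cong refl) simp
  finally show ?thesis ..
qed

text \<open>Whitening maps \<beta> to the transpose of \<open>sqrt_cov\<close> applied to \<beta>,
  and it is onto. This supplies the orthonormal directions of the hypercube in
  \<open>Lreg_lower\<close>.\<close>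

lemma sqrt_cov_transpose_solvable:
  assumes S: "pos_def d S"
  shows "\<exists>\<beta>. \<forall>k<d. (\<Sum>i<d. \<beta> i * sqrt_cov d S i k) = u k"
proof -
  have "\<exists>\<beta>. \<forall>k<d. (\<Sum>i<d. sqrt_cov d S i k * \<beta> i) = u k"
  proof (rule square_system_solvable)
    fix x assume 0: "\<forall>k<d. (\<Sum>i<d. sqrt_cov d S i k * x i) = 0"
    show "\<forall>j<d. x j = 0"
    proof (rule ccontr)
      assume "\<not> ?thesis"
      then obtain i where "i < d" "x i \<noteq> 0" by auto
      then have "0 < sqnormS d S x" unfolding sqnormS_def by (rule pos_defD[OF S])
      also have "\<dots> = 0" unfolding sqnormS_eq_sum_sq[OF S] using 0 by (simp add: mult.commute)
      finally show False by simp
    qed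
  qed
  then show ?thesis by (simp add: mult.commute)
qed

section \<open>The Gaussian linear model\<close>

definition centered_normal :: "real \<Rightarrow> real measure" where "centered_normal \<tau> = density lborel (normal_density 0 \<tau>)"

lemma prob_space_centered_normal: "0 < \<tau> \<Longrightarrow> prob_space (centered_normal \<tau>)"
  unfolding centered_normal_def by (rule prob_space_normal_density)

lemma sets_centered_normal[simp, measurable_cong]: "sets (centered_normal \<tau>) = sets borel"
  by (simp add: centered_normal_def)

lemma space_centered_normal[simp]: "space (centered_normal \<tau>) = UNIV"
  by (simp add: centered_normal_def)

lemma distributed_distr: "distributed M lborel X (normal_density 0 \<tau>) \<Longrightarrow> distr M borel X = centered_normal \<tau>"
  using distributed_distr_eq_density[of M lborel X "normal_density 0 \<tau>"] unfolding centered_normal_def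
  by (metis (no_types, lifting) distr_cong sets_lborel)

lemma centered_normal_uminus:
  assumes "0 < \<tau>" shows "distr (centered_normal \<tau>) borel uminus = centered_normal \<tau>"
proof -
  interpret prob_space "centered_normal \<tau>" by (rule prob_space_centered_normal) fact
  have "distr (centered_normal \<tau>) lborel (\<lambda>x. x) = centered_normal \<tau>" by (rule distr_id2) simp
  then have "distributed (centered_normal \<tau>) lborel (\<lambda>x. x) (normal_density 0 \<tau>)"
    by (auto simp: distributed_def centered_normal_def)
  from normal_density_affine[OF this assms, of "-1" 0]
  have "distributed (centered_normal \<tau>) lborel (\<lambda>x. - x) (normal_density 0 \<tau>)" by simp
  then show ?thesis by (rule distributed_distr)
qed

lemma centered_normal_symmetric:
  assumes "0 < \<tau>" "A \<in> sets borel" shows "measure (centered_normal \<tau>) (uminus -` A) = measure (centered_normal \<tau>) A"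
proof -
  have "measure (centered_normal \<tau>) A = measure (distr (centered_normal \<tau>) borel uminus) A" by (simp only: centered_normal_uminus[OF assms(1)])
  also have "\<dots> = measure (centered_normal \<tau>) (uminus -` A)" using assms(2) by (subst measure_distr) auto
  finally show ?thesis ..
qed

text \<open>Reflection exchanges the two closed half-lines, and a closed half-line together with the
  opposite open one has mass 1.\<close>

lemma centered_normal_half:
  assumes \<tau>: "0 < \<tau>"
  shows "measure (centered_normal \<tau>) {..0} \<ge> 1/2" "measure (centered_normal \<tau>) {0..} \<ge> 1/2"
    "measure (centered_normal \<tau>) {..<0} \<le> 1/2" "measure (centered_normal \<tau>) {0<..} \<le> 1/2"
proof -
  interpret prob_space "centered_normal \<tau>" by (rule prob_space_centered_normal) fact
  have "uminus -` {0..} = {..(0::real)}" "uminus -` {0<..} = {..<(0::real)}" by auto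
  then have eq: "prob {..0} = prob {0..}" "prob {..<0} = prob {0<..}"
    using centered_normal_symmetric[OF \<tau>, of "{0..}"] centered_normal_symmetric[OF \<tau>, of "{0<..}"] by auto
  have "prob ({..0} \<union> {0<..}) = prob {..0} + prob {0<..}" by (intro finite_measure_Union) auto
  moreover have "{..0} \<union> {0<..} = (UNIV :: real set)" by auto
  ultimately have 1: "prob {..0} + prob {0<..} = 1" using prob_space by simp
  have "prob {0<..} \<le> prob {0..}" by (intro finite_measure_mono) auto
  then show "prob {..0} \<ge> 1/2" "prob {0..} \<ge> 1/2" "prob {..<0} \<le> 1/2" "prob {0<..} \<le> 1/2"
    using 1 eq by linarith+
qed

lemma sqrt_2pi_bounds: "2 \<le> sqrt (2 * pi)" "sqrt (2 * pi) \<le> 3"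
  using pi_gt3 pi_less_4 by (auto intro!: real_le_rsqrt real_le_lsqrt)

text \<open>Rational bounds that come from 2 \<le> sqrt (2 pi) \<le> 3 and exp (- 1/2) \<ge>
  1/2.\<close>

lemma normal_density_bounds:
  assumes \<tau>: "0 < \<tau>"
  shows "normal_density 0 \<tau> x \<le> 1 / (2 * \<tau>)" "\<bar>x\<bar> \<le> \<tau> \<Longrightarrow> 1 / (6 * \<tau>) \<le> normal_density 0 \<tau> x"
proof -
  have eq: "normal_density 0 \<tau> x = exp (- x\<^sup>2 / (2 * \<tau>\<^sup>2)) / (sqrt (2 * pi) * \<tau>)"
    using \<tau> by (simp add: normal_density_def real_sqrt_mult)
  show "normal_density 0 \<tau> x \<le> 1 / (2 * \<tau>)"
    unfolding eq using \<tau> sqrt_2pi_bounds(1) by (intro frac_le mult_right_mono) auto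
  assume x: "\<bar>x\<bar> \<le> \<tau>"
  then have "x\<^sup>2 \<le> \<tau>\<^sup>2" by (metis abs_le_square_iff abs_of_pos \<tau>)
  then have "x\<^sup>2 / (2 * \<tau>\<^sup>2) \<le> 1/2" using \<tau> by (simp add: field_simps)
  then have "1/2 \<le> exp (- x\<^sup>2 / (2 * \<tau>\<^sup>2))" using exp_ge_add_one_self[of "- x\<^sup>2 / (2 * \<tau>\<^sup>2)"] by simp
  then have "(1/2) / (3 * \<tau>) \<le> exp (- x\<^sup>2 / (2 * \<tau>\<^sup>2)) / (sqrt (2 * pi) * \<tau>)"
    using \<tau> sqrt_2pi_bounds by (intro frac_le mult_right_mono) auto
  then show "1 / (6 * \<tau>) \<le> normal_density 0 \<tau> x" unfolding eq by simp
qed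

lemma centered_normal_small:
  assumes \<tau>: "0 < \<tau>" and \<kappa>: "0 \<le> \<kappa>" shows "measure (centered_normal \<tau>) {-\<kappa><..<\<kappa>} \<le> \<kappa> / \<tau>"
proof -
  interpret prob_space "centered_normal \<tau>" by (rule prob_space_centered_normal) fact
  have "emeasure (centered_normal \<tau>) {-\<kappa><..<\<kappa>} = (\<integral>\<^sup>+x. ennreal (normal_density 0 \<tau> x) * indicator {-\<kappa><..<\<kappa>} x \<partial>lborel)"
    unfolding centered_normal_def by (subst emeasure_density) auto
  also have "\<dots> \<le> (\<integral>\<^sup>+x. ennreal (1 / (2 * \<tau>)) * indicator {-\<kappa><..<\<kappa>} x \<partial>lborel)"
    using normal_density_bounds(1)[OF \<tau>] by (intro nn_integral_mono mult_right_mono ennreal_leI) auto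
  also have "\<dots> = ennreal (1 / (2 * \<tau>)) * ennreal (2 * \<kappa>)"
    using \<kappa> by (subst nn_integral_cmult_indicator) auto
  also have "\<dots> = ennreal (\<kappa> / \<tau>)" using \<tau> \<kappa> by (simp add: ennreal_mult'[symmetric])
  finally show ?thesis using \<tau> \<kappa> by (simp add: emeasure_eq_measure)
qed

lemma centered_normal_near:
  assumes \<tau>: "0 < \<tau>" and \<kappa>: "0 \<le> \<kappa>" "\<kappa> \<le> \<tau>"
  shows "measure (centered_normal \<tau>) {0<..\<kappa>} \<ge> \<kappa> / (6 * \<tau>)" "measure (centered_normal \<tau>) {-\<kappa>..<0} \<ge> \<kappa> / (6 * \<tau>)"
proof -
  interpret prob_space "centered_normal \<tau>" by (rule prob_space_centered_normal) fact
  have "ennreal (\<kappa> / (6 * \<tau>)) = ennreal (1 / (6 * \<tau>)) * ennreal \<kappa>"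
    using \<tau> \<kappa> by (simp add: ennreal_mult'[symmetric])
  also have "\<dots> = (\<integral>\<^sup>+x. ennreal (1 / (6 * \<tau>)) * indicator {0<..\<kappa>} x \<partial>lborel)"
    using \<kappa> by (subst nn_integral_cmult_indicator) auto
  also have "\<dots> \<le> (\<integral>\<^sup>+x. ennreal (normal_density 0 \<tau> x) * indicator {0<..\<kappa>} x \<partial>lborel)"
    using normal_density_bounds(2)[OF \<tau>] \<kappa>
    by (intro nn_integral_mono) (auto split: split_indicator intro!: ennreal_leI)
  also have "\<dots> = emeasure (centered_normal \<tau>) {0<..\<kappa>}" unfolding centered_normal_def by (subst emeasure_density) auto
  finally show 1: "measure (centered_normal \<tau>) {0<..\<kappa>} \<ge> \<kappa> / (6 * \<tau>)" by (simp add: emeasure_eq_measure)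
  have "uminus -` {0<..\<kappa>} = {-\<kappa>..<0}" by auto
  then show "measure (centered_normal \<tau>) {-\<kappa>..<0} \<ge> \<kappa> / (6 * \<tau>)"
    using 1 centered_normal_symmetric[OF \<tau>, of "{0<..\<kappa>}"] by simp
qed

lemma measure_pair_times:
  assumes "prob_space M" "prob_space N" "A \<in> sets M" "B \<in> sets N"
  shows "measure (M \<Otimes>\<^sub>M N) (A \<times> B) = measure M A * measure N B"
  using assms by (simp add: measure_def sigma_finite_measure.emeasure_pair_measure_Times prob_space_imp_sigma_finite enn2real_mult)

text \<open>The noise is symmetric and independent of the first coordinate, so it takes the sign
  opposite to the latter with probability at most 1/2. The law \<mu> is arbitrary because a rational
  direction may be the zero vector.\<close>

lemma opposite_signs_prob:
  fixes \<mu> :: "real measure"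
  assumes "prob_space \<mu>" and \<mu>: "sets \<mu> = sets borel" and \<sigma>: "0 < \<sigma>"
  shows "measure (\<mu> \<Otimes>\<^sub>M centered_normal \<sigma>) {p. snd p * fst p < 0} \<le> 1/2"
proof -
  interpret \<mu>: prob_space \<mu> by fact
  interpret \<nu>: prob_space "centered_normal \<sigma>" by (rule prob_space_centered_normal) fact
  interpret pair_prob_space \<mu> "centered_normal \<sigma>" ..
  note [measurable_cong] = \<mu>
  have sp: "space \<mu> = UNIV" using sets_eq_imp_space_eq[OF \<mu>] by simp
  have [measurable]: "{0<..} \<in> sets \<mu>" "{..<0} \<in> sets \<mu>" using \<mu> by auto
  have "{p :: real \<times> real. snd p * fst p < 0} = {0<..} \<times> {..<0} \<union> {..<0} \<times> {0<..}"
    by (auto simp: mult_less_0_iff)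
  also have "P.prob ({0<..} \<times> {..<0} \<union> {..<0} \<times> {0<..}) \<le> P.prob ({0<..} \<times> {..<0}) + P.prob ({..<0} \<times> {0<..})"
    by (intro measure_Un_le) auto
  also have "\<dots> = \<mu>.prob {0<..} * \<nu>.prob {..<0} + \<mu>.prob {..<0} * \<nu>.prob {0<..}"
    by (simp add: measure_pair_times \<mu>.prob_space_axioms \<nu>.prob_space_axioms)
  also have "\<dots> \<le> \<mu>.prob {0<..} * (1/2) + \<mu>.prob {..<0} * (1/2)"
    using centered_normal_half[OF \<sigma>] by (intro add_mono mult_left_mono) auto
  also have "\<dots> = (\<mu>.prob ({0<..} \<union> {..<0})) / 2" by (subst \<mu>.finite_measure_Union) auto
  also have "\<dots> \<le> 1/2" by simp
  finally show ?thesis .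
qed

text \<open>The complement contains four disjoint rectangles. In two of them the noise vanishes or
  has the sign opposite to the first coordinate; the margin brings their mass down to 1/2 - s / 192.
  In the other two the signs agree, but the noise is small compared with the first coordinate; they
  add s / 96. The margin is s / 96 times the lower bound \<open>s * \<sigma> / 2\<close> of \<tau>,
  so that a net gain of s / 192 remains.\<close>

lemma near_between_prob:
  assumes \<sigma>: "0 < \<sigma>" and s: "0 < s" "s \<le> 1" and \<tau>: "s * \<sigma> / 2 \<le> \<tau>"
  shows "measure (centered_normal \<tau> \<Otimes>\<^sub>M centered_normal \<sigma>)
     {p. min 0 (snd p) - s\<^sup>2 * \<sigma> / 192 < fst p \<and> fst p < max 0 (snd p) + s\<^sup>2 * \<sigma> / 192} \<le> 1/2 - s / 192"
    (is "measure _ ?C \<le> _")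
proof -
  define t where "t = s * \<sigma> / 2"
  define k where "k = s\<^sup>2 * \<sigma> / 192"
  have t: "0 < t" "t \<le> \<tau>" "t / 4 \<le> \<sigma>" using \<sigma> s \<tau> mult_right_mono[of s 1 \<sigma>] by (auto simp: t_def)
  have kt: "k = s * t / 96" by (simp add: k_def t_def power2_eq_square)
  have k: "0 < k" "k \<le> t / 4" using s t mult_right_mono[of s 1 t] by (auto simp: kt)
  have \<tau>0: "0 < \<tau>" using t by simp
  interpret \<mu>: prob_space "centered_normal \<tau>" by (rule prob_space_centered_normal) fact
  interpret \<nu>: prob_space "centered_normal \<sigma>" by (rule prob_space_centered_normal) fact
  interpret pair_prob_space "centered_normal \<tau>" "centered_normal \<sigma>" ..
  have "{p \<in> space (centered_normal \<tau> \<Otimes>\<^sub>M centered_normal \<sigma>). min 0 (snd p) - s\<^sup>2 * \<sigma> / 192 < fst p \<and>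
     fst p < max 0 (snd p) + s\<^sup>2 * \<sigma> / 192} \<in> P.events" by measurable
  then have C: "?C \<in> P.events" by (simp add: space_pair_measure)
  let ?R1 = "{k..} \<times> {..0::real}" and ?R2 = "{..-k} \<times> {0::real..}"
  let ?R3 = "{t/2..} \<times> {0<..t/4}" and ?R4 = "{..-(t/2)} \<times> {-(t/4)..<0}"
  have "P.prob ((?R1 \<union> ?R2) \<union> (?R3 \<union> ?R4)) = (P.prob ?R1 + P.prob ?R2) + (P.prob ?R3 + P.prob ?R4)"
    using k t by (subst P.finite_measure_Union, auto)+
  also have "\<dots> = \<mu>.prob {k..} * \<nu>.prob {..0} + \<mu>.prob {..-k} * \<nu>.prob {0..} +
     (\<mu>.prob {t/2..} * \<nu>.prob {0<..t/4} + \<mu>.prob {..-(t/2)} * \<nu>.prob {-(t/4)..<0})"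
    by (simp add: measure_pair_times \<mu>.prob_space_axioms \<nu>.prob_space_axioms)
  also have "\<dots> \<ge> \<mu>.prob {k..} * (1/2) + \<mu>.prob {..-k} * (1/2) +
     (\<mu>.prob {t/2..} * ((t/4) / (6 * \<sigma>)) + \<mu>.prob {..-(t/2)} * ((t/4) / (6 * \<sigma>)))"
    using centered_normal_half[OF \<sigma>] centered_normal_near[OF \<sigma>, of "t/4"] t by (intro add_mono mult_left_mono) auto
  finally have ge: "P.prob ((?R1 \<union> ?R2) \<union> (?R3 \<union> ?R4)) \<ge> (\<mu>.prob {k..} + \<mu>.prob {..-k}) * (1/2) +
     (\<mu>.prob {t/2..} + \<mu>.prob {..-(t/2)}) * (s / 48)"
    using \<sigma> by (simp add: t_def algebra_simps)
  have tails: "\<mu>.prob {r..} + \<mu>.prob {..-r} \<ge> 1 - r / \<tau>" if r: "0 < r" for r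
  proof -
    have "UNIV = ({r..} \<union> {..-r}) \<union> {-r<..<r}" by auto
    then have "1 = \<mu>.prob (({r..} \<union> {..-r}) \<union> {-r<..<r})" using \<mu>.prob_space by simp
    also have "\<dots> = (\<mu>.prob {r..} + \<mu>.prob {..-r}) + \<mu>.prob {-r<..<r}"
      using r by (subst \<mu>.finite_measure_Union, auto)+
    finally show ?thesis using centered_normal_small[OF \<tau>0, of r] r by simp
  qed
  have r1: "\<mu>.prob {k..} + \<mu>.prob {..-k} \<ge> 1 - s / 96"
  proof -
    have "k / \<tau> \<le> s / 96" using t s \<tau>0 by (simp add: kt field_simps)
    then show ?thesis using tails[OF k(1)] by linarith
  qed
  have r2: "\<mu>.prob {t/2..} + \<mu>.prob {..-(t/2)} \<ge> 1/2"
  proof -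
    have "(t/2) / \<tau> \<le> 1/2" using t \<tau>0 by (simp add: field_simps)
    then show ?thesis using tails[of "t/2"] t by linarith
  qed
  have "(1 - s / 96) * (1/2) + (1/2) * (s / 48) \<le> P.prob ((?R1 \<union> ?R2) \<union> (?R3 \<union> ?R4))"
    using ge r1 r2 s by (smt (verit) mult_right_mono divide_nonneg_pos)
  also have "\<dots> \<le> P.prob (space (centered_normal \<tau> \<Otimes>\<^sub>M centered_normal \<sigma>) - ?C)"
  proof (intro P.finite_measure_mono sets.compl_sets C subsetI)
    fix p assume "p \<in> (?R1 \<union> ?R2) \<union> (?R3 \<union> ?R4)"
    then have "p \<notin> ?C" using k t unfolding k_def[symmetric] by (cases p) (auto simp: min_def max_def)
    then show "p \<in> space (centered_normal \<tau> \<Otimes>\<^sub>M centered_normal \<sigma>) - ?C" by (simp add: space_pair_measure)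
  qed
  also have "\<dots> = 1 - P.prob ?C" by (rule P.prob_compl[OF C])
  finally show ?thesis using s by (simp add: algebra_simps)
qed

section \<open>Gaussian vectors and the law of one observation\<close>

lemma sets_Rd_gauss_vec[simp, measurable_cong]: "sets (gauss_vec d S) = sets (Rd d)"
  by (simp add: gauss_vec_def)

lemma space_gauss_vec[simp]: "space (gauss_vec d S) = space (Rd d)"
  by (simp add: gauss_vec_def)

lemma measurable_Rd_component[measurable]: "i < d \<Longrightarrow> (\<lambda>w. w i) \<in> borel_measurable (Rd d)"
  unfolding Rd_def by (intro measurable_component_singleton) auto

lemma borel_measurable_Rd_dot[measurable]: "(\<lambda>w. \<Sum>i<d. u i * w i) \<in> borel_measurable (Rd d)"
  by (intro borel_measurable_sum borel_measurable_times measurable_Rd_component) auto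

lemma prob_space_std_normal: "prob_space std_normal"
  unfolding std_normal_def by (rule prob_space_normal_density) simp

lemma sets_std_normal[simp, measurable_cong]: "sets std_normal = sets borel"
  by (simp add: std_normal_def)

lemma measurable_sqrt_cov_map[measurable]:
  "(\<lambda>g. \<lambda>i\<in>{..<d}. \<Sum>j<d. sqrt_cov d S i j * g j) \<in> PiM {..<d} (\<lambda>_. std_normal) \<rightarrow>\<^sub>M Rd d"
  unfolding Rd_def
proof (intro measurable_restrict borel_measurable_sum borel_measurable_times)
  fix j assume "j \<in> {..<d}"
  then have "(\<lambda>g. g j) \<in> PiM {..<d} (\<lambda>_. std_normal) \<rightarrow>\<^sub>M std_normal" by (intro measurable_component_singleton) auto
  then show "(\<lambda>g. g j) \<in> borel_measurable (PiM {..<d} (\<lambda>_. std_normal))" by (simp cong: measurable_cong_sets)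
qed auto

lemma prob_space_gauss_vec: "prob_space (gauss_vec d S)"
  unfolding gauss_vec_def
  by (intro prob_space.prob_space_distr prob_space_PiM prob_space_std_normal measurable_sqrt_cov_map)

lemma std_normal_combination:
  fixes c :: "nat \<Rightarrow> real"
  assumes c: "\<exists>j<d. c j \<noteq> 0"
  shows "distributed (PiM {..<d} (\<lambda>_. std_normal)) lborel (\<lambda>g. \<Sum>j<d. c j * g j) (normal_density 0 (sqrt (\<Sum>j<d. (c j)\<^sup>2)))"
proof -
  let ?G = "PiM {..<d} (\<lambda>_. std_normal)"
  interpret G: prob_space ?G by (intro prob_space_PiM prob_space_std_normal)
  interpret PG: product_prob_space "\<lambda>_::nat. std_normal" by (rule product_prob_spaceI) (rule prob_space_std_normal)
  \<comment> \<open>Vanishing coefficients are dropped, since \<open>G.sum_indep_normal\<close>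
    needs positive standard deviations. \<open>J\<close> is nonempty because \<open>c\<close> has a
    nonzero entry.\<close>
  define J where "J = {j. j < d \<and> c j \<noteq> 0}"
  have "finite J" unfolding J_def by (rule finite_subset[of _ "{..<d}"]) auto
  then have J: "finite J" "J \<noteq> {}" "J \<subseteq> {..<d}" using c by (simp, auto simp: J_def)
  have comp: "(\<lambda>g. g j) \<in> ?G \<rightarrow>\<^sub>M std_normal" if "j \<in> J" for j
    using that J by (intro measurable_component_singleton) auto
  have ind: "G.indep_vars (\<lambda>_. std_normal) (\<lambda>j g. g j) J"
  proof (subst G.indep_vars_iff_distr_eq_PiM'[OF J(2) comp])
    have "distr ?G (PiM J (\<lambda>_. std_normal)) (\<lambda>x. \<lambda>i\<in>J. x i) = PiM J (\<lambda>_. std_normal)"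
      using PG.distr_restrict[OF J(3)] by simp
    also have "\<dots> = PiM J (\<lambda>i. distr ?G std_normal (\<lambda>g. g i))"
      using J by (intro PiM_cong refl distr_PiM_component[symmetric] prob_space_std_normal) auto
    finally show "distr ?G (PiM J (\<lambda>_. std_normal)) (\<lambda>x. \<lambda>i\<in>J. x i) = PiM J (\<lambda>i. distr ?G std_normal (\<lambda>g. g i))" .
  qed auto
  have ind': "G.indep_vars (\<lambda>_. borel) (\<lambda>j g. c j * g j) J"
  proof (rule G.indep_vars_compose2[OF ind])
    show "(*) (c j) \<in> std_normal \<rightarrow>\<^sub>M borel" for j
      by (subst measurable_cong_sets[OF sets_std_normal refl]) simp
  qed
  have "distributed ?G lborel (\<lambda>g. 0 + c j * g j) (normal_density (0 + c j * 0) (\<bar>c j\<bar> * 1))" if j: "j \<in> J" for j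
  proof (rule G.normal_density_affine)
    have "distr ?G lborel (\<lambda>g. g j) = distr ?G std_normal (\<lambda>g. g j)" by (intro distr_cong) auto
    also have "\<dots> = std_normal" using j J by (intro distr_PiM_component prob_space_std_normal) auto
    finally have "distr ?G lborel (\<lambda>g. g j) = density lborel std_normal_density" by (simp add: std_normal_def)
    then show "distributed ?G lborel (\<lambda>g. g j) std_normal_density"
      using comp[OF j] by (auto simp: distributed_def cong: measurable_cong_sets)
  qed (use j in \<open>auto simp: J_def\<close>)
  then have "distributed ?G lborel (\<lambda>g. \<Sum>j\<in>J. c j * g j) (normal_density (\<Sum>j\<in>J. 0) (sqrt (\<Sum>j\<in>J. \<bar>c j\<bar>\<^sup>2)))"
    by (intro G.sum_indep_normal[OF J(1,2) ind']) (auto simp: J_def)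
  moreover have "(\<Sum>j\<in>J. c j * g j) = (\<Sum>j<d. c j * g j)" for g :: "nat \<Rightarrow> real"
    by (rule sum.mono_neutral_left) (auto simp: J_def)
  moreover have "(\<Sum>j\<in>J. \<bar>c j\<bar>\<^sup>2) = (\<Sum>j<d. (c j)\<^sup>2)"
    unfolding power2_abs by (rule sum.mono_neutral_left) (auto simp: J_def)
  ultimately show ?thesis by simp
qed

lemma gauss_vec_dot:
  assumes S: "pos_def d S" and u: "0 < sqnormS d S u"
  shows "distr (gauss_vec d S) borel (\<lambda>w. \<Sum>i<d. u i * w i) = centered_normal (sqrt (sqnormS d S u))"
proof -
  let ?G = "PiM {..<d} (\<lambda>_. std_normal)"
  define c where "c j = (\<Sum>i<d. u i * sqrt_cov d S i j)" for j
  have sq: "sqnormS d S u = (\<Sum>j<d. (c j)\<^sup>2)" unfolding c_def by (rule sqnormS_eq_sum_sq[OF S])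
  then have "\<exists>j<d. c j \<noteq> 0" 
  proof (rule contrapos_pp)
    assume "\<not> (\<exists>j<d. c j \<noteq> 0)"
    then have "(\<Sum>j<d. (c j)\<^sup>2) = 0" by simp
    then show "\<not> (sqnormS d S u = (\<Sum>j<d. (c j)\<^sup>2))" using u by simp
  qed
  note d = std_normal_combination[OF this]
  have "distr (gauss_vec d S) borel (\<lambda>w. \<Sum>i<d. u i * w i) =
     distr ?G borel ((\<lambda>w. \<Sum>i<d. u i * w i) \<circ> (\<lambda>g. \<lambda>i\<in>{..<d}. \<Sum>j<d. sqrt_cov d S i j * g j))"
    unfolding gauss_vec_def by (rule distr_distr[OF borel_measurable_Rd_dot measurable_sqrt_cov_map])
  also have "((\<lambda>w. \<Sum>i<d. u i * w i) \<circ> (\<lambda>g. \<lambda>i\<in>{..<d}. \<Sum>j<d. sqrt_cov d S i j * g j)) = (\<lambda>g. \<Sum>j<d. c j * g j)"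
  proof
    fix g :: "nat \<Rightarrow> real"
    have "(\<Sum>i<d. u i * (\<Sum>j<d. sqrt_cov d S i j * g j)) = (\<Sum>j<d. c j * g j)"
      unfolding c_def sum_distrib_left sum_distrib_right by (subst sum.swap) (simp add: mult.assoc)
    then show "((\<lambda>w. \<Sum>i<d. u i * w i) \<circ> (\<lambda>g. \<lambda>i\<in>{..<d}. \<Sum>j<d. sqrt_cov d S i j * g j)) g = (\<Sum>j<d. c j * g j)" by simp
  qed
  also have "distr ?G borel (\<lambda>g. \<Sum>j<d. c j * g j) = centered_normal (sqrt (sqnormS d S u))"
    unfolding sq by (rule distributed_distr[OF d])
  finally show ?thesis .
qed

lemma measurable_lin_model_map[measurable]:
  "(\<lambda>(w, e). (w, (\<Sum>i<d. \<beta> i * w i) + e)) \<in> gauss_vec d S \<Otimes>\<^sub>M centered_normal \<sigma> \<rightarrow>\<^sub>M obs_space d"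
  unfolding obs_space_def by measurable

lemma lin_model_eq: "lin_model d S \<sigma> \<beta> = distr (gauss_vec d S \<Otimes>\<^sub>M centered_normal \<sigma>) (obs_space d) (\<lambda>(w, e). (w, (\<Sum>i<d. \<beta> i * w i) + e))"
  by (simp add: lin_model_def centered_normal_def)

lemma sets_lin_model[simp, measurable_cong]: "sets (lin_model d S \<sigma> \<beta>) = sets (obs_space d)"
  by (simp add: lin_model_def)

lemma space_lin_model[simp]: "space (lin_model d S \<sigma> \<beta>) = space (obs_space d)"
  by (simp add: lin_model_def)

lemma prob_space_lin_model:
  assumes "0 < \<sigma>" shows "prob_space (lin_model d S \<sigma> \<beta>)"
proof -
  interpret pair_prob_space "gauss_vec d S" "centered_normal \<sigma>"
    by (intro pair_prob_space.intro pair_sigma_finite.intro prob_space_imp_sigma_finite prob_space_gauss_vec prob_space_centered_normal assms)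
  show ?thesis unfolding lin_model_eq by (intro prob_space_distr measurable_lin_model_map)
qed

lemma measurable_obs[measurable]:
  "(\<lambda>p. \<Sum>i<d. u i * fst p i) \<in> borel_measurable (obs_space d)" "snd \<in> borel_measurable (obs_space d)"
  unfolding obs_space_def by measurable

text \<open>The covariate enters the upper bound through one linear form at a time. This form and
  the residual have a product law, so probabilities under the model become computations in the
  plane.\<close>

lemma lin_model_event:
  assumes \<sigma>: "0 < \<sigma>" and Q: "Q \<in> sets (borel \<Otimes>\<^sub>M borel)"
  shows "measure (lin_model d S \<sigma> \<beta>) {p \<in> space (obs_space d). (\<Sum>i<d. u i * fst p i, snd p - (\<Sum>i<d. \<beta> i * fst p i)) \<in> Q}
    = measure (distr (gauss_vec d S) borel (\<lambda>w. \<Sum>i<d. u i * w i) \<Otimes>\<^sub>M centered_normal \<sigma>) Q"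
proof -
  let ?f = "\<lambda>(w, e). (w, (\<Sum>i<d. \<beta> i * w i) + e) :: obs"
  let ?E = "{p \<in> space (obs_space d). (\<Sum>i<d. u i * fst p i, snd p - (\<Sum>i<d. \<beta> i * fst p i)) \<in> Q}"
  let ?GN = "gauss_vec d S \<Otimes>\<^sub>M centered_normal \<sigma>"
  have m: "(\<lambda>p. (\<Sum>i<d. u i * fst p i, snd p - (\<Sum>i<d. \<beta> i * fst p i))) \<in> obs_space d \<rightarrow>\<^sub>M borel \<Otimes>\<^sub>M borel"
    by measurable
  have E: "?E \<in> sets (obs_space d)" using measurable_sets[OF m Q] by (simp add: vimage_def Int_def conj_commute)
  have "measure (lin_model d S \<sigma> \<beta>) ?E = measure ?GN (?f -` ?E \<inter> space ?GN)"
    unfolding lin_model_eq by (rule measure_distr[OF measurable_lin_model_map E])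
  also have "?f -` ?E \<inter> space ?GN = (\<lambda>(w, e). (\<Sum>i<d. u i * w i, e)) -` Q \<inter> space ?GN"
    using measurable_space[OF measurable_lin_model_map] by fastforce
  also have "measure ?GN \<dots> = measure (distr ?GN (borel \<Otimes>\<^sub>M borel) (\<lambda>(w, e). (\<Sum>i<d. u i * w i, e))) Q"
  proof (rule measure_distr[symmetric, OF _ Q])
    show "(\<lambda>(w, e). (\<Sum>i<d. u i * w i, e)) \<in> ?GN \<rightarrow>\<^sub>M borel \<Otimes>\<^sub>M borel" by measurable
  qed
  also have "distr ?GN (borel \<Otimes>\<^sub>M borel) (\<lambda>(w, e). (\<Sum>i<d. u i * w i, e)) =
     distr (gauss_vec d S) borel (\<lambda>w. \<Sum>i<d. u i * w i) \<Otimes>\<^sub>M distr (centered_normal \<sigma>) borel (\<lambda>x. x)"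
  proof (rule pair_measure_distr[symmetric])
    have "distr (centered_normal \<sigma>) borel (\<lambda>x. x) = centered_normal \<sigma>" by (rule distr_id2) simp
    then show "sigma_finite_measure (distr (centered_normal \<sigma>) borel (\<lambda>x. x))"
      using prob_space_centered_normal[OF \<sigma>] by (simp add: prob_space_imp_sigma_finite)
    show "(\<lambda>w. \<Sum>i<d. u i * w i) \<in> borel_measurable (gauss_vec d S)" by measurable
    show "(\<lambda>x. x) \<in> borel_measurable (centered_normal \<sigma>)" by (rule measurable_ident_sets) simp
  qed
  also have "distr (centered_normal \<sigma>) borel (\<lambda>x. x) = centered_normal \<sigma>" by (rule distr_id2) simp
  finally show ?thesis .
qed

section \<open>The clean sample\<close>

text \<open>A dense sequence of vectors, through the countable type of rational lists; coordinates
  beyond the end of the list are 0. Indexing by natural numbers makes classes of half-spaces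
  countable and allows a measurable choice by \<open>LEAST\<close>.\<close>

definition qvec :: "nat \<Rightarrow> nat \<Rightarrow> real" where
  "qvec k i = (if i < length (from_nat k :: rat list) then of_rat ((from_nat k :: rat list) ! i) else 0)"

lemma qvec_dense:
  assumes "0 < (e::real)" shows "\<exists>k. \<forall>i<d. \<bar>qvec k i - x i\<bar> < e"
proof -
  have "\<exists>q. \<bar>of_rat q - x i\<bar> < e" for i
  proof -
    have "x i - e < x i + e" using assms by simp
    then obtain q where "x i - e < of_rat q" "of_rat q < x i + e" using of_rat_dense by blast
    then show ?thesis by (intro exI[of _ q]) (auto simp: abs_less_iff)
  qed
  then obtain q where q: "\<And>i. \<bar>of_rat (q i) - x i\<bar> < e" by metis
  show ?thesis
    by (rule exI[of _ "to_nat (map q [0..<d])"]) (auto simp: qvec_def q)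
qed

lemma qvec_tendsto: "\<exists>f. \<forall>i<d. (\<lambda>m. qvec (f m) i) \<longlonglongrightarrow> x i"
proof -
  have "\<forall>m. \<exists>k. \<forall>i<d. \<bar>qvec k i - x i\<bar> < 1 / real (Suc m)" using qvec_dense by simp
  from choice[OF this] obtain f where f: "\<forall>m. \<forall>i<d. \<bar>qvec (f m) i - x i\<bar> < 1 / real (Suc m)" by blast
  have "(\<lambda>m. qvec (f m) i) \<longlonglongrightarrow> x i" if "i < d" for i
  proof (rule LIMSEQ_I)
    fix r :: real assume "0 < r"
    then obtain M where M: "1 / real (Suc M) < r" using nat_approx_posE by blast
    have "norm (qvec (f m) i - x i) < r" if "m \<ge> M" for m
    proof -
      have "\<bar>qvec (f m) i - x i\<bar> < 1 / real (Suc m)" using f \<open>i < d\<close> by blast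
      also have "\<dots> \<le> 1 / real (Suc M)" using that by (simp add: frac_le)
      finally show ?thesis using M by simp
    qed
    then show "\<exists>no. \<forall>n\<ge>no. norm (qvec (f n) i - x i) < r" by blast
  qed
  then show ?thesis by blast
qed

lemma integral_PiM_component:
  fixes f :: "'b \<Rightarrow> real"
  assumes "\<And>i. prob_space (M i)" "i \<in> I" "f \<in> borel_measurable (M i)"
  shows "(\<integral>x. f (x i) \<partial>PiM I M) = (\<integral>y. f y \<partial>M i)"
proof -
  have 1: "(\<lambda>x. x i) \<in> PiM I M \<rightarrow>\<^sub>M M i" using assms by (intro measurable_component_singleton)
  have "(\<integral>y. f y \<partial>M i) = (\<integral>y. f y \<partial>(distr (PiM I M) (M i) (\<lambda>x. x i)))"
    using assms by (subst distr_PiM_component) auto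
  also have "\<dots> = (\<integral>x. f (x i) \<partial>PiM I M)" by (rule integral_distr[OF 1 assms(3)])
  finally show ?thesis ..
qed

definition residual :: "(nat \<Rightarrow> real) \<Rightarrow> nat \<Rightarrow> obs \<Rightarrow> real" where
  "residual \<beta> d p = snd p - (\<Sum>j<d. \<beta> j * fst p j)"

lemma measurable_residual[measurable]: "residual \<beta> d \<in> borel_measurable (obs_space d)"
  unfolding residual_def[abs_def] by measurable

lemma lin_model_event_pred:
  assumes \<sigma>: "0 < \<sigma>" and Q: "Measurable.pred (borel \<Otimes>\<^sub>M borel) Q"
  shows "measure (lin_model d S \<sigma> \<beta>) {p \<in> space (obs_space d). Q (\<Sum>i<d. u i * fst p i, residual \<beta> d p)}
    = measure (distr (gauss_vec d S) borel (\<lambda>w. \<Sum>i<d. u i * w i) \<Otimes>\<^sub>M centered_normal \<sigma>) {p. Q p}"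
proof -
  have "{p. Q p} \<in> sets (borel \<Otimes>\<^sub>M borel :: (real \<times> real) measure)"
    using predE[OF Q] by (simp add: space_pair_measure)
  from lin_model_event[OF \<sigma> this, of d S \<beta> u] show ?thesis by (simp add: residual_def)
qed

text \<open>Prepares \<open>rational_near\<close>, where vectors close to \<beta> must have the same
  residual signs as \<beta>. Taking the linear form 0 leaves only the noise, whose bounded density
  excludes an atom at 0.\<close>

lemma AE_lin_model_residual_nonzero:
  assumes \<sigma>: "0 < \<sigma>" shows "AE p in lin_model d S \<sigma> \<beta>. residual \<beta> d p \<noteq> 0"
proof (rule AE_I)
  interpret prob_space "lin_model d S \<sigma> \<beta>" by (rule prob_space_lin_model[OF \<sigma>])
  interpret N: prob_space "centered_normal \<sigma>" by (rule prob_space_centered_normal[OF \<sigma>])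
  let ?D = "distr (gauss_vec d S) borel (\<lambda>w. \<Sum>i<d. (0::real) * w i)"
  interpret D: prob_space ?D
    by (intro prob_space.prob_space_distr prob_space_gauss_vec) measurable
  have "measure (lin_model d S \<sigma> \<beta>) {p \<in> space (obs_space d). snd (\<Sum>i<d. (0::real) * fst p i, residual \<beta> d p) = 0}
     = measure (?D \<Otimes>\<^sub>M centered_normal \<sigma>) {p. snd p = 0}"
    by (rule lin_model_event_pred[OF \<sigma>, of "\<lambda>p. snd p = 0"]) measurable
  also have "{p :: real \<times> real. snd p = 0} = UNIV \<times> {0}" by auto
  also have "measure (?D \<Otimes>\<^sub>M centered_normal \<sigma>) (UNIV \<times> {0}) = measure ?D UNIV * measure (centered_normal \<sigma>) {0}"
    by (rule measure_pair_times[OF D.prob_space_axioms N.prob_space_axioms]) auto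
  also have "measure (centered_normal \<sigma>) {0} = 0"
  proof -
    have "N.prob {0} \<le> e" if "0 < e" for e
    proof -
      have "N.prob {0} \<le> N.prob {- (e*\<sigma>) <..< e*\<sigma>}" using that \<sigma> by (intro N.finite_measure_mono) auto
      also have "\<dots> \<le> e" using centered_normal_small[OF \<sigma>, of "e*\<sigma>"] that \<sigma> by simp
      finally show ?thesis .
    qed
    then have "N.prob {0} \<le> 0" by (rule field_le_epsilon[of _ 0, simplified])
    then show ?thesis by (simp add: measure_le_0_iff)
  qed
  finally show "emeasure (lin_model d S \<sigma> \<beta>) {p \<in> space (obs_space d). residual \<beta> d p = 0} = 0"
    by (simp add: emeasure_eq_measure)
  show "{p \<in> space (obs_space d). residual \<beta> d p = 0} \<in> events" by measurable
qed auto

lemma card_eq_sum_of_bool: "finite I \<Longrightarrow> real (card {i\<in>I. P i}) = (\<Sum>i\<in>I. of_bool (P i))"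
  by (simp add: sum_of_bool_eq Int_def)

text \<open>On average at most \<open>r * card I\<close> indices of \<open>I\<close> are corrupted,
  and Markov's inequality at 20 times this value leaves 1/20. The level \<open>r\<close> replaces
  the threshold itself, which may be 0 and would make the Markov level vanish.\<close>

lemma contamination_count:
  fixes lam :: "nat \<Rightarrow> real"
  assumes I: "I \<subseteq> {..<n}" "I \<noteq> {}" and lam: "\<And>i. i \<in> I \<Longrightarrow> 0 \<le> lam i \<and> lam i \<le> 1" and r: "0 < r" "\<And>i. i \<in> I \<Longrightarrow> lam i \<le> r"
  defines "PB \<equiv> PiM {..<n} (\<lambda>i. measure_pmf (bernoulli_pmf (lam i)))"
  defines "G \<equiv> {b \<in> space PB. real (card {i\<in>I. b i}) \<le> 20 * r * real (card I)}"
  shows "G \<in> sets PB" "measure PB G \<ge> 19/20"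
proof -
  interpret PB: prob_space PB unfolding PB_def by (intro prob_space_PiM) (rule measure_pmf.prob_space_axioms)
  have fI: "finite I" using I finite_subset by blast
  have N: "0 < real (card I)" using fI I by (simp add: card_gt_0_iff)
  have bm: "(\<lambda>b. b i) \<in> PB \<rightarrow>\<^sub>M count_space UNIV" if "i \<in> I" for i
    unfolding PB_def using that I measurable_component_singleton[of i "{..<n}" "\<lambda>i. measure_pmf (bernoulli_pmf (lam i))"]
    by (auto cong: measurable_cong_sets)
  define u where "u b = (\<Sum>i\<in>I. of_bool (b i) :: real)" for b :: "nat \<Rightarrow> bool"
  have ob: "(\<lambda>b. of_bool (b i) :: real) \<in> borel_measurable PB" if "i \<in> I" for i
    by (rule measurable_compose[OF bm[OF that]]) simp
  have oi: "integrable PB (\<lambda>b. of_bool (b i) :: real)" if "i \<in> I" for i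
    by (rule PB.integrable_const_bound[of _ 1]) (use ob[OF that] in auto)
  have um: "u \<in> borel_measurable PB" unfolding u_def[abs_def] using ob by (intro borel_measurable_sum)
  have ui: "integrable PB u" unfolding u_def[abs_def] using oi by (intro Bochner_Integration.integrable_sum)
  have "(\<integral>b. u b \<partial>PB) = (\<Sum>i\<in>I. \<integral>b. of_bool (b i) \<partial>PB)"
    unfolding u_def using oi by (intro Bochner_Integration.integral_sum)
  also have "\<dots> = (\<Sum>i\<in>I. lam i)"
  proof (intro sum.cong refl)
    fix i assume i: "i \<in> I"
    have "(\<integral>b. of_bool (b i) \<partial>PB) = (\<integral>y. of_bool y \<partial>measure_pmf (bernoulli_pmf (lam i)) :: real)"
      unfolding PB_def using i I by (intro integral_PiM_component) (auto intro: measure_pmf.prob_space_axioms)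
    also have "\<dots> = lam i" using lam[OF i] by simp
    finally show "(\<integral>b. of_bool (b i) \<partial>PB) = lam i" .
  qed
  also have "\<dots> \<le> r * real (card I)" using sum_mono[of I lam "\<lambda>_. r"] r by (simp add: mult.commute)
  finally have E: "(\<integral>b. u b \<partial>PB) \<le> r * real (card I)" .
  have Gu: "G = {b \<in> space PB. u b \<le> 20 * r * real (card I)}"
    unfolding G_def u_def card_eq_sum_of_bool[OF fI] ..
  show G: "G \<in> sets PB" unfolding Gu using um by measurable
  have "PB.prob (space PB - G) \<le> PB.prob {b \<in> space PB. 20 * r * real (card I) \<le> u b}"
    using um by (intro PB.finite_measure_mono) (auto simp: Gu)
  also have "\<dots> \<le> (\<integral>b. u b \<partial>PB) / (20 * r * real (card I))"
    using r N by (intro integral_Markov_inequality_measure[OF ui, of "{}"]) (auto simp: u_def sum_nonneg)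
  also have "\<dots> \<le> (r * real (card I)) / (20 * r * real (card I))" using E r N by (intro divide_right_mono) auto
  also have "\<dots> = 1/20" using r N by simp
  finally show "PB.prob G \<ge> 19/20" using PB.prob_compl[OF G] by simp
qed

text \<open>Three families of half-spaces suffice: the sign of \<open>e * (u \<bullet> w)\<close> controls the depth at
  \<open>\<beta>\<close>, and the two sides of \<open>min 0 e - \<kappa> < u \<bullet> w < max 0 e + \<kappa>\<close> control the depth far away.
  The margin \<open>\<kappa>\<close> makes it possible to restrict to rational directions \<open>u\<close>.\<close>

lemma clean_sample_good:
  fixes \<beta> :: "nat \<Rightarrow> real" and \<sigma> :: real and I :: "nat set"
  assumes d: "1 \<le> d" and S: "pos_def d S" and \<sigma>: "0 < \<sigma>" and I: "I \<subseteq> {..<n}" "I \<noteq> {}"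
    and s: "0 < s" "s \<le> 1"
  defines "PX \<equiv> PiM {..<n} (\<lambda>_. lin_model d S \<sigma> \<beta>)"
  defines "\<kappa> \<equiv> s\<^sup>2 * \<sigma> / 192"
  defines "\<Delta> \<equiv> 10080 * sqrt (real d * real (card I))"
  shows "\<exists>G\<in>sets PX. measure PX G \<ge> 37/40 \<and> (\<forall>x\<in>G. (\<forall>i<n. residual \<beta> d (x i) \<noteq> 0) \<and>
     (\<forall>k. real (card {i\<in>I. residual \<beta> d (x i) * (\<Sum>j<d. qvec k j * fst (x i) j) < 0}) \<le> real (card I) / 2 + \<Delta>) \<and>
     (\<forall>k. (s * \<sigma> / 2)\<^sup>2 \<le> sqnormS d S (qvec k) \<longrightarrow>
        real (card {i\<in>I. min 0 (residual \<beta> d (x i)) - \<kappa> < (\<Sum>j<d. qvec k j * fst (x i) j) \<and>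
          (\<Sum>j<d. qvec k j * fst (x i) j) < max 0 (residual \<beta> d (x i)) + \<kappa>}) \<le> real (card I) * (1/2 - s/192) + 2 * \<Delta>))"
proof -
  let ?P = "lin_model d S \<sigma> \<beta>"
  have P: "prob_space ?P" by (rule prob_space_lin_model[OF \<sigma>])
  interpret P: prob_space ?P by (rule P)
  have PX: "prob_space PX" unfolding PX_def by (rule prob_space_PiM) (rule P)
  interpret PX: prob_space PX by (rule PX)
  have fI: "finite I" by (rule finite_subset[OF I(1)]) simp
  let ?N = "real (card I)"
  let ?dot = "\<lambda>k p. \<Sum>j<d. qvec k j * fst p j"
  define g1 where "g1 k p \<longleftrightarrow> residual \<beta> d p * ?dot k p < 0" for k and p :: obs
  define g2 where "g2 k p \<longleftrightarrow> ?dot k p < max 0 (residual \<beta> d p) + \<kappa>" for k and p :: obs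
  define g3 where "g3 k p \<longleftrightarrow> min 0 (residual \<beta> d p) - \<kappa> < ?dot k p" for k and p :: obs
  define K where "K = {k. (s * \<sigma> / 2)\<^sup>2 \<le> sqnormS d S (qvec k)}"
  have [measurable]: "Measurable.pred (obs_space d) (g1 k)" "Measurable.pred (obs_space d) (g2 k)"
    "Measurable.pred (obs_space d) (g3 k)" for k
    unfolding g1_def[abs_def] g2_def[abs_def] g3_def[abs_def] by measurable
  define C1 where "C1 = insert (\<lambda>_. False) (range g1)"
  define C2 where "C2 = insert (\<lambda>_. False) (g2 ` K)"
  define C3 where "C3 = insert (\<lambda>_. False) (g3 ` K)"
  have Cm: "Measurable.pred ?P g" if "g \<in> C1 \<union> C2 \<union> C3" for g
    using that unfolding C1_def C2_def C3_def by auto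
  \<comment> \<open>The residual is part of the features, so the predicate is linear in the
    direction. The coordinate with index \<open>d\<close> is padded by 0, which gives all three
    classes the same dimension \<open>Suc d\<close>.\<close>
  have vc1: "vc_bounded C1 (Suc d)"
  proof (rule vc_bounded_mono[OF vc_bounded_halfspaces[where D = "Suc d" and \<phi> = "\<lambda>p j. - residual \<beta> d p * (if j < d then fst p j else 0)" and U = UNIV]])
    show "C1 \<subseteq> (\<lambda>u p. 0 < (\<Sum>j<Suc d. u j * (- residual \<beta> d p * (if j < d then fst p j else 0)))) ` UNIV"
      unfolding C1_def
    proof (intro insert_subsetI image_subsetI)
      show "(\<lambda>_. False) \<in> range (\<lambda>u p. 0 < (\<Sum>j<Suc d. u j * (- residual \<beta> d p * (if j < d then fst p j else 0))))"
        by (rule range_eqI[of _ _ "\<lambda>_. 0"]) (simp add: fun_eq_iff)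
      show "g1 k \<in> range (\<lambda>u p. 0 < (\<Sum>j<Suc d. u j * (- residual \<beta> d p * (if j < d then fst p j else 0))))" for k
      proof (rule range_eqI[of _ _ "qvec k"], rule ext)
        fix p :: obs
        have "(\<Sum>j<Suc d. qvec k j * (- residual \<beta> d p * (if j < d then fst p j else 0))) = - (residual \<beta> d p * ?dot k p)"
          by (simp add: sum_distrib_left sum_negf mult.left_commute)
        then show "g1 k p = (0 < (\<Sum>j<Suc d. qvec k j * (- residual \<beta> d p * (if j < d then fst p j else 0))))"
          unfolding g1_def by simp
      qed
    qed
  qed
  \<comment> \<open>The last feature carries the affine term, with coefficient 1; the zero vector
    represents the always false predicate.\<close>
  have vc2: "vc_bounded C2 (Suc d)"
  proof (rule vc_bounded_mono[OF vc_bounded_halfspaces[where D = "Suc d" and \<phi> = "\<lambda>p j. if j < d then fst p j else max 0 (residual \<beta> d p) + \<kappa>" and U = UNIV]])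
    show "C2 \<subseteq> (\<lambda>u p. 0 < (\<Sum>j<Suc d. u j * (if j < d then fst p j else max 0 (residual \<beta> d p) + \<kappa>))) ` UNIV"
      unfolding C2_def
    proof (intro insert_subsetI image_subsetI)
      show "(\<lambda>_. False) \<in> range (\<lambda>u p. 0 < (\<Sum>j<Suc d. u j * (if j < d then fst p j else max 0 (residual \<beta> d p) + \<kappa>)))"
        by (rule range_eqI[of _ _ "\<lambda>_. 0"]) (simp add: fun_eq_iff)
      show "g2 k \<in> range (\<lambda>u p. 0 < (\<Sum>j<Suc d. u j * (if j < d then fst p j else max 0 (residual \<beta> d p) + \<kappa>)))" for k
        by (rule range_eqI[of _ _ "\<lambda>j. if j < d then - qvec k j else 1"]) (auto simp: g2_def fun_eq_iff sum_negf)
    qed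
  qed
  have vc3: "vc_bounded C3 (Suc d)"
  proof (rule vc_bounded_mono[OF vc_bounded_halfspaces[where D = "Suc d" and \<phi> = "\<lambda>p j. if j < d then fst p j else \<kappa> - min 0 (residual \<beta> d p)" and U = UNIV]])
    show "C3 \<subseteq> (\<lambda>u p. 0 < (\<Sum>j<Suc d. u j * (if j < d then fst p j else \<kappa> - min 0 (residual \<beta> d p)))) ` UNIV"
      unfolding C3_def
    proof (intro insert_subsetI image_subsetI)
      show "(\<lambda>_. False) \<in> range (\<lambda>u p. 0 < (\<Sum>j<Suc d. u j * (if j < d then fst p j else \<kappa> - min 0 (residual \<beta> d p))))"
        by (rule range_eqI[of _ _ "\<lambda>_. 0"]) (simp add: fun_eq_iff)
      show "g3 k \<in> range (\<lambda>u p. 0 < (\<Sum>j<Suc d. u j * (if j < d then fst p j else \<kappa> - min 0 (residual \<beta> d p))))" for k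
        by (rule range_eqI[of _ _ "\<lambda>j. if j < d then qvec k j else 1"]) (auto simp: g3_def fun_eq_iff)
    qed
  qed
  have cnt: "countable C1" "countable C2" "countable C3" by (auto simp: C1_def C2_def C3_def)
  define B where "B C = {x \<in> space PX. \<exists>g\<in>C. ?N * measure ?P {p\<in>space ?P. g p} +
      6720 * sqrt (real (Suc d) * ?N) < (\<Sum>i\<in>I. of_bool (g (x i)))}" for C :: "(obs \<Rightarrow> bool) set"
  have B: "B C \<in> sets PX" "PX.prob (B C) \<le> 1/40"
    if "countable C" "(\<lambda>_. False) \<in> C" "vc_bounded C (Suc d)" "C \<subseteq> C1 \<union> C2 \<union> C3" for C
    unfolding B_def PX_def using vc_deviation[OF P finite_lessThan I that(1,2) Cm that(3)] that(4) by auto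
  have B1: "B C1 \<in> sets PX" "PX.prob (B C1) \<le> 1/40" by (rule B; use cnt vc1 in \<open>auto simp: C1_def\<close>)+
  have B2: "B C2 \<in> sets PX" "PX.prob (B C2) \<le> 1/40" by (rule B; use cnt vc2 in \<open>auto simp: C2_def\<close>)+
  have B3: "B C3 \<in> sets PX" "PX.prob (B C3) \<le> 1/40" by (rule B; use cnt vc3 in \<open>auto simp: C3_def\<close>)+
  have "AE x in PX. \<forall>i\<in>{..<n}. residual \<beta> d (x i) \<noteq> 0"
    unfolding PX_def using P AE_lin_model_residual_nonzero[OF \<sigma>]
    by (intro AE_finite_allI finite_lessThan AE_PiM_component) auto
  then obtain Z where Z: "{x \<in> space PX. \<not> (\<forall>i\<in>{..<n}. residual \<beta> d (x i) \<noteq> 0)} \<subseteq> Z" "emeasure PX Z = 0" "Z \<in> sets PX"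
    by (rule AE_E)
  \<comment> \<open>Three events of probability at most 1/40 and a null set are removed, which
    leaves 37/40.\<close>
  define G where "G = space PX - (Z \<union> (B C1 \<union> (B C2 \<union> B C3)))"
  have Gs: "G \<in> sets PX" unfolding G_def using Z B1 B2 B3 by auto
  have "PX.prob (Z \<union> (B C1 \<union> (B C2 \<union> B C3))) \<le> PX.prob Z + (PX.prob (B C1) + (PX.prob (B C2) + PX.prob (B C3)))"
    using Z B1 B2 B3 by (intro order.trans[OF measure_Un_le] add_left_mono) auto
  also have "\<dots> \<le> 3/40" using B1 B2 B3 Z(2) by (simp add: measure_def)
  finally have "PX.prob G \<ge> 37/40"
    unfolding G_def using Z B1 B2 B3 by (subst PX.prob_compl) auto
  \<comment> \<open>For d \<ge> 1, d + 1 is at most (9/4) d, so the square root costs a factor 3/2: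
    10080 = 6720 * 3/2.\<close>
  moreover have "6720 * sqrt (real (Suc d) * ?N) \<le> \<Delta>"
  proof -
    have "real (Suc d) * ?N \<le> (3/2)\<^sup>2 * (real d * ?N)"
      using d mult_right_mono[of "real (Suc d)" "9/4 * real d" ?N] by (simp add: power2_eq_square)
    then have "sqrt (real (Suc d) * ?N) \<le> sqrt ((3/2)\<^sup>2 * (real d * ?N))" by (rule real_sqrt_le_mono)
    also have "\<dots> = 3/2 * sqrt (real d * ?N)" by (simp only: real_sqrt_mult) simp
    finally show ?thesis by (simp add: \<Delta>_def)
  qed
  have good: "real (card {i\<in>I. g (x i)}) \<le> ?N * measure ?P {p\<in>space ?P. g p} + \<Delta>"
    if "x \<in> G" "g \<in> C" "C = C1 \<or> C = C2 \<or> C = C3" for x g C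
  proof -
    have "x \<notin> B C" "x \<in> space PX" using that by (auto simp: G_def)
    then have "(\<Sum>i\<in>I. of_bool (g (x i))) \<le> ?N * measure ?P {p\<in>space ?P. g p} + 6720 * sqrt (real (Suc d) * ?N)"
      using that(2) unfolding B_def by (auto simp: not_less)
    then show ?thesis using \<open>_ \<le> \<Delta>\<close> by (simp add: card_eq_sum_of_bool[OF fI])
  qed
  have p1: "measure ?P {p\<in>space ?P. g1 k p} \<le> 1/2" for k
  proof -
    have "measure ?P {p\<in>space ?P. g1 k p} = measure (distr (gauss_vec d S) borel (\<lambda>w. \<Sum>i<d. qvec k i * w i) \<Otimes>\<^sub>M centered_normal \<sigma>)
       {p. snd p * fst p < 0}"
      using lin_model_event_pred[OF \<sigma>, of "\<lambda>p. snd p * fst p < 0" d S \<beta> "qvec k"] by (simp add: g1_def)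
    also have "\<dots> \<le> 1/2"
      by (intro opposite_signs_prob prob_space.prob_space_distr prob_space_gauss_vec \<sigma>) auto
    finally show ?thesis .
  qed
  \<comment> \<open>The slab is the intersection of two half-spaces that together cover everything.
    Inclusion and exclusion passes between the intersection and the sum, here for probabilities and
    further down for counts, so the uniform deviation bound is invoked for half-spaces only.\<close>
  have p23: "measure ?P {p\<in>space ?P. g2 k p} + measure ?P {p\<in>space ?P. g3 k p} \<le> 1 + (1/2 - s/192)" if k: "k \<in> K" for k
  proof -
    let ?H2 = "{p\<in>space ?P. g2 k p}" and ?H3 = "{p\<in>space ?P. g3 k p}"
    have Hs: "?H2 \<in> P.events" "?H3 \<in> P.events" by measurable
    have q: "(s * \<sigma> / 2)\<^sup>2 \<le> sqnormS d S (qvec k)" using k by (simp add: K_def)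
    moreover have "0 < (s * \<sigma> / 2)\<^sup>2" using s \<sigma> by simp
    ultimately have q0: "0 < sqnormS d S (qvec k)" by linarith
    have "measure ?P (?H2 \<inter> ?H3) = measure ?P {p\<in>space (obs_space d).
        (\<lambda>p. min 0 (snd p) - \<kappa> < fst p \<and> fst p < max 0 (snd p) + \<kappa>) (?dot k p, residual \<beta> d p)}"
      by (intro arg_cong[of _ _ "measure ?P"]) (auto simp: g2_def g3_def)
    also have "\<dots> = measure (centered_normal (sqrt (sqnormS d S (qvec k))) \<Otimes>\<^sub>M centered_normal \<sigma>)
        {p. min 0 (snd p) - \<kappa> < fst p \<and> fst p < max 0 (snd p) + \<kappa>}"
      unfolding gauss_vec_dot[OF S q0, symmetric] by (rule lin_model_event_pred[OF \<sigma>]) measurable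
    also have "\<dots> \<le> 1/2 - s/192"
      unfolding \<kappa>_def by (rule near_between_prob[OF \<sigma> s real_le_rsqrt[OF q]])
    finally have "P.prob (?H2 \<inter> ?H3) \<le> 1/2 - s/192" .
    moreover have "P.prob (?H2 - ?H3) = P.prob ?H2 - P.prob (?H2 \<inter> ?H3)"
      by (rule P.finite_measure_Diff'[OF Hs])
    moreover have "P.prob (?H2 - ?H3) + P.prob ?H3 = P.prob ((?H2 - ?H3) \<union> ?H3)"
      using Hs by (intro P.finite_measure_Union[symmetric]) auto
    ultimately show ?thesis using P.prob_le_1[of "(?H2 - ?H3) \<union> ?H3"] by linarith
  qed
  have "\<kappa> > 0" using s \<sigma> by (simp add: \<kappa>_def)
  have "(\<forall>i<n. residual \<beta> d (x i) \<noteq> 0) \<and>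
     (\<forall>k. real (card {i\<in>I. residual \<beta> d (x i) * (\<Sum>j<d. qvec k j * fst (x i) j) < 0}) \<le> ?N / 2 + \<Delta>) \<and>
     (\<forall>k. (s * \<sigma> / 2)\<^sup>2 \<le> sqnormS d S (qvec k) \<longrightarrow>
        real (card {i\<in>I. min 0 (residual \<beta> d (x i)) - \<kappa> < (\<Sum>j<d. qvec k j * fst (x i) j) \<and>
          (\<Sum>j<d. qvec k j * fst (x i) j) < max 0 (residual \<beta> d (x i)) + \<kappa>}) \<le> ?N * (1/2 - s/192) + 2 * \<Delta>)"
    if x: "x \<in> G" for x
  proof (intro conjI allI impI)
    show "residual \<beta> d (x i) \<noteq> 0" if "i < n" for i using x Z(1) that by (auto simp: G_def)
    show "real (card {i\<in>I. residual \<beta> d (x i) * ?dot k (x i) < 0}) \<le> ?N / 2 + \<Delta>" for k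
    proof -
      have "real (card {i\<in>I. g1 k (x i)}) \<le> ?N * measure ?P {p\<in>space ?P. g1 k p} + \<Delta>"
        by (rule good[OF x, of _ C1]) (auto simp: C1_def)
      also have "?N * measure ?P {p\<in>space ?P. g1 k p} \<le> ?N * (1/2)" using p1 by (intro mult_left_mono) auto
      finally show ?thesis by (simp add: g1_def)
    qed
    fix k assume k: "(s * \<sigma> / 2)\<^sup>2 \<le> sqnormS d S (qvec k)"
    have 2: "real (card {i\<in>I. g2 k (x i)}) \<le> ?N * measure ?P {p\<in>space ?P. g2 k p} + \<Delta>"
      by (rule good[OF x, of _ C2]) (use k in \<open>auto simp: C2_def K_def\<close>)
    have 3: "real (card {i\<in>I. g3 k (x i)}) \<le> ?N * measure ?P {p\<in>space ?P. g3 k p} + \<Delta>"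
      by (rule good[OF x, of _ C3]) (use k in \<open>auto simp: C3_def K_def\<close>)
    have cov: "{i\<in>I. g2 k (x i)} \<union> {i\<in>I. g3 k (x i)} = I"
      using \<open>\<kappa> > 0\<close> by (auto simp: g2_def g3_def)
    have "card {i\<in>I. g2 k (x i)} + card {i\<in>I. g3 k (x i)} = card ({i\<in>I. g2 k (x i)} \<union> {i\<in>I. g3 k (x i)})
      + card ({i\<in>I. g2 k (x i)} \<inter> {i\<in>I. g3 k (x i)})" using fI by (intro card_Un_Int) auto
    also have "{i\<in>I. g2 k (x i)} \<inter> {i\<in>I. g3 k (x i)} = {i\<in>I. g3 k (x i) \<and> g2 k (x i)}" by auto
    finally have "real (card {i\<in>I. g3 k (x i) \<and> g2 k (x i)}) = real (card {i\<in>I. g2 k (x i)}) + real (card {i\<in>I. g3 k (x i)}) - ?N"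
      unfolding cov by linarith
    also have "\<dots> \<le> ?N * (measure ?P {p\<in>space ?P. g2 k p} + measure ?P {p\<in>space ?P. g3 k p}) + 2 * \<Delta> - ?N"
      using 2 3 by (simp add: distrib_left)
    also have "\<dots> \<le> ?N * (1 + (1/2 - s/192)) + 2 * \<Delta> - ?N"
      using p23[of k] k by (intro diff_right_mono add_right_mono mult_left_mono) (auto simp: K_def)
    also have "\<dots> = ?N * (1/2 - s/192) + 2 * \<Delta>" by (simp add: algebra_simps)
    finally show "real (card {i\<in>I. min 0 (residual \<beta> d (x i)) - \<kappa> < ?dot k (x i) \<and> ?dot k (x i) < max 0 (residual \<beta> d (x i)) + \<kappa>})
       \<le> ?N * (1/2 - s/192) + 2 * \<Delta>" by (simp only: g2_def g3_def)
  qed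
  then show ?thesis using Gs \<open>PX.prob G \<ge> 37/40\<close> by blast
qed

section \<open>Regression depth\<close>

abbreviation dot :: "nat \<Rightarrow> (nat \<Rightarrow> real) \<Rightarrow> obs \<Rightarrow> real" where
  "dot d u p \<equiv> \<Sum>j<d. u j * fst p j"

text \<open>The depth in one direction before normalization, for equal weights on \<open>I\<close>.
  Only signs matter, so \<open>v\<close> need not be a unit vector.\<close>

definition agree_count :: "nat \<Rightarrow> nat set \<Rightarrow> (nat \<Rightarrow> real) \<Rightarrow> (nat \<Rightarrow> real) \<Rightarrow> (nat \<Rightarrow> obs) \<Rightarrow> real" where
  "agree_count d I \<eta> v z = real (card {i\<in>I. 0 \<le> (snd (z i) - dot d \<eta> (z i)) * dot d v (z i)})"

lemma qvec_dot_tendsto: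
  assumes "\<forall>i<d. (\<lambda>m. qvec (f m) i) \<longlonglongrightarrow> x i"
  shows "(\<lambda>m. dot d (qvec (f m)) p) \<longlonglongrightarrow> dot d x p"
  using assms by (intro tendsto_sum tendsto_mult tendsto_const) auto

text \<open>Finitely many strict inequalities survive a small perturbation of \<open>v\<close>. Weak
  ones may fail, so only disagreement is transferred to the rational direction.\<close>

lemma rational_direction_neg:
  assumes "finite I"
  shows "\<exists>k. \<forall>i\<in>I. c i * dot d v (z i) < 0 \<longrightarrow> c i * dot d (qvec k) (z i) < 0"
proof -
  obtain f where f: "\<forall>i<d. (\<lambda>m. qvec (f m) i) \<longlonglongrightarrow> v i" using qvec_tendsto by blast
  have "\<forall>i\<in>I. \<forall>\<^sub>F m in sequentially. c i * dot d v (z i) < 0 \<longrightarrow> c i * dot d (qvec (f m)) (z i) < 0"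
  proof
    fix i assume "i \<in> I"
    show "\<forall>\<^sub>F m in sequentially. c i * dot d v (z i) < 0 \<longrightarrow> c i * dot d (qvec (f m)) (z i) < 0"
    proof (cases "c i * dot d v (z i) < 0")
      case True
      have "(\<lambda>m. c i * dot d (qvec (f m)) (z i)) \<longlonglongrightarrow> c i * dot d v (z i)"
        by (intro tendsto_mult tendsto_const qvec_dot_tendsto f)
      from order_tendstoD(2)[OF this True] show ?thesis by (rule eventually_mono) simp
    qed simp
  qed
  then have "\<forall>\<^sub>F m in sequentially. \<forall>i\<in>I. c i * dot d v (z i) < 0 \<longrightarrow> c i * dot d (qvec (f m)) (z i) < 0"
    by (simp only: eventually_ball_finite_distrib[OF assms])
  then obtain m where "\<forall>i\<in>I. c i * dot d v (z i) < 0 \<longrightarrow> c i * dot d (qvec (f m)) (z i) < 0"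
    using eventually_happens'[OF sequentially_bot] by blast
  then show ?thesis by blast
qed

text \<open>Strict disagreements survive, so the count can only drop. Hence rational directions
  already decide whether some direction brings the count below a given level, and the measurable
  estimator may test just these.\<close>

lemma agree_count_rational_direction:
  assumes I: "finite I" and v: "\<exists>j<d. v j \<noteq> 0"
  shows "\<exists>l. (\<exists>j<d. qvec l j \<noteq> 0) \<and> agree_count d I \<eta> (qvec l) z \<le> agree_count d I \<eta> v z"
proof -
  obtain j0 where j0: "j0 < d" "v j0 \<noteq> 0" using v by blast
  \<comment> \<open>The additional point \<open>None\<close> forces the rational direction to be nonzero.\<close>
  define z' where "z' i = (case i of None \<Rightarrow> (\<lambda>j. if j = j0 then - v j0 else 0, 0) | Some i \<Rightarrow> z i)" for i
  define c where "c i = (case i of None \<Rightarrow> 1 | Some i \<Rightarrow> snd (z i) - dot d \<eta> (z i))" for i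
  have N: "dot d u (z' None) = - u j0 * v j0" for u
  proof -
    have "dot d u (z' None) = (\<Sum>j<d. if j = j0 then - u j0 * v j0 else 0)"
      unfolding z'_def by (intro sum.cong refl) auto
    then show ?thesis using j0 by simp
  qed
  have "finite (insert None (Some ` I))" using I by simp
  from rational_direction_neg[OF this, where c = c and d = d and v = v and z = z'] obtain l where
    l: "\<forall>i\<in>insert None (Some ` I). c i * dot d v (z' i) < 0 \<longrightarrow> c i * dot d (qvec l) (z' i) < 0" by blast
  have "c None * dot d v (z' None) < 0" using j0 by (simp add: N c_def) (simp add: zero_less_mult_iff linorder_neq_iff[symmetric])
  then have "qvec l j0 \<noteq> 0" using l by (auto simp: N)
  moreover have "agree_count d I \<eta> (qvec l) z \<le> agree_count d I \<eta> v z"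
    unfolding agree_count_def of_nat_le_iff
  proof (intro card_mono subsetI)
    fix i assume i: "i \<in> {i\<in>I. 0 \<le> (snd (z i) - dot d \<eta> (z i)) * dot d (qvec l) (z i)}"
    have "Some i \<in> insert None (Some ` I)" using i by simp
    then have "c (Some i) * dot d v (z' (Some i)) < 0 \<longrightarrow> c (Some i) * dot d (qvec l) (z' (Some i)) < 0" using l by (rule bspec[rotated])
    then have "(snd (z i) - dot d \<eta> (z i)) * dot d v (z i) < 0 \<longrightarrow> (snd (z i) - dot d \<eta> (z i)) * dot d (qvec l) (z i) < 0"
      by (simp only: c_def z'_def option.case)
    then show "i \<in> {i\<in>I. 0 \<le> (snd (z i) - dot d \<eta> (z i)) * dot d v (z i)}" using i by (simp add: not_less[symmetric])
  qed (use I in simp)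
  ultimately show ?thesis using j0 by blast
qed

text \<open>An index that disagrees is either corrupted or, by \<open>near\<close>, disagrees
  already for the clean residual of \<beta>. The hypothesis \<open>near\<close> is met by \<beta>
  itself and by rational vectors with the same residual signs.\<close>

lemma agree_count_near_lower:
  assumes I: "finite I" and z: "\<And>i. i \<in> I \<Longrightarrow> \<not> b i \<Longrightarrow> z i = x i"
    and A: "\<And>k. real (card {i\<in>I. residual \<beta> d (x i) * dot d (qvec k) (x i) < 0}) \<le> a"
    and c: "real (card {i\<in>I. b i}) \<le> c"
    and near: "\<And>i r. i \<in> I \<Longrightarrow> (snd (x i) - dot d \<eta> (x i)) * r < 0 \<Longrightarrow> residual \<beta> d (x i) * r < 0"
  shows "real (card I) - a - c \<le> agree_count d I \<eta> v z"
proof -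
  obtain k where k: "\<forall>i\<in>I. residual \<beta> d (x i) * dot d v (x i) < 0 \<longrightarrow> residual \<beta> d (x i) * dot d (qvec k) (x i) < 0"
    using rational_direction_neg[OF I, where c = "\<lambda>i. residual \<beta> d (x i)" and d = d and v = v and z = x] by blast
  let ?A = "{i\<in>I. 0 \<le> (snd (z i) - dot d \<eta> (z i)) * dot d v (z i)}"
  let ?B = "{i\<in>I. residual \<beta> d (x i) * dot d (qvec k) (x i) < 0}" and ?C = "{i\<in>I. b i}"
  have "I \<subseteq> ?A \<union> (?B \<union> ?C)"
  proof
    fix i assume i: "i \<in> I"
    show "i \<in> ?A \<union> (?B \<union> ?C)"
    proof (cases "b i \<or> 0 \<le> (snd (z i) - dot d \<eta> (z i)) * dot d v (z i)")
      case False
      then have "(snd (x i) - dot d \<eta> (x i)) * dot d v (x i) < 0" using z[OF i] by simp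
      from near[OF i this] k i show ?thesis by blast
    qed (use i in blast)
  qed
  then have "card I \<le> card (?A \<union> (?B \<union> ?C))" using I by (intro card_mono) auto
  also have "\<dots> \<le> card ?A + (card ?B + card ?C)"
    by (rule order.trans[OF card_Un_le add_left_mono[OF card_Un_le]])
  finally have "real (card I) \<le> real (card ?A) + (real (card ?B) + real (card ?C))" by (simp flip: of_nat_add)
  then show ?thesis using A[of k] c unfolding agree_count_def by linarith
qed

lemma sqnormS_scale: "sqnormS d S (\<lambda>i. c * x i) = c\<^sup>2 * sqnormS d S x"
  by (simp add: sqnormS_def sum_distrib_left power2_eq_square ac_simps)

text \<open>The direction is \<eta> - \<beta>. With w the value of this form and e the clean
  residual, agreement means 0 \<le> (e - w) w, that is, w lies between 0 and e. Shrinking the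
  direction to norm s \<sigma> keeps its value in this interval, and the margin \<kappa> pays for a
  rational approximation.\<close>

lemma agree_count_far_upper:
  assumes I: "finite I" and z: "\<And>i. i \<in> I \<Longrightarrow> \<not> b i \<Longrightarrow> z i = x i" and s: "0 < s" "0 < \<sigma>" "0 < \<kappa>"
    and A: "\<And>k. (s * \<sigma> / 2)\<^sup>2 \<le> sqnormS d S (qvec k) \<Longrightarrow>
        real (card {i\<in>I. min 0 (residual \<beta> d (x i)) - \<kappa> < dot d (qvec k) (x i) \<and>
          dot d (qvec k) (x i) < max 0 (residual \<beta> d (x i)) + \<kappa>}) \<le> a"
    and c: "real (card {i\<in>I. b i}) \<le> c"
    and far: "(s * \<sigma>)\<^sup>2 \<le> sqnormS d S (\<lambda>i. \<eta> i - \<beta> i)"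
  shows "\<exists>v. (\<exists>j<d. v j \<noteq> 0) \<and> agree_count d I \<eta> v z \<le> a + c"
proof -
  define \<delta> where "\<delta> i = \<eta> i - \<beta> i" for i
  let ?q = "sqnormS d S \<delta>"
  have ss: "0 < (s * \<sigma>)\<^sup>2" using s by simp
  have q: "0 < ?q" "(s * \<sigma>)\<^sup>2 \<le> ?q" using far ss unfolding \<delta>_def by linarith+
  define h where "h = s * \<sigma> / sqrt ?q"
  have h: "0 < h" "h \<le> 1"
    using s q real_le_rsqrt[OF q(2)] by (auto simp: h_def field_simps)
  have h2: "sqnormS d S (\<lambda>i. h * \<delta> i) = (s * \<sigma>)\<^sup>2"
    unfolding sqnormS_scale using q by (simp add: h_def power_divide)
  have \<delta>0: "\<exists>j<d. \<delta> j \<noteq> 0"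
  proof (rule ccontr)
    assume "\<not> ?thesis"
    then have "?q = 0" by (simp add: sqnormS_def)
    then show False using q by simp
  qed
  obtain f where f: "\<forall>i<d. (\<lambda>m. qvec (f m) i) \<longlonglongrightarrow> h * \<delta> i" using qvec_tendsto[of d "\<lambda>i. h * \<delta> i"] by blast
  have "(\<lambda>m. sqnormS d S (qvec (f m))) \<longlonglongrightarrow> sqnormS d S (\<lambda>i. h * \<delta> i)"
    unfolding sqnormS_def using f by (intro tendsto_sum tendsto_mult tendsto_const) auto
  moreover have "(s * \<sigma> / 2)\<^sup>2 < sqnormS d S (\<lambda>i. h * \<delta> i)" unfolding h2 using ss by (simp add: power_divide)
  ultimately have e1: "\<forall>\<^sub>F m in sequentially. (s * \<sigma> / 2)\<^sup>2 < sqnormS d S (qvec (f m))" by (rule order_tendstoD(1))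
  have e2: "\<forall>\<^sub>F m in sequentially. \<forall>i\<in>I. dist (dot d (qvec (f m)) (x i)) (dot d (\<lambda>i. h * \<delta> i) (x i)) < \<kappa>"
    unfolding eventually_ball_finite_distrib[OF I]
    using tendstoD[OF qvec_dot_tendsto[OF f] s(3)] by blast
  have "\<forall>\<^sub>F m in sequentially. (s * \<sigma> / 2)\<^sup>2 < sqnormS d S (qvec (f m)) \<and>
      (\<forall>i\<in>I. dist (dot d (qvec (f m)) (x i)) (dot d (\<lambda>i. h * \<delta> i) (x i)) < \<kappa>)"
    using e1 e2 by (rule eventually_conj)
  then obtain m where m: "(s * \<sigma> / 2)\<^sup>2 < sqnormS d S (qvec (f m))"
      "\<forall>i\<in>I. dist (dot d (qvec (f m)) (x i)) (dot d (\<lambda>i. h * \<delta> i) (x i)) < \<kappa>"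
    using eventually_happens'[OF sequentially_bot] by blast
  let ?A = "{i\<in>I. 0 \<le> (snd (z i) - dot d \<eta> (z i)) * dot d \<delta> (z i)}"
  let ?B = "{i\<in>I. min 0 (residual \<beta> d (x i)) - \<kappa> < dot d (qvec (f m)) (x i) \<and>
          dot d (qvec (f m)) (x i) < max 0 (residual \<beta> d (x i)) + \<kappa>}" and ?C = "{i\<in>I. b i}"
  have "?A \<subseteq> ?B \<union> ?C"
  proof
    fix i assume i: "i \<in> ?A"
    show "i \<in> ?B \<union> ?C"
    proof (cases "b i")
      case False
      define e where "e = residual \<beta> d (x i)"
      define w where "w = dot d \<delta> (x i)"
      have zi: "z i = x i" using z False i by simp
      have "snd (x i) - dot d \<eta> (x i) = e - w"
        by (simp add: e_def w_def residual_def \<delta>_def algebra_simps sum_subtractf)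
      then have ew: "0 \<le> (e - w) * w" using i zi by (simp add: w_def)
      have hw: "dot d (\<lambda>i. h * \<delta> i) (x i) = h * w" by (simp add: w_def sum_distrib_left mult.assoc)
      have "min 0 e \<le> h * w \<and> h * w \<le> max 0 e"
      proof (cases "0 < w")
        case True
        then have "w \<le> e" using ew by (simp add: zero_le_mult_iff)
        moreover have "h * w \<le> w" "0 \<le> h * w" using True h by (auto simp: mult_le_cancel_right1)
        ultimately show ?thesis by linarith
      next
        case F: False
        show ?thesis
        proof (cases "w = 0")
          case False
          then have "w < 0" using F by simp
          then have "e \<le> w" using ew by (simp add: zero_le_mult_iff)
          moreover have "w \<le> h * w" "h * w \<le> 0"
            using \<open>w < 0\<close> h by (auto simp: mult_le_cancel_right2 mult_nonneg_nonpos)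
          ultimately show ?thesis by linarith
        qed simp
      qed
      moreover have "\<bar>dot d (qvec (f m)) (x i) - h * w\<bar> < \<kappa>"
        using m(2) i unfolding hw[symmetric] dist_real_def by blast
      ultimately have "min 0 e - \<kappa> < dot d (qvec (f m)) (x i) \<and> dot d (qvec (f m)) (x i) < max 0 e + \<kappa>"
        unfolding abs_less_iff by linarith
      then show ?thesis using i by (simp add: e_def)
    qed (use i in blast)
  qed
  then have "card ?A \<le> card (?B \<union> ?C)" using I by (intro card_mono) auto
  also have "\<dots> \<le> card ?B + card ?C" by (rule card_Un_le)
  finally have "real (card ?A) \<le> real (card ?B) + real (card ?C)" by (simp flip: of_nat_add)
  also have "\<dots> \<le> a + c" using A[of "f m"] m(1) c by (intro add_mono) auto
  finally show ?thesis using \<delta>0 unfolding agree_count_def by blast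
qed

text \<open>Nonzero residuals keep their signs under a small change of \<beta>. This places a vector
  with the depth guarantee of \<beta> in the countable search set of the measurable
  estimator.\<close>

lemma rational_near:
  assumes I: "finite I" and nz: "\<And>i. i \<in> I \<Longrightarrow> residual \<beta> d (x i) \<noteq> 0"
  shows "\<exists>k. \<forall>i\<in>I. \<forall>r. (snd (x i) - dot d (qvec k) (x i)) * r < 0 \<longrightarrow> residual \<beta> d (x i) * r < 0"
proof -
  obtain f where f: "\<forall>i<d. (\<lambda>m. qvec (f m) i) \<longlonglongrightarrow> \<beta> i" using qvec_tendsto by blast
  have "\<forall>\<^sub>F m in sequentially. 0 < (snd (x i) - dot d (qvec (f m)) (x i)) * residual \<beta> d (x i)" if "i \<in> I" for i
  proof (rule order_tendstoD(1))
    show "(\<lambda>m. (snd (x i) - dot d (qvec (f m)) (x i)) * residual \<beta> d (x i)) \<longlonglongrightarrow> (snd (x i) - dot d \<beta> (x i)) * residual \<beta> d (x i)"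
      by (intro tendsto_mult tendsto_diff tendsto_const qvec_dot_tendsto f)
    have "(snd (x i) - dot d \<beta> (x i)) * residual \<beta> d (x i) = residual \<beta> d (x i) * residual \<beta> d (x i)" by (simp only: residual_def)
    then show "0 < (snd (x i) - dot d \<beta> (x i)) * residual \<beta> d (x i)" using nz[OF that]
      by (simp add: zero_less_mult_iff linorder_neq_iff[symmetric])
  qed
  then have "\<forall>\<^sub>F m in sequentially. \<forall>i\<in>I. 0 < (snd (x i) - dot d (qvec (f m)) (x i)) * residual \<beta> d (x i)"
    unfolding eventually_ball_finite_distrib[OF I] by blast
  then obtain m where m: "\<forall>i\<in>I. 0 < (snd (x i) - dot d (qvec (f m)) (x i)) * residual \<beta> d (x i)"
    using eventually_happens'[OF sequentially_bot] by blast
  have sg: "0 < p * q \<Longrightarrow> p * r < 0 \<Longrightarrow> q * r < 0" for p q r :: real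
    by (auto simp: zero_less_mult_iff mult_less_0_iff)
  show ?thesis using m sg by (intro exI[of _ "f m"]) blast
qed

section \<open>Regression depth under threshold weights\<close>

lemma sum_thr_weights:
  assumes "0 < Ncount n lam t"
  shows "(\<Sum>i<n. thr_weights n lam t i * (if P i then 1 else 0)) = real (card {i\<in>{i. i < n \<and> lam i \<le> t}. P i}) / real (Ncount n lam t)"
proof -
  have "(\<Sum>i<n. thr_weights n lam t i * (if P i then 1 else 0)) =
     (\<Sum>i<n. if lam i \<le> t \<and> P i then 1 / real (Ncount n lam t) else 0)"
    by (intro sum.cong refl) (simp add: thr_weights_def)
  also have "\<dots> = (\<Sum>i\<in>{i\<in>{..<n}. lam i \<le> t \<and> P i}. 1 / real (Ncount n lam t))"
    by (rule sum.inter_filter[symmetric]) simp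
  also have "{i\<in>{..<n}. lam i \<le> t \<and> P i} = {i\<in>{i. i < n \<and> lam i \<le> t}. P i}" by auto
  finally show ?thesis by simp
qed

lemma depth_thr_weights:
  assumes "0 < Ncount n lam t"
  shows "depth d n (thr_weights n lam t) \<eta> z =
    Inf {agree_count d {i. i < n \<and> lam i \<le> t} \<eta> v z / real (Ncount n lam t) | v. (\<Sum>j<d. (v j)\<^sup>2) = 1}"
  unfolding depth_def agree_count_def sum_thr_weights[OF assms] ..

lemma le_depth:
  assumes N: "0 < Ncount n lam t" and d: "1 \<le> d"
    and le: "\<And>v. \<theta> * real (Ncount n lam t) \<le> agree_count d {i. i < n \<and> lam i \<le> t} \<eta> v z"
  shows "\<theta> \<le> depth d n (thr_weights n lam t) \<eta> z"
  unfolding depth_thr_weights[OF N]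
proof (rule cInf_greatest)
  \<comment> \<open>A unit vector exists because \<open>1 \<le> d\<close>; bounding an infimum of
    reals from below requires a nonempty set.\<close>
  have "(\<Sum>j<d. (if j = 0 then 1 else 0 :: real)\<^sup>2) = (\<Sum>j<d. if j = 0 then 1 else 0)" by (intro sum.cong) auto
  also have "\<dots> = 1" using d by simp
  finally show "{agree_count d {i. i < n \<and> lam i \<le> t} \<eta> v z / real (Ncount n lam t) | v. (\<Sum>j<d. (v j)\<^sup>2) = 1} \<noteq> {}"
    by (auto intro!: exI[of _ "\<lambda>j. if j = 0 then 1 else 0"])
qed (use le N in \<open>auto simp: pos_le_divide_eq\<close>)

lemma depth_less:
  assumes N: "0 < Ncount n lam t" and v: "\<exists>j<d. v j \<noteq> 0"
    and less: "agree_count d {i. i < n \<and> lam i \<le> t} \<eta> v z < \<theta> * real (Ncount n lam t)"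
  shows "depth d n (thr_weights n lam t) \<eta> z < \<theta>"
proof -
  define h where "h = sqrt (\<Sum>j<d. (v j)\<^sup>2)"
  have "0 < (\<Sum>j<d. (v j)\<^sup>2)"
    using v by (metis finite_lessThan lessThan_iff sum_pos2 zero_le_power2 zero_less_power2)
  then have h: "0 < h" "h\<^sup>2 = (\<Sum>j<d. (v j)\<^sup>2)" by (auto simp: h_def)
  define v' where "v' j = v j / h" for j
  have "(\<Sum>j<d. (v' j)\<^sup>2) = 1"
    unfolding v'_def power_divide sum_divide_distrib[symmetric] h(2)[symmetric] using h(1) by simp
  moreover have "agree_count d {i. i < n \<and> lam i \<le> t} \<eta> v' z = agree_count d {i. i < n \<and> lam i \<le> t} \<eta> v z"
  proof -
    have "dot d v' p = dot d v p / h" for p by (simp add: v'_def sum_divide_distrib)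
    then show ?thesis using h(1) by (simp add: agree_count_def zero_le_divide_iff zero_le_mult_iff)
  qed
  ultimately have "depth d n (thr_weights n lam t) \<eta> z \<le> agree_count d {i. i < n \<and> lam i \<le> t} \<eta> v z / real (Ncount n lam t)"
    unfolding depth_thr_weights[OF N]
    by (intro cInf_lower bdd_belowI[of _ 0]) (auto simp: agree_count_def intro!: exI[of _ v'])
  also have "\<dots> < \<theta>" using less N by (simp add: pos_divide_less_eq)
  finally show ?thesis .
qed

section \<open>Contaminated samples and the upper bound\<close>

abbreviation clean_law :: "nat \<Rightarrow> nat \<Rightarrow> (nat \<Rightarrow> nat \<Rightarrow> real) \<Rightarrow> real \<Rightarrow> (nat \<Rightarrow> real) \<Rightarrow> (nat \<Rightarrow> real)
    \<Rightarrow> ((nat \<Rightarrow> obs) \<times> (nat \<Rightarrow> bool)) measure" where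
  "clean_law d n S \<sigma> lam \<beta> \<equiv>
    PiM {..<n} (\<lambda>_. lin_model d S \<sigma> \<beta>) \<Otimes>\<^sub>M PiM {..<n} (\<lambda>i. measure_pmf (bernoulli_pmf (lam i)))"

lemma prob_space_bernoulli_PiM: "prob_space (PiM I (\<lambda>i. measure_pmf (bernoulli_pmf (lam i))))"
  by (intro prob_space_PiM measure_pmf.prob_space_axioms)

lemma sets_data_bits[simp, measurable_cong]:
  "sets (clean_law d n S \<sigma> lam \<beta>) =
   sets (sample_space d n \<Otimes>\<^sub>M bit_space n)"
  unfolding sample_space_def bit_space_def by (intro sets_pair_measure_cong sets_PiM_cong) auto

lemma space_data_bits[simp]:
  "space (clean_law d n S \<sigma> lam \<beta>) =
   space (sample_space d n \<Otimes>\<^sub>M bit_space n)"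
  by (rule sets_eq_imp_space_eq) simp

lemma prob_space_data_bits:
  assumes "0 < \<sigma>"
  shows "prob_space (clean_law d n S \<sigma> lam \<beta>)"
  by (intro prob_space_pair prob_space_bernoulli_PiM prob_space_PiM prob_space_lin_model assms)

lemma adversaryD:
  assumes "adversary d n K" "xb \<in> space (sample_space d n \<Otimes>\<^sub>M bit_space n)"
  shows "prob_space (K xb)" "sets (K xb) = sets (sample_space d n)" "space (K xb) = space (sample_space d n)"
proof -
  have "K xb \<in> space (prob_algebra (sample_space d n))"
    by (rule measurable_space[OF assms(1)[unfolded adversary_def] assms(2)])
  then show "prob_space (K xb)" "sets (K xb) = sets (sample_space d n)" by (auto simp: space_prob_algebra)
  then show "space (K xb) = space (sample_space d n)" using sets_eq_imp_space_eq by blast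
qed

lemma contam_kernel_measurable:
  assumes "adversary d n K"
  shows "(\<lambda>xb. distr (K xb) (contam_space d n) (\<lambda>xt. (xb, xt))) \<in> sample_space d n \<Otimes>\<^sub>M bit_space n \<rightarrow>\<^sub>M prob_algebra (contam_space d n)"
  unfolding contam_space_def
proof (rule measurable_distr_prob_space2)
  show "K \<in> sample_space d n \<Otimes>\<^sub>M bit_space n \<rightarrow>\<^sub>M prob_algebra (sample_space d n)"
    using assms unfolding adversary_def .
qed measurable

lemma contam_prob_eq_bind:
  assumes \<sigma>: "0 < \<sigma>" and K: "adversary d n K"
  shows "contam_prob d n S \<sigma> lam \<beta> K =
    (clean_law d n S \<sigma> lam \<beta>) \<bind>
      (\<lambda>xb. distr (K xb) (contam_space d n) (\<lambda>xt. (xb, xt)))"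
  unfolding contam_prob_def
proof (rule bind_cong[OF refl])
  fix xb assume "xb \<in> space (clean_law d n S \<sigma> lam \<beta>)"
  then have xb: "xb \<in> space (sample_space d n \<Otimes>\<^sub>M bit_space n)" by simp
  note Kx = adversaryD[OF K xb]
  have "space (K xb) \<noteq> {}" using prob_space.not_empty[OF Kx(1)] .
  moreover have "(\<lambda>xt. (xb, xt)) \<in> K xb \<rightarrow>\<^sub>M contam_space d n"
    unfolding contam_space_def measurable_cong_sets[OF Kx(2) refl] using xb by (rule measurable_Pair1')
  ultimately show "K xb \<bind> (\<lambda>xt. return (contam_space d n) (xb, xt)) = distr (K xb) (contam_space d n) (\<lambda>xt. (xb, xt))"
    by (rule bind_return_distr')
qed

lemma data_bits_nonempty: "0 < (\<sigma> :: real) \<Longrightarrow> space (sample_space d n \<Otimes>\<^sub>M bit_space n) \<noteq> {}"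
  using prob_space.not_empty[OF prob_space_data_bits[of \<sigma> n d undefined undefined undefined]] by simp

lemma sets_contam_prob:
  assumes \<sigma>: "0 < \<sigma>" and K: "adversary d n K"
  shows "sets (contam_prob d n S \<sigma> lam \<beta> K) = sets (contam_space d n)"
  unfolding contam_prob_eq_bind[OF assms] using data_bits_nonempty[OF \<sigma>] by (intro sets_bind) auto

lemma prob_space_contam_prob:
  assumes \<sigma>: "0 < \<sigma>" and K: "adversary d n K"
  shows "prob_space (contam_prob d n S \<sigma> lam \<beta> K)"
  unfolding contam_prob_eq_bind[OF assms]
proof (rule prob_space.prob_space_bind[OF prob_space_data_bits[OF \<sigma>]])
  show "AE xb in clean_law d n S \<sigma> lam \<beta>.
      prob_space (distr (K xb) (contam_space d n) (\<lambda>xt. (xb, xt)))"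
  proof (rule AE_I2)
    fix xb assume "xb \<in> space (clean_law d n S \<sigma> lam \<beta>)"
    then have "distr (K xb) (contam_space d n) (\<lambda>xt. (xb, xt)) \<in> space (prob_algebra (contam_space d n))"
      by (intro measurable_space[OF contam_kernel_measurable[OF K]]) simp
    then show "prob_space (distr (K xb) (contam_space d n) (\<lambda>xt. (xb, xt)))" by (simp add: space_prob_algebra)
  qed
  show "(\<lambda>xb. distr (K xb) (contam_space d n) (\<lambda>xt. (xb, xt))) \<in>
     clean_law d n S \<sigma> lam \<beta> \<rightarrow>\<^sub>M subprob_algebra (contam_space d n)"
    unfolding measurable_cong_sets[OF sets_data_bits refl] by (rule measurable_prob_algebraD[OF contam_kernel_measurable[OF K]])
qed

lemma emeasure_contam_prob:
  assumes \<sigma>: "0 < \<sigma>" and K: "adversary d n K" and A: "A \<in> sets (contam_space d n)"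
  shows "emeasure (contam_prob d n S \<sigma> lam \<beta> K) A =
    (\<integral>\<^sup>+xb. emeasure (K xb) {xt \<in> space (sample_space d n). (xb, xt) \<in> A}
      \<partial>(clean_law d n S \<sigma> lam \<beta>))"
    (is "_ = (\<integral>\<^sup>+xb. _ \<partial>?\<mu>)")
proof -
  have "emeasure (contam_prob d n S \<sigma> lam \<beta> K) A = (\<integral>\<^sup>+xb. emeasure (distr (K xb) (contam_space d n) (\<lambda>xt. (xb, xt))) A \<partial>?\<mu>)"
    unfolding contam_prob_eq_bind[OF \<sigma> K]
  proof (rule emeasure_bind[OF _ _ A])
    show "space ?\<mu> \<noteq> {}" using data_bits_nonempty[OF \<sigma>] by simp
    show "(\<lambda>xb. distr (K xb) (contam_space d n) (\<lambda>xt. (xb, xt))) \<in> ?\<mu> \<rightarrow>\<^sub>M subprob_algebra (contam_space d n)"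
      unfolding measurable_cong_sets[OF sets_data_bits refl] by (rule measurable_prob_algebraD[OF contam_kernel_measurable[OF K]])
  qed
  also have "\<dots> = (\<integral>\<^sup>+xb. emeasure (K xb) {xt \<in> space (sample_space d n). (xb, xt) \<in> A} \<partial>?\<mu>)"
  proof (rule nn_integral_cong)
    fix xb assume "xb \<in> space ?\<mu>"
    then have xb: "xb \<in> space (sample_space d n \<Otimes>\<^sub>M bit_space n)" by simp
    note Kx = adversaryD[OF K xb]
    have "(\<lambda>xt. (xb, xt)) \<in> K xb \<rightarrow>\<^sub>M contam_space d n"
      unfolding contam_space_def measurable_cong_sets[OF Kx(2) refl] using xb by (rule measurable_Pair1')
    then show "emeasure (distr (K xb) (contam_space d n) (\<lambda>xt. (xb, xt))) A = emeasure (K xb) {xt \<in> space (sample_space d n). (xb, xt) \<in> A}"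
      using A Kx(3) by (subst emeasure_distr) (auto simp: vimage_def Int_def conj_commute)
  qed
  finally show ?thesis .
qed

lemma outer_prob_le:
  assumes "A \<in> sets M" "\<And>\<omega>. \<omega> \<in> space M \<Longrightarrow> E \<omega> \<Longrightarrow> \<omega> \<in> A"
  shows "outer_prob M E \<le> measure M A"
  unfolding outer_prob_def using assms
  by (intro cInf_lower bdd_belowI[of _ 0]) auto

text \<open>\<open>G\<close> is fixed before the outliers are drawn and excludes \<open>E\<close>
  for every choice of them. So \<open>E\<close> is covered by the measurable event that the clean
  data and bits miss \<open>G\<close>, whose probability is the same for every adversary;
  \<open>E\<close> itself need not be measurable.\<close>

lemma outer_prob_contam_le:
  assumes \<sigma>: "0 < \<sigma>" and K: "adversary d n K" and G: "G \<in> sets (sample_space d n \<Otimes>\<^sub>M bit_space n)"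
    and p: "measure (clean_law d n S \<sigma> lam \<beta>) G \<ge> 4/5"
    and E: "\<And>x b xt. (x, b) \<in> G \<Longrightarrow> \<not> E ((x, b), xt)"
  shows "outer_prob (contam_prob d n S \<sigma> lam \<beta> K) E \<le> 1/5"
proof -
  let ?\<mu> = "clean_law d n S \<sigma> lam \<beta>"
  interpret \<mu>: prob_space ?\<mu> by (rule prob_space_data_bits[OF \<sigma>])
  define A where "A = {\<omega> \<in> space (contam_space d n). fst \<omega> \<notin> G}"
  have "fst \<in> contam_space d n \<rightarrow>\<^sub>M sample_space d n \<Otimes>\<^sub>M bit_space n" unfolding contam_space_def by simp
  from measurable_sets[OF this G] have "{\<omega> \<in> space (contam_space d n). fst \<omega> \<in> G} \<in> sets (contam_space d n)"
    by (simp add: vimage_def Int_def conj_commute)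
  then have "space (contam_space d n) - {\<omega> \<in> space (contam_space d n). fst \<omega> \<in> G} \<in> sets (contam_space d n)" by (rule sets.compl_sets)
  moreover have "space (contam_space d n) - {\<omega> \<in> space (contam_space d n). fst \<omega> \<in> G} = A" by (auto simp: A_def)
  ultimately have A: "A \<in> sets (contam_space d n)" by simp
  have "emeasure (contam_prob d n S \<sigma> lam \<beta> K) A = (\<integral>\<^sup>+xb. emeasure (K xb) {xt \<in> space (sample_space d n). (xb, xt) \<in> A} \<partial>?\<mu>)"
    by (rule emeasure_contam_prob[OF \<sigma> K A])
  also have "\<dots> = (\<integral>\<^sup>+xb. indicator (space ?\<mu> - G) xb \<partial>?\<mu>)"
  proof (rule nn_integral_cong)
    fix xb assume xb': "xb \<in> space ?\<mu>"
    then have xb: "xb \<in> space (sample_space d n \<Otimes>\<^sub>M bit_space n)" by simp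
    note Kx = adversaryD[OF K xb]
    have "{xt \<in> space (sample_space d n). (xb, xt) \<in> A} = (if xb \<in> G then {} else space (K xb))"
      using xb Kx(3) by (auto simp: A_def contam_space_def space_pair_measure)
    then show "emeasure (K xb) {xt \<in> space (sample_space d n). (xb, xt) \<in> A} = indicator (space ?\<mu> - G) xb"
      using xb' prob_space.emeasure_space_1[OF Kx(1)] by auto
  qed
  also have "\<dots> = emeasure ?\<mu> (space ?\<mu> - G)" using G by (intro nn_integral_indicator) auto
  finally have "measure (contam_prob d n S \<sigma> lam \<beta> K) A = \<mu>.prob (space ?\<mu> - G)" by (simp add: measure_def)
  also have "\<dots> = 1 - \<mu>.prob G" using G by (intro \<mu>.prob_compl) simp
  also have "\<dots> \<le> 1/5" using p by simp
  finally have m: "measure (contam_prob d n S \<sigma> lam \<beta> K) A \<le> 1/5" .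
  have "outer_prob (contam_prob d n S \<sigma> lam \<beta> K) E \<le> measure (contam_prob d n S \<sigma> lam \<beta> K) A"
  proof (rule outer_prob_le)
    show "A \<in> sets (contam_prob d n S \<sigma> lam \<beta> K)" using A sets_contam_prob[OF \<sigma> K] by simp
    fix \<omega> assume w: "\<omega> \<in> space (contam_prob d n S \<sigma> lam \<beta> K)" "E \<omega>"
    obtain x b xt where "\<omega> = ((x, b), xt)" by (metis prod.exhaust)
    then have "fst \<omega> \<notin> G" using E w(2) by auto
    then show "\<omega> \<in> A" using w(1) sets_eq_imp_space_eq[OF sets_contam_prob[OF \<sigma> K]] by (simp add: A_def)
  qed
  then show ?thesis using m by simp
qed

text \<open>The bounds on \<open>r\<close> control the two perturbations: \<open>t \<le> r\<close>
  gives at most 20 r N corrupted points, and d / N \<le> r^2 gives a sampling error of at most 10080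
  r N. Their sum explains 10100 in \<theta>. The last bound is the condition s \<le> 1 for s =
  6000000 r. The sample \<open>z\<close> is any sample that agrees with \<open>x\<close> at
  uncorrupted indices, so the statement is uniform over adversaries.\<close>

lemma good_event:
  assumes d: "1 \<le> d" and S: "pos_def d S" and \<sigma>: "0 < \<sigma>"
    and lam: "\<forall>i<n. 0 \<le> lam i \<and> lam i \<le> 1" and N: "0 < Ncount n lam t"
    and r: "0 < r" "t \<le> r" "real d / real (Ncount n lam t) \<le> r\<^sup>2" "6000000 * r \<le> 1"
  defines "I \<equiv> {i. i < n \<and> lam i \<le> t}" and "\<theta> \<equiv> (1/2 - 10100 * r) * real (Ncount n lam t)"
  shows "\<exists>G \<in> sets (sample_space d n \<Otimes>\<^sub>M bit_space n).
    measure (clean_law d n S \<sigma> lam \<beta>) G \<ge> 4/5 \<and>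
    (\<forall>x b z. (x, b) \<in> G \<longrightarrow> (\<forall>i<n. \<not> b i \<longrightarrow> z i = x i) \<longrightarrow>
      (\<forall>v. \<theta> \<le> agree_count d I \<beta> v z) \<and>
      (\<exists>k. \<forall>v. \<theta> \<le> agree_count d I (qvec k) v z) \<and>
      (\<forall>\<eta>. (6000000 * r * \<sigma>)\<^sup>2 \<le> sqnormS d S (\<lambda>i. \<eta> i - \<beta> i) \<longrightarrow>
        (\<exists>v. (\<exists>j<d. v j \<noteq> 0) \<and> agree_count d I \<eta> v z < \<theta>)))"
proof -
  let ?PX = "PiM {..<n} (\<lambda>_. lin_model d S \<sigma> \<beta>)" and ?PB = "PiM {..<n} (\<lambda>i. measure_pmf (bernoulli_pmf (lam i)))"
  define s where "s = 6000000 * r"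
  have s: "0 < s" "s \<le> 1" using r by (auto simp: s_def)
  have NI: "Ncount n lam t = card I" by (simp add: Ncount_def I_def)
  have I: "I \<subseteq> {..<n}" "I \<noteq> {}" using N by (auto simp: I_def Ncount_def card_gt_0_iff)
  have fI: "finite I" by (rule finite_subset[OF I(1)]) simp
  let ?N = "real (card I)"
  have N0: "0 < ?N" using N NI by simp
  define \<Delta> where "\<Delta> = 10080 * sqrt (real d * ?N)"
  have "sqrt (real d * ?N) \<le> r * ?N"
  proof (rule real_le_lsqrt)
    show "real d * ?N \<le> (r * ?N)\<^sup>2"
      using r(3) N0 unfolding NI by (simp add: field_simps power2_eq_square)
  qed (use r N0 in auto)
  then have \<Delta>: "\<Delta> \<le> 10080 * r * ?N" by (simp add: \<Delta>_def)
  define \<kappa> where "\<kappa> = s\<^sup>2 * \<sigma> / 192"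
  have \<kappa>: "0 < \<kappa>" using s \<sigma> by (simp add: \<kappa>_def)
  from clean_sample_good[OF d S \<sigma> I s, of \<beta>] obtain GX where GX: "GX \<in> sets ?PX" "measure ?PX GX \<ge> 37/40"
    "\<forall>x\<in>GX. (\<forall>i<n. residual \<beta> d (x i) \<noteq> 0) \<and>
     (\<forall>k. real (card {i\<in>I. residual \<beta> d (x i) * dot d (qvec k) (x i) < 0}) \<le> ?N / 2 + \<Delta>) \<and>
     (\<forall>k. (s * \<sigma> / 2)\<^sup>2 \<le> sqnormS d S (qvec k) \<longrightarrow>
        real (card {i\<in>I. min 0 (residual \<beta> d (x i)) - \<kappa> < dot d (qvec k) (x i) \<and>
          dot d (qvec k) (x i) < max 0 (residual \<beta> d (x i)) + \<kappa>}) \<le> ?N * (1/2 - s/192) + 2 * \<Delta>)"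
    unfolding \<Delta>_def \<kappa>_def by blast
  define GB where "GB = {b \<in> space ?PB. real (card {i\<in>I. b i}) \<le> 20 * r * ?N}"
  have lr: "0 \<le> lam i \<and> lam i \<le> 1" "lam i \<le> r" if "i \<in> I" for i using that lam r(2) by (auto simp: I_def)
  have GB: "GB \<in> sets ?PB" "measure ?PB GB \<ge> 19/20"
    unfolding GB_def by (rule contamination_count[OF I lr(1) r(1) lr(2)]; assumption)+
  have PX: "prob_space ?PX" by (intro prob_space_PiM prob_space_lin_model \<sigma>)
  have PB: "prob_space ?PB" by (rule prob_space_bernoulli_PiM)
  show ?thesis
  proof (intro bexI[of _ "GX \<times> GB"] conjI allI impI)
    have "GX \<times> GB \<in> sets (?PX \<Otimes>\<^sub>M ?PB)" using GX GB by (intro pair_measureI)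
    then show "GX \<times> GB \<in> sets (sample_space d n \<Otimes>\<^sub>M bit_space n)" by simp
    \<comment> \<open>The budget: clean data and bits are independent, and the product of their
      probabilities is at least 703/800.\<close>
    have "4/5 \<le> (37/40) * (19/20 :: real)" by simp
    also have "\<dots> \<le> measure ?PX GX * measure ?PB GB" using GX GB by (intro mult_mono) auto
    also have "\<dots> = measure (?PX \<Otimes>\<^sub>M ?PB) (GX \<times> GB)" by (rule measure_pair_times[symmetric, OF PX PB GX(1) GB(1)])
    finally show "measure (?PX \<Otimes>\<^sub>M ?PB) (GX \<times> GB) \<ge> 4/5" .
    fix x b z assume xb: "(x, b) \<in> GX \<times> GB" and zz: "\<forall>i<n. \<not> b i \<longrightarrow> z i = x i"
    have z: "z i = x i" if "i \<in> I" "\<not> b i" for i using zz that I by auto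
    have x: "residual \<beta> d (x i) \<noteq> 0" if "i \<in> I" for i using GX(3) xb that I by auto
    have A1: "real (card {i\<in>I. residual \<beta> d (x i) * dot d (qvec k) (x i) < 0}) \<le> ?N / 2 + \<Delta>" for k
      using GX(3) xb by auto
    have A2: "real (card {i\<in>I. min 0 (residual \<beta> d (x i)) - \<kappa> < dot d (qvec k) (x i) \<and>
          dot d (qvec k) (x i) < max 0 (residual \<beta> d (x i)) + \<kappa>}) \<le> ?N * (1/2 - s/192) + 2 * \<Delta>"
      if "(s * \<sigma> / 2)\<^sup>2 \<le> sqnormS d S (qvec k)" for k
      using GX(3) xb that by blast
    have c: "real (card {i\<in>I. b i}) \<le> 20 * r * ?N" using xb by (auto simp: GB_def)
    have "\<theta> \<le> ?N - (?N / 2 + \<Delta>) - 20 * r * ?N" using \<Delta> by (simp add: \<theta>_def NI algebra_simps)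
    note lower = order.trans[OF this agree_count_near_lower[OF fI z A1 c]]
    show "\<theta> \<le> agree_count d I \<beta> v z" for v by (rule lower) (auto simp: residual_def)
    obtain k where k: "\<forall>i\<in>I. \<forall>r. (snd (x i) - dot d (qvec k) (x i)) * r < 0 \<longrightarrow> residual \<beta> d (x i) * r < 0"
      using rational_near[OF fI, where \<beta> = \<beta> and d = d and x = x] x by meson
    have "\<theta> \<le> agree_count d I (qvec k) v z" for v by (rule lower) (use k in auto)
    then show "\<exists>k. \<forall>v. \<theta> \<le> agree_count d I (qvec k) v z" by blast
    fix \<eta> assume "(6000000 * r * \<sigma>)\<^sup>2 \<le> sqnormS d S (\<lambda>i. \<eta> i - \<beta> i)"
    then have far: "(s * \<sigma>)\<^sup>2 \<le> sqnormS d S (\<lambda>i. \<eta> i - \<beta> i)" by (simp add: s_def)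
    obtain v where v: "\<exists>j<d. v j \<noteq> 0" "agree_count d I \<eta> v z \<le> (?N * (1/2 - s/192) + 2 * \<Delta>) + 20 * r * ?N"
      using agree_count_far_upper[OF fI z s(1) \<sigma> \<kappa> A2 c far] by blast
    have "(?N * (1/2 - s/192) + 2 * \<Delta>) + 20 * r * ?N \<le> ?N * (1/2 - s/192) + 2 * (10080 * r * ?N) + 20 * r * ?N"
      using \<Delta> by simp
    \<comment> \<open>The radius \<open>6000000 * r * \<sigma>\<close> is chosen so that \<open>6000000 / 192\<close> exceeds \<open>10100 + 2 * 10080 + 20\<close>.\<close>
    also have "\<dots> = \<theta> - 970 * (r * ?N)" by (simp add: \<theta>_def NI s_def algebra_simps)
    also have "\<dots> < \<theta>" using r(1) N0 by simp
    finally show "\<exists>v. (\<exists>j<d. v j \<noteq> 0) \<and> agree_count d I \<eta> v z < \<theta>" using v(1) le_less_trans[OF v(2)] by blast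
  qed
qed

lemma observed_clean: "\<forall>i<n. \<not> b i \<longrightarrow> observed n ((x, b), xt) i = x i"
  by (simp add: observed_def)

text \<open>On the good event \<beta> has depth at least 1/2 - 10100 r while every far vector has
  less, so no maximizer is far. Outer probability is used because \<open>est\<close> carries no
  measurability assumption.\<close>

lemma depth_maximizer_error:
  assumes d: "1 \<le> d" and S: "pos_def d S" and \<sigma>: "0 < \<sigma>"
    and lam: "\<forall>i<n. 0 \<le> lam i \<and> lam i \<le> 1" and N: "0 < Ncount n lam t"
    and r: "0 < r" "t \<le> r" "real d / real (Ncount n lam t) \<le> r\<^sup>2" "6000000 * r \<le> 1"
    and est: "\<And>z \<eta>. depth d n (thr_weights n lam t) \<eta> z \<le> depth d n (thr_weights n lam t) (est z) z"
    and K: "adversary d n K"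
  shows "outer_prob (contam_prob d n S \<sigma> lam \<beta> K)
    (\<lambda>\<omega>. (6000000 * r * \<sigma>)\<^sup>2 \<le> sqnormS d S (\<lambda>i. est (observed n \<omega>) i - \<beta> i)) \<le> 1/5"
proof -
  let ?I = "{i. i < n \<and> lam i \<le> t}" and ?\<theta> = "(1/2 - 10100 * r) * real (Ncount n lam t)"
  obtain G where G: "G \<in> sets (sample_space d n \<Otimes>\<^sub>M bit_space n)"
    "measure (clean_law d n S \<sigma> lam \<beta>) G \<ge> 4/5"
    and H: "\<forall>x b z. (x, b) \<in> G \<longrightarrow> (\<forall>i<n. \<not> b i \<longrightarrow> z i = x i) \<longrightarrow>
      (\<forall>v. ?\<theta> \<le> agree_count d ?I \<beta> v z) \<and>
      (\<exists>k. \<forall>v. ?\<theta> \<le> agree_count d ?I (qvec k) v z) \<and>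
      (\<forall>\<eta>. (6000000 * r * \<sigma>)\<^sup>2 \<le> sqnormS d S (\<lambda>i. \<eta> i - \<beta> i) \<longrightarrow>
        (\<exists>v. (\<exists>j<d. v j \<noteq> 0) \<and> agree_count d ?I \<eta> v z < ?\<theta>))"
    using good_event[OF d S \<sigma> lam N r, of \<beta>] by (elim bexE conjE)
  show ?thesis
  proof (rule outer_prob_contam_le[OF \<sigma> K G], rule notI)
    fix x b xt assume xb: "(x, b) \<in> G"
    define z where "z = observed n ((x, b), xt)"
    note Hz = H[THEN spec, THEN spec, THEN spec, THEN mp, THEN mp, OF xb observed_clean[of n b x xt, folded z_def]]
    assume "(6000000 * r * \<sigma>)\<^sup>2 \<le> sqnormS d S (\<lambda>i. est (observed n ((x, b), xt)) i - \<beta> i)"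
    then have "\<exists>v. (\<exists>j<d. v j \<noteq> 0) \<and> agree_count d ?I (est z) v z < ?\<theta>"
      by (intro Hz[THEN conjunct2, THEN conjunct2, rule_format]) (simp only: z_def)
    then obtain v where v: "\<exists>j<d. v j \<noteq> 0" "agree_count d ?I (est z) v z < ?\<theta>" by blast
    have "depth d n (thr_weights n lam t) (est z) z < 1/2 - 10100 * r" by (rule depth_less[OF N v])
    also have "\<dots> \<le> depth d n (thr_weights n lam t) \<beta> z"
      by (rule le_depth[OF N d Hz[THEN conjunct1, rule_format]])
    finally show False using est[of \<beta> z] by simp
  qed
qed

lemma measurable_agree_count[measurable]:
  assumes "I \<subseteq> {..<n}"
  shows "agree_count d I \<eta> v \<in> borel_measurable (sample_space d n)"
proof -
  have fI: "finite I" by (rule finite_subset[OF assms]) simp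
  have "(\<lambda>z. \<Sum>i\<in>I. of_bool (0 \<le> (snd (z i) - dot d \<eta> (z i)) * dot d v (z i)) :: real) \<in> borel_measurable (sample_space d n)"
  proof (rule borel_measurable_sum)
    fix i assume "i \<in> I"
    then have [measurable]: "(\<lambda>z. z i) \<in> sample_space d n \<rightarrow>\<^sub>M obs_space d"
      using assms unfolding sample_space_def by (intro measurable_component_singleton) auto
    have [measurable]: "Measurable.pred (obs_space d) (\<lambda>p. 0 \<le> (snd p - dot d \<eta> p) * dot d v p)" by measurable
    show "(\<lambda>z. of_bool (0 \<le> (snd (z i) - dot d \<eta> (z i)) * dot d v (z i)) :: real) \<in> borel_measurable (sample_space d n)"
      by measurable
  qed
  then show ?thesis unfolding agree_count_def[abs_def] card_eq_sum_of_bool[OF fI] .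
qed

text \<open>A depth maximizer need not be measurable; the first rational vector of large depth is.\<close>

lemma measurable_estimator_error:
  assumes d: "1 \<le> d" and S: "pos_def d S" and \<sigma>: "0 < \<sigma>"
    and lam: "\<forall>i<n. 0 \<le> lam i \<and> lam i \<le> 1" and N: "0 < Ncount n lam t"
    and r: "0 < r" "t \<le> r" "real d / real (Ncount n lam t) \<le> r\<^sup>2" "6000000 * r \<le> 1"
  shows "\<exists>M \<in> sample_space d n \<rightarrow>\<^sub>M Rd d. \<forall>\<beta> K. adversary d n K \<longrightarrow>
    outer_prob (contam_prob d n S \<sigma> lam \<beta> K)
      (\<lambda>\<omega>. (6000000 * r * \<sigma>)\<^sup>2 \<le> sqnormS d S (\<lambda>i. M (observed n \<omega>) i - \<beta> i)) \<le> 1/5"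
proof -
  define I where "I = {i. i < n \<and> lam i \<le> t}"
  define \<theta> where "\<theta> = (1/2 - 10100 * r) * real (Ncount n lam t)"
  have I: "I \<subseteq> {..<n}" by (auto simp: I_def)
  have fI: "finite I" by (rule finite_subset[OF I]) simp
  \<comment> \<open>The level \<theta> depends on \<open>r\<close> and on the number of retained
    points, not on \<beta>, so the search for a deep vector is an estimator. Testing only the
    countably many rational directions makes each test measurable.\<close>
  define deep where "deep k z \<longleftrightarrow> (\<forall>l. (\<exists>j<d. qvec l j \<noteq> 0) \<longrightarrow> \<theta> \<le> agree_count d I (qvec k) (qvec l) z)" for k z
  define M where "M z = (\<lambda>i\<in>{..<d}. qvec (LEAST k. deep k z) i)" for z
  have [measurable]: "Measurable.pred (sample_space d n) (deep k)" for k
    unfolding deep_def[abs_def] using measurable_agree_count[OF I] by measurable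
  have "(\<lambda>z. LEAST k. deep k z) \<in> sample_space d n \<rightarrow>\<^sub>M count_space UNIV" by measurable
  moreover have "(\<lambda>k. \<lambda>i\<in>{..<d}. qvec k i) \<in> count_space UNIV \<rightarrow>\<^sub>M Rd d" by (simp add: Rd_def space_PiM)
  ultimately have M: "M \<in> sample_space d n \<rightarrow>\<^sub>M Rd d" unfolding M_def[abs_def] by (rule measurable_compose)
  have "outer_prob (contam_prob d n S \<sigma> lam \<beta> K)
      (\<lambda>\<omega>. (6000000 * r * \<sigma>)\<^sup>2 \<le> sqnormS d S (\<lambda>i. M (observed n \<omega>) i - \<beta> i)) \<le> 1/5"
    if K: "adversary d n K" for \<beta> K
  proof -
    obtain G where G: "G \<in> sets (sample_space d n \<Otimes>\<^sub>M bit_space n)"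
      "measure (clean_law d n S \<sigma> lam \<beta>) G \<ge> 4/5"
      and H: "\<forall>x b z. (x, b) \<in> G \<longrightarrow> (\<forall>i<n. \<not> b i \<longrightarrow> z i = x i) \<longrightarrow>
        (\<forall>v. \<theta> \<le> agree_count d I \<beta> v z) \<and>
        (\<exists>k. \<forall>v. \<theta> \<le> agree_count d I (qvec k) v z) \<and>
        (\<forall>\<eta>. (6000000 * r * \<sigma>)\<^sup>2 \<le> sqnormS d S (\<lambda>i. \<eta> i - \<beta> i) \<longrightarrow>
          (\<exists>v. (\<exists>j<d. v j \<noteq> 0) \<and> agree_count d I \<eta> v z < \<theta>))"
      using good_event[OF d S \<sigma> lam N r, of \<beta>, folded I_def \<theta>_def] by (elim bexE conjE)
    show ?thesis
    proof (rule outer_prob_contam_le[OF \<sigma> K G], rule notI)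
      fix x b xt assume xb: "(x, b) \<in> G"
      define z where "z = observed n ((x, b), xt)"
      define q where "q = qvec (LEAST k. deep k z)"
      note Hz = H[THEN spec, THEN spec, THEN spec, THEN mp, THEN mp, OF xb observed_clean[of n b x xt, folded z_def]]
      \<comment> \<open>On the good event some candidate passes, so the \<open>LEAST\<close> in the
        estimator is meaningful there; elsewhere its value is unspecified.\<close>
      obtain k where "\<forall>v. \<theta> \<le> agree_count d I (qvec k) v z" using Hz[THEN conjunct2, THEN conjunct1] by (elim exE)
      then have "\<exists>k. deep k z" unfolding deep_def by blast
      then have "deep (LEAST k. deep k z) z" by (rule LeastI_ex)
      then have dq: "\<And>l. (\<exists>j<d. qvec l j \<noteq> 0) \<Longrightarrow> \<theta> \<le> agree_count d I q (qvec l) z"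
        unfolding deep_def q_def by blast
      assume "(6000000 * r * \<sigma>)\<^sup>2 \<le> sqnormS d S (\<lambda>i. M (observed n ((x, b), xt)) i - \<beta> i)"
      also have "sqnormS d S (\<lambda>i. M (observed n ((x, b), xt)) i - \<beta> i) = sqnormS d S (\<lambda>i. q i - \<beta> i)"
        unfolding sqnormS_def M_def q_def z_def by (intro sum.cong refl) simp
      finally have "\<exists>v. (\<exists>j<d. v j \<noteq> 0) \<and> agree_count d I q v z < \<theta>"
        by (rule Hz[THEN conjunct2, THEN conjunct2, rule_format])
      then obtain v where v: "\<exists>j<d. v j \<noteq> 0" "agree_count d I q v z < \<theta>" by blast
      obtain l where "\<exists>j<d. qvec l j \<noteq> 0" "agree_count d I q (qvec l) z \<le> agree_count d I q v z"
        using agree_count_rational_direction[OF fI v(1)] by blast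
      then show False using dq[of l] v(2) by simp
    qed
  qed
  then show ?thesis using M by blast
qed

section \<open>Likelihoods and two-point testing\<close>

text \<open>A common dominating measure. The covariate has the same law for every \<beta>, so the
  density of the model is the conditional density of the response.\<close>

definition base :: "nat \<Rightarrow> (nat \<Rightarrow> nat \<Rightarrow> real) \<Rightarrow> obs measure" where
  "base d S = gauss_vec d S \<Otimes>\<^sub>M lborel"

lemma sets_base[simp, measurable_cong]: "sets (base d S) = sets (obs_space d)"
  unfolding base_def obs_space_def by (intro sets_pair_measure_cong) auto

lemma space_base[simp]: "space (base d S) = space (obs_space d)"
  by (rule sets_eq_imp_space_eq) simp

lemma sigma_finite_base: "sigma_finite_measure (base d S)"
proof -
  interpret pair_sigma_finite "gauss_vec d S" lborel
    by (intro pair_sigma_finite.intro prob_space_imp_sigma_finite prob_space_gauss_vec lborel.sigma_finite_measure_axioms)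
  show ?thesis unfolding base_def by (rule sigma_finite_measure_axioms)
qed

lemma nn_integral_base:
  assumes "g \<in> borel_measurable (obs_space d)"
  shows "(\<integral>\<^sup>+p. g p \<partial>base d S) = (\<integral>\<^sup>+w. \<integral>\<^sup>+y. g (w, y) \<partial>lborel \<partial>gauss_vec d S)"
proof -
  have "g \<in> borel_measurable (gauss_vec d S \<Otimes>\<^sub>M lborel)"
    using assms measurable_cong_sets[OF sets_base[of d S] refl] unfolding base_def by blast
  then show ?thesis unfolding base_def by (rule lborel.nn_integral_fst[symmetric])
qed

lemma nn_integral_shift:
  fixes g :: "real \<Rightarrow> ennreal"
  assumes "g \<in> borel_measurable borel" shows "(\<integral>\<^sup>+y. g (y - c) \<partial>lborel) = (\<integral>\<^sup>+y. g y \<partial>lborel)"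
proof -
  have "(\<lambda>y. g (y - c)) \<in> borel_measurable borel" using assms by measurable
  from nn_integral_real_affine[OF this, of 1 c] show ?thesis by simp
qed

lemma normal_density_shift: "normal_density \<mu> \<sigma> y = normal_density 0 \<sigma> (y - \<mu>)"
  by (simp add: normal_density_def)

lemma measurable_normal_density_dot[measurable]:
  "(\<lambda>p. normal_density (dot d u p) \<sigma> (snd p)) \<in> borel_measurable (obs_space d)"
  unfolding normal_density_shift[of "dot d u _"] by measurable

lemma lin_model_density:
  assumes \<sigma>: "0 < \<sigma>"
  shows "lin_model d S \<sigma> u = density (base d S) (\<lambda>p. ennreal (normal_density (dot d u p) \<sigma> (snd p)))"
proof (rule measure_eqI)
  show "sets (lin_model d S \<sigma> u) = sets (density (base d S) (\<lambda>p. ennreal (normal_density (dot d u p) \<sigma> (snd p))))" by simp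
  fix A assume "A \<in> sets (lin_model d S \<sigma> u)"
  then have A[measurable]: "A \<in> sets (obs_space d)" by simp
  let ?f = "\<lambda>(w, e). (w, (\<Sum>i<d. u i * w i) + e) :: obs"
  interpret N: prob_space "centered_normal \<sigma>" by (rule prob_space_centered_normal[OF \<sigma>])
  have "emeasure (lin_model d S \<sigma> u) A = (\<integral>\<^sup>+p. indicator A (?f p) \<partial>(gauss_vec d S \<Otimes>\<^sub>M centered_normal \<sigma>))"
    unfolding lin_model_eq using A by (simp add: nn_integral_distr flip: nn_integral_indicator)
  also have "\<dots> = (\<integral>\<^sup>+w. \<integral>\<^sup>+e. indicator A (?f (w, e)) \<partial>centered_normal \<sigma> \<partial>gauss_vec d S)"
  proof (rule N.nn_integral_fst[symmetric])
    show "(\<lambda>p. indicator A (?f p) :: ennreal) \<in> borel_measurable (gauss_vec d S \<Otimes>\<^sub>M centered_normal \<sigma>)"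
      by (rule measurable_compose[OF measurable_lin_model_map]) simp
  qed
  also have "\<dots> = (\<integral>\<^sup>+w. \<integral>\<^sup>+y. ennreal (normal_density (\<Sum>i<d. u i * w i) \<sigma> y) * indicator A (w, y) \<partial>lborel \<partial>gauss_vec d S)"
  proof (rule nn_integral_cong)
    fix w assume w: "w \<in> space (gauss_vec d S)"
    define c where "c = (\<Sum>i<d. u i * w i)"
    have Aw: "(\<lambda>y. indicator A (w, y) :: ennreal) \<in> borel_measurable borel"
    proof (rule measurable_compose[of "\<lambda>y. (w, y)" borel "obs_space d"])
      show "(\<lambda>y. (w, y)) \<in> borel \<rightarrow>\<^sub>M obs_space d" unfolding obs_space_def using w by (intro measurable_Pair1') simp
    qed simp
    have "(\<integral>\<^sup>+e. indicator A (?f (w, e)) \<partial>centered_normal \<sigma>) = (\<integral>\<^sup>+e. ennreal (normal_density 0 \<sigma> e) * indicator A (w, c + e) \<partial>lborel)"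
      unfolding centered_normal_def using measurable_compose[OF _ Aw, of "\<lambda>e. c + e" borel]
      by (subst nn_integral_density) (auto simp: c_def)
    also have "\<dots> = (\<integral>\<^sup>+y. ennreal (normal_density 0 \<sigma> (y - c)) * indicator A (w, c + (y - c)) \<partial>lborel)"
      using measurable_compose[OF _ Aw, of "\<lambda>e. c + e" borel]
      by (intro nn_integral_shift[symmetric] borel_measurable_times_ennreal) auto
    finally show "(\<integral>\<^sup>+e. indicator A (?f (w, e)) \<partial>centered_normal \<sigma>) =
        (\<integral>\<^sup>+y. ennreal (normal_density (\<Sum>i<d. u i * w i) \<sigma> y) * indicator A (w, y) \<partial>lborel)"
      unfolding normal_density_shift[of "\<Sum>i<d. u i * w i"] c_def by simp
  qed
  also have "\<dots> = (\<integral>\<^sup>+p. ennreal (normal_density (dot d u p) \<sigma> (snd p)) * indicator A p \<partial>base d S)"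
  proof (subst nn_integral_base)
    show "(\<lambda>p. ennreal (normal_density (dot d u p) \<sigma> (snd p)) * indicator A p) \<in> borel_measurable (obs_space d)"
      by measurable
  qed simp
  also have "\<dots> = emeasure (density (base d S) (\<lambda>p. ennreal (normal_density (dot d u p) \<sigma> (snd p)))) A"
    by (rule emeasure_density[symmetric]) (auto simp: measurable_cong_sets[OF sets_base refl])
  finally show "emeasure (lin_model d S \<sigma> u) A = emeasure (density (base d S) (\<lambda>p. ennreal (normal_density (dot d u p) \<sigma> (snd p)))) A" .
qed

section \<open>The envelope of shifted normal densities\<close>

lemma normal_density_antimono:
  assumes "0 < \<sigma>" "\<bar>x\<bar> \<le> \<bar>y\<bar>" shows "normal_density 0 \<sigma> y \<le> normal_density 0 \<sigma> x"
proof -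
  have "x\<^sup>2 \<le> y\<^sup>2" using assms(2) by (simp add: abs_le_square_iff)
  then have "- y\<^sup>2 / (2 * \<sigma>\<^sup>2) \<le> - x\<^sup>2 / (2 * \<sigma>\<^sup>2)" by (intro divide_right_mono) auto
  then show ?thesis unfolding normal_density_def by (intro mult_left_mono) auto
qed

text \<open>The pointwise supremum of all normal densities with mean in \<open>[-M, M]\<close> is a normal density
  cut at its top and pulled apart by \<open>2 M\<close>.\<close>

lemma flat_top_mass:
  assumes \<sigma>: "0 < \<sigma>" and M: "0 \<le> M"
  shows "(\<integral>\<^sup>+y. ennreal (normal_density 0 \<sigma> (max (\<bar>y\<bar> - M) 0)) \<partial>lborel) \<le> ennreal (1 + M / \<sigma>)"
proof -
  interpret N: prob_space "centered_normal \<sigma>" by (rule prob_space_centered_normal[OF \<sigma>])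
  let ?\<phi> = "\<lambda>y. ennreal (normal_density 0 \<sigma> y)"
  let ?h1 = "\<lambda>y. ennreal (1 / (2 * \<sigma>)) * indicator {-M..M} y"
  let ?h2 = "\<lambda>y. ?\<phi> (y - M) * indicator {0<..} (y - M)"
  let ?h3 = "\<lambda>y. ?\<phi> (y - (-M)) * indicator {..<0} (y - (-M))"
  have "(\<integral>\<^sup>+y. ?\<phi> (max (\<bar>y\<bar> - M) 0) \<partial>lborel) \<le> (\<integral>\<^sup>+y. ?h1 y + (?h2 y + ?h3 y) \<partial>lborel)"
  proof (rule nn_integral_mono)
    fix y
    consider "\<bar>y\<bar> \<le> M" | "M < y" | "y < -M" by linarith
    then show "?\<phi> (max (\<bar>y\<bar> - M) 0) \<le> ?h1 y + (?h2 y + ?h3 y)"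
    proof cases
      case 1
      then have "?\<phi> (max (\<bar>y\<bar> - M) 0) \<le> ?h1 y"
        using normal_density_bounds(1)[OF \<sigma>] by (auto simp: abs_le_iff intro!: ennreal_leI)
      then show ?thesis by (rule order.trans) simp
    next
      case 2
      then have "?\<phi> (max (\<bar>y\<bar> - M) 0) \<le> ?h2 y" using M by simp
      also have "\<dots> \<le> ?h2 y + ?h3 y" by simp
      finally show ?thesis by (rule order.trans) simp
    next
      case 3
      have "normal_density 0 \<sigma> (- y - M) = normal_density 0 \<sigma> (y - (-M))"
        by (simp add: normal_density_def power2_eq_square algebra_simps)
      moreover have "max (\<bar>y\<bar> - M) 0 = - y - M" using 3 M by simp
      ultimately have "?\<phi> (max (\<bar>y\<bar> - M) 0) \<le> ?h3 y" using 3 by simp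
      also have "\<dots> \<le> ?h2 y + ?h3 y" by simp
      finally show ?thesis by (rule order.trans) simp
    qed
  qed
  also have "\<dots> = (\<integral>\<^sup>+y. ?h1 y \<partial>lborel) + ((\<integral>\<^sup>+y. ?h2 y \<partial>lborel) + (\<integral>\<^sup>+y. ?h3 y \<partial>lborel))"
    by (simp add: nn_integral_add)
  also have "(\<integral>\<^sup>+y. ?h1 y \<partial>lborel) = ennreal (1 / (2 * \<sigma>)) * ennreal (2 * M)"
    using M by (subst nn_integral_cmult_indicator) auto
  also have "\<dots> = ennreal (M / \<sigma>)" using M \<sigma> by (simp add: ennreal_mult'[symmetric])
  also have "(\<integral>\<^sup>+y. ?h2 y \<partial>lborel) = emeasure (centered_normal \<sigma>) {0<..}"
    unfolding centered_normal_def by (subst emeasure_density) (auto intro!: nn_integral_shift[where g = "\<lambda>y. ?\<phi> y * indicator {0<..} y"])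
  also have "(\<integral>\<^sup>+y. ?h3 y \<partial>lborel) = emeasure (centered_normal \<sigma>) {..<0}"
    unfolding centered_normal_def by (subst emeasure_density) (auto intro!: nn_integral_shift[where g = "\<lambda>y. ?\<phi> y * indicator {..<0} y", of "-M", simplified])
  also have "emeasure (centered_normal \<sigma>) {0<..} + emeasure (centered_normal \<sigma>) {..<0} = emeasure (centered_normal \<sigma>) ({0<..} \<union> {..<0})"
    by (rule plus_emeasure) auto
  also have "\<dots> \<le> 1" by (rule N.emeasure_le_1)
  also have "ennreal (M / \<sigma>) + 1 = ennreal (1 + M / \<sigma>)"
    using M \<sigma> ennreal_plus[of "M / \<sigma>" 1] by (simp add: add.commute)
  finally show ?thesis by (simp add: add_left_mono)
qed

text \<open>The absolute moment is sqrt (2 / pi); it controls the mass of the envelope in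
  \<open>flat_mass\<close>. The second moment enters the affinity of neighbouring vertices in
  \<open>dens_affinity\<close>.\<close>

lemma gauss_vec_unit_moments:
  assumes S: "pos_def d S" and u: "sqnormS d S u = 1"
  shows "(\<integral>\<^sup>+w. ennreal \<bar>\<Sum>i<d. u i * w i\<bar> \<partial>gauss_vec d S) \<le> 1"
    "(\<integral>\<^sup>+w. ennreal ((\<Sum>i<d. u i * w i)\<^sup>2) \<partial>gauss_vec d S) = 1"
proof -
  have D: "distr (gauss_vec d S) borel (\<lambda>w. \<Sum>i<d. u i * w i) = centered_normal 1" using gauss_vec_dot[OF S, of u] u by simp
  have tr: "(\<integral>\<^sup>+w. g (\<Sum>i<d. u i * w i) \<partial>gauss_vec d S) = (\<integral>\<^sup>+x. ennreal (std_normal_density x) * g x \<partial>lborel)"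
    if "g \<in> borel_measurable borel" for g :: "real \<Rightarrow> ennreal"
  proof -
    have "(\<integral>\<^sup>+w. g (\<Sum>i<d. u i * w i) \<partial>gauss_vec d S) = (\<integral>\<^sup>+x. g x \<partial>centered_normal 1)"
      unfolding D[symmetric] using that by (subst nn_integral_distr) auto
    also have "\<dots> = (\<integral>\<^sup>+x. ennreal (std_normal_density x) * g x \<partial>lborel)"
      unfolding centered_normal_def using that by (subst nn_integral_density) auto
    finally show ?thesis .
  qed
  have "(\<integral>\<^sup>+w. ennreal \<bar>\<Sum>i<d. u i * w i\<bar> \<partial>gauss_vec d S) = (\<integral>\<^sup>+x. ennreal (std_normal_density x * \<bar>x\<bar>^1) \<partial>lborel)"
    by (subst tr) (auto simp: ennreal_mult')
  also have "\<dots> = ennreal (\<integral>x. std_normal_density x * \<bar>x\<bar>^1 \<partial>lborel)"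
    by (intro nn_integral_eq_integral integrable_std_normal_moment_abs) auto
  also have "(\<integral>x. std_normal_density x * \<bar>x\<bar>^1 \<partial>lborel) = sqrt (2 / pi)"
    using integral_std_normal_moment_abs_odd[of 0] by simp
  also have "ennreal (sqrt (2 / pi)) \<le> 1" using pi_gt3 by (simp add: real_sqrt_le_1_iff)
  finally show "(\<integral>\<^sup>+w. ennreal \<bar>\<Sum>i<d. u i * w i\<bar> \<partial>gauss_vec d S) \<le> 1" .
  have "(\<integral>\<^sup>+w. ennreal ((\<Sum>i<d. u i * w i)\<^sup>2) \<partial>gauss_vec d S) = (\<integral>\<^sup>+x. ennreal (std_normal_density x * x^(2*1)) \<partial>lborel)"
    by (subst tr) (auto simp: ennreal_mult')
  also have "\<dots> = ennreal (\<integral>x. std_normal_density x * x^(2*1) \<partial>lborel)"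
    by (intro nn_integral_eq_integral integrable_std_normal_moment) auto
  also have "(\<integral>x. std_normal_density x * x^(2*1) \<partial>lborel) = 1"
    using integral_std_normal_moment_even[of 1] by (simp add: fact_numeral)
  finally show "(\<integral>\<^sup>+w. ennreal ((\<Sum>i<d. u i * w i)\<^sup>2) \<partial>gauss_vec d S) = 1" by simp
qed

text \<open>Completing the square: the geometric mean of the two densities is the normal density at
  the midpoint of the means, times the Hellinger affinity of the pair.\<close>

lemma sqrt_normal_density_mult:
  assumes "0 < \<sigma>"
  shows "sqrt (normal_density m \<sigma> y * normal_density m' \<sigma> y) =
    normal_density ((m + m') / 2) \<sigma> y * exp (- (m - m')\<^sup>2 / (8 * \<sigma>\<^sup>2))"
proof -
  let ?c = "1 / sqrt (2 * pi * \<sigma>\<^sup>2)"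
  have "(- (y - m)\<^sup>2 / (2 * \<sigma>\<^sup>2)) + (- (y - m')\<^sup>2 / (2 * \<sigma>\<^sup>2)) = 2 * (- (y - (m + m') / 2)\<^sup>2 / (2 * \<sigma>\<^sup>2) + - (m - m')\<^sup>2 / (8 * \<sigma>\<^sup>2))"
    using assms by (simp add: field_simps power2_eq_square)
  then have "exp (- (y - m)\<^sup>2 / (2 * \<sigma>\<^sup>2)) * exp (- (y - m')\<^sup>2 / (2 * \<sigma>\<^sup>2)) =
     (exp (- (y - (m + m') / 2)\<^sup>2 / (2 * \<sigma>\<^sup>2)) * exp (- (m - m')\<^sup>2 / (8 * \<sigma>\<^sup>2)))\<^sup>2"
    by (simp only: exp_add[symmetric] exp_double[symmetric])
  then have "normal_density m \<sigma> y * normal_density m' \<sigma> y =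
     (normal_density ((m + m') / 2) \<sigma> y * exp (- (m - m')\<^sup>2 / (8 * \<sigma>\<^sup>2)))\<^sup>2"
    unfolding normal_density_def power_mult_distrib by (simp add: power2_eq_square)
  then show ?thesis by (simp add: real_sqrt_abs)
qed

lemma PiM_density:
  assumes I: "finite I" and \<nu>: "sigma_finite_measure \<nu>"
    and f: "\<And>i. f i \<in> borel_measurable \<nu>" and p: "\<And>i. prob_space (density \<nu> (f i))"
  shows "PiM I (\<lambda>i. density \<nu> (f i)) = density (PiM I (\<lambda>_. \<nu>)) (\<lambda>x. \<Prod>i\<in>I. f i (x i))"
proof -
  interpret D: product_prob_space "\<lambda>i. density \<nu> (f i)" by (rule product_prob_spaceI[OF p])
  interpret N: product_sigma_finite "\<lambda>_. \<nu>" by (rule product_sigma_finite.intro[OF \<nu>])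
  have m: "(\<lambda>x. \<Prod>i\<in>I. f i (x i)) \<in> borel_measurable (PiM I (\<lambda>_. \<nu>))"
    by (intro borel_measurable_prod_ennreal measurable_compose[OF _ f] measurable_component_singleton)
  show ?thesis
  proof (rule D.PiM_eqI[OF I, symmetric])
    show "sets (density (PiM I (\<lambda>_. \<nu>)) (\<lambda>x. \<Prod>i\<in>I. f i (x i))) = sets (PiM I (\<lambda>i. density \<nu> (f i)))"
      by (simp cong: sets_PiM_cong)
    fix A assume "\<And>i. i \<in> I \<Longrightarrow> A i \<in> sets (density \<nu> (f i))"
    then have A: "\<And>i. i \<in> I \<Longrightarrow> A i \<in> sets \<nu>" by simp
    have "emeasure (density (PiM I (\<lambda>_. \<nu>)) (\<lambda>x. \<Prod>i\<in>I. f i (x i))) (Pi\<^sub>E I A) =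
      (\<integral>\<^sup>+x. (\<Prod>i\<in>I. f i (x i)) * indicator (Pi\<^sub>E I A) x \<partial>PiM I (\<lambda>_. \<nu>))"
      using I A by (intro emeasure_density m sets_PiM_I_finite) auto
    also have "\<dots> = (\<integral>\<^sup>+x. (\<Prod>i\<in>I. f i (x i) * indicator (A i) (x i)) \<partial>PiM I (\<lambda>_. \<nu>))"
    proof (rule nn_integral_cong)
      fix x assume x: "x \<in> space (PiM I (\<lambda>_. \<nu>))"
      have "indicator (Pi\<^sub>E I A) x = (\<Prod>i\<in>I. indicator (A i) (x i) :: ennreal)"
      proof (cases "\<forall>i\<in>I. x i \<in> A i")
        case True
        then have "x \<in> Pi\<^sub>E I A" using x by (auto simp: space_PiM PiE_iff)
        then show ?thesis using True by simp
      next
        case False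
        then obtain i where i: "i \<in> I" "x i \<notin> A i" by auto
        then have "x \<notin> Pi\<^sub>E I A" using PiE_mem by metis
        moreover have "(\<Prod>i\<in>I. indicator (A i) (x i) :: ennreal) = 0" 
          by (rule prod_zero[OF I bexI[OF _ i(1)]]) (use i(2) in \<open>rule indicator_simps\<close>)
        ultimately show ?thesis by (simp only: indicator_simps not_False_eq_True)
      qed
      then show "(\<Prod>i\<in>I. f i (x i)) * indicator (Pi\<^sub>E I A) x = (\<Prod>i\<in>I. f i (x i) * indicator (A i) (x i))"
        by (simp only: prod.distrib)
    qed
    also have "\<dots> = (\<Prod>i\<in>I. \<integral>\<^sup>+y. f i y * indicator (A i) y \<partial>\<nu>)"
      using A f by (intro N.product_nn_integral_prod[OF I] borel_measurable_times_ennreal) auto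
    also have "\<dots> = (\<Prod>i\<in>I. emeasure (density \<nu> (f i)) (A i))"
      using A f by (intro prod.cong refl) (simp add: emeasure_density)
    finally show "emeasure (density (PiM I (\<lambda>_. \<nu>)) (\<lambda>x. \<Prod>i\<in>I. f i (x i))) (Pi\<^sub>E I A) =
      (\<Prod>i\<in>I. emeasure (density \<nu> (f i)) (A i))" .
  qed
qed

lemma sqrt_mult_le:
  assumes "0 \<le> x" "0 \<le> (y::real)" shows "sqrt (x * y) \<le> x + y / 4"
proof -
  have "0 \<le> (sqrt x - sqrt y / 2)\<^sup>2" by simp
  also have "\<dots> = x + y / 4 - sqrt (x * y)" using assms by (simp add: power2_diff real_sqrt_mult power_divide)
  finally show ?thesis by simp
qed

text \<open>Le Cam's two-point bound, with \<open>sqrt (x * y) \<le> x + y / 4\<close> in place of the Cauchy-Schwarz inequality.\<close>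

lemma two_point_testing:
  fixes f g :: "'a \<Rightarrow> real"
  assumes f: "f \<in> borel_measurable N" "\<And>x. 0 \<le> f x" and g: "g \<in> borel_measurable N" "\<And>x. 0 \<le> g x"
    and P: "prob_space (density N f)" and Q: "prob_space (density N g)"
    and aff: "ennreal c \<le> (\<integral>\<^sup>+x. ennreal (sqrt (f x * g x)) \<partial>N)" and E: "E \<in> sets N"
  shows "(c - 1/2) * (4/3) \<le> measure (density N f) E + measure (density N g) (space N - E)"
proof -
  interpret P: prob_space "density N f" by (rule P)
  interpret Q: prob_space "density N g" by (rule Q)
  let ?P = "density N f" and ?Q = "density N g"
  let ?E' = "space N - E"
  have E': "?E' \<in> sets N" using E by auto
  have i4: "(\<integral>\<^sup>+x. ennreal (h x / 4) * indicator A x \<partial>N) = emeasure (density N h) A / 4"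
    if "h \<in> borel_measurable N" "\<And>x. 0 \<le> h x" "A \<in> sets N" for h :: "'a \<Rightarrow> real" and A
  proof -
    have "(\<integral>\<^sup>+x. ennreal (h x / 4) * indicator A x \<partial>N) = (\<integral>\<^sup>+x. (ennreal (h x) * indicator A x) / 4 \<partial>N)"
      using that by (intro nn_integral_cong) (auto simp: ennreal_divide_numeral[symmetric] split: split_indicator)
    also have "\<dots> = (\<integral>\<^sup>+x. ennreal (h x) * indicator A x \<partial>N) / 4" using that by (intro nn_integral_divide) auto
    finally show ?thesis using that by (simp add: emeasure_density)
  qed
  have "(\<integral>\<^sup>+x. ennreal (sqrt (f x * g x)) \<partial>N) \<le>
     (\<integral>\<^sup>+x. (ennreal (f x) * indicator E x + ennreal (g x / 4) * indicator E x) +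
       (ennreal (g x) * indicator ?E' x + ennreal (f x / 4) * indicator ?E' x) \<partial>N)"
  proof (rule nn_integral_mono)
    fix x assume x: "x \<in> space N"
    have "sqrt (f x * g x) \<le> f x + g x / 4" "sqrt (f x * g x) \<le> g x + f x / 4"
      using sqrt_mult_le[of "f x" "g x"] sqrt_mult_le[of "g x" "f x"] f(2) g(2) by (auto simp: mult.commute)
    then have "ennreal (sqrt (f x * g x)) \<le> ennreal (f x) + ennreal (g x / 4)"
       "ennreal (sqrt (f x * g x)) \<le> ennreal (g x) + ennreal (f x / 4)"
      using f(2) g(2) by (auto simp flip: ennreal_plus intro!: ennreal_leI)
    then show "ennreal (sqrt (f x * g x)) \<le> (ennreal (f x) * indicator E x + ennreal (g x / 4) * indicator E x) +
       (ennreal (g x) * indicator ?E' x + ennreal (f x / 4) * indicator ?E' x)"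
      using x by (cases "x \<in> E") auto
  qed
  also have "\<dots> = (emeasure ?P E + emeasure ?Q E / 4) + (emeasure ?Q ?E' + emeasure ?P ?E' / 4)"
    using f g E E' i4[OF f E'] i4[OF g E] by (simp add: nn_integral_add emeasure_density)
  also have "\<dots> = ennreal ((P.prob E + Q.prob E / 4) + (Q.prob ?E' + P.prob ?E' / 4))"
    by (simp add: P.emeasure_eq_measure Q.emeasure_eq_measure ennreal_divide_numeral flip: ennreal_plus)
  finally have "ennreal c \<le> ennreal ((P.prob E + Q.prob E / 4) + (Q.prob ?E' + P.prob ?E' / 4))"
    using aff by simp
  then have "c \<le> (P.prob E + Q.prob E / 4) + (Q.prob ?E' + P.prob ?E' / 4)" by (subst (asm) ennreal_le_iff) auto
  moreover have Ec: "P.prob ?E' = 1 - P.prob E" "Q.prob ?E' = 1 - Q.prob E"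
    using P.prob_compl[of E] Q.prob_compl[of E] E by auto
  ultimately have le: "c \<le> (P.prob E + Q.prob E / 4) + ((1 - Q.prob E) + (1 - P.prob E) / 4)" by (simp only:)
  \<comment> \<open>The right-hand side of the premise equals 1/2 + (3/4) (p + (1 - q)), and p + (1
    - q) is the sum of the two testing errors.\<close>
  have arith: "c \<le> (p + q / 4) + ((1 - q) + (1 - p) / 4) \<Longrightarrow> (c - 1/2) * (4/3) \<le> p + (1 - q)" for p q :: real
    by (simp add: field_simps)
  show ?thesis unfolding Ec(2) by (rule arith[OF le])
qed

section \<open>A masked hypercube of alternatives\<close>

lemma emeasure_density_base_space:
  assumes "g \<in> borel_measurable (obs_space d)"
  shows "emeasure (density (base d S) g) (space (obs_space d)) = (\<integral>\<^sup>+p. ennreal (g p) \<partial>base d S)"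
proof -
  have "(\<lambda>p. ennreal (g p)) \<in> borel_measurable (base d S)" using assms by (simp add: measurable_cong_sets[OF sets_base refl])
  moreover have "space (obs_space d) \<in> sets (base d S)" by simp
  ultimately have "emeasure (density (base d S) g) (space (obs_space d)) =
      (\<integral>\<^sup>+p. ennreal (g p) * indicator (space (obs_space d)) p \<partial>base d S)" by (rule emeasure_density)
  also have "\<dots> = (\<integral>\<^sup>+p. ennreal (g p) \<partial>base d S)" by (intro nn_integral_cong) simp
  finally show ?thesis .
qed

text \<open>Whitening maps the vectors \<open>f j\<close> to unit vectors, so they are orthonormal
  for the covariance, and the k coordinates of the hypercube can be perturbed and tested one at a
  time. Observations with \<open>lam i\<close> above \<open>t\<close> are the ones that will be
  masked.\<close>

locale hypercube_design =
  fixes d n k :: nat and S :: "nat \<Rightarrow> nat \<Rightarrow> real" and \<sigma> t :: real and lam :: "nat \<Rightarrow> real" and f :: "nat \<Rightarrow> nat \<Rightarrow> real"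
  assumes S: "pos_def d S" and \<sigma>: "0 < \<sigma>" and k: "1 \<le> k" "k \<le> d" and t: "0 < t" "t \<le> 1"
    and lam: "\<forall>i<n. 0 \<le> lam i \<and> lam i \<le> 1"
    and f: "\<And>j l. j < k \<Longrightarrow> l < d \<Longrightarrow> (\<Sum>i<d. f j i * sqrt_cov d S i l) = (if l = j then 1 else 0)"
begin

text \<open>Half the side of the hypercube, in units of \<sigma>. The choice k b = t makes the
  excess mass of \<open>flat\<close> at most t.\<close>

definition b :: real where "b = t / real k"
definition a :: real where "a = \<sigma> * b"
definition \<beta> :: "nat set \<Rightarrow> nat \<Rightarrow> real" where "\<beta> T i = (\<Sum>j<k. (if j \<in> T then a else - a) * f j i)"
definition dens :: "nat set \<Rightarrow> obs \<Rightarrow> real" where "dens T p = normal_density (dot d (\<beta> T) p) \<sigma> (snd p)"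
definition width :: "obs \<Rightarrow> real" where "width p = a * (\<Sum>j<k. \<bar>dot d (f j) p\<bar>)"
text \<open>Given the covariate, every mean \<open>dot d (\<beta> T) p\<close> lies between the
  negative of \<open>width p\<close> and \<open>width p\<close>. The supremum of the normal
  densities with mean in this interval is \<open>flat\<close>.\<close>

definition flat :: "obs \<Rightarrow> real" where "flat p = normal_density 0 \<sigma> (max (\<bar>snd p\<bar> - width p) 0)"
definition Z :: real where "Z = enn2real (\<integral>\<^sup>+p. ennreal (flat p) \<partial>base d S)"
definition mask :: "obs \<Rightarrow> real" where "mask p = flat p / Z"
text \<open>The solution of lam i * fill + (1 - lam i) * dens = mask: with outliers of this density
  the contaminated observation has density \<open>mask\<close>, whatever the vertex
  \<open>T\<close>.\<close>

definition fill :: "nat set \<Rightarrow> nat \<Rightarrow> obs \<Rightarrow> real" where "fill T i p = (mask p - (1 - lam i) * dens T p) / lam i"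

lemma b_pos: "0 < b" "b \<le> 1" and a_pos: "0 < a"
  using t k \<sigma> by (auto simp: b_def a_def field_simps)

lemma sqnormS_f: "j < k \<Longrightarrow> sqnormS d S (f j) = 1"
proof -
  assume j: "j < k"
  have "sqnormS d S (f j) = (\<Sum>l<d. (if l = j then 1 else 0)\<^sup>2)"
    unfolding sqnormS_eq_sum_sq[OF S] using f[OF j] by (intro sum.cong) auto
  also have "\<dots> = (\<Sum>l<d. if l = j then 1 else 0)" by (intro sum.cong) auto
  also have "\<dots> = 1" using j k by simp
  finally show ?thesis .
qed

lemma dot_\<beta>: "dot d (\<beta> T) p = (\<Sum>j<k. (if j \<in> T then a else - a) * dot d (f j) p)"
  unfolding \<beta>_def sum_distrib_right sum_distrib_left by (subst sum.swap) (simp add: mult.assoc)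

lemma measurable_dens[measurable]: "dens T \<in> borel_measurable (obs_space d)"
  unfolding dens_def[abs_def] by measurable

lemma measurable_width[measurable]: "width \<in> borel_measurable (obs_space d)"
  unfolding width_def[abs_def] by measurable

lemma measurable_flat[measurable]: "flat \<in> borel_measurable (obs_space d)"
  unfolding flat_def[abs_def] by measurable

lemma measurable_mask[measurable]: "mask \<in> borel_measurable (obs_space d)"
  unfolding mask_def[abs_def] by measurable

lemma measurable_fill[measurable]: "fill T i \<in> borel_measurable (obs_space d)"
  unfolding fill_def[abs_def] by measurable

lemma dens_nonneg: "0 \<le> dens T p" and flat_nonneg: "0 \<le> flat p"
  by (auto simp: dens_def flat_def)

text \<open>The response differs from its mean by at least its absolute value minus
  \<open>width\<close>, and the centred normal density decreases with the distance from 0.\<close>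

lemma dens_le_flat: "dens T p \<le> flat p"
proof -
  have "\<bar>dot d (\<beta> T) p\<bar> \<le> (\<Sum>j<k. \<bar>(if j \<in> T then a else - a) * dot d (f j) p\<bar>)"
    unfolding dot_\<beta> by (rule sum_abs)
  also have "\<dots> = (\<Sum>j<k. a * \<bar>dot d (f j) p\<bar>)"
  proof -
    have "\<bar>(if j \<in> T then a else - a) * x\<bar> = a * \<bar>x\<bar>" for j and x :: real using a_pos by (simp add: abs_mult)
    then show ?thesis by (simp only:)
  qed
  also have "\<dots> = width p" by (simp only: width_def sum_distrib_left)
  finally have "\<bar>max (\<bar>snd p\<bar> - width p) 0\<bar> \<le> \<bar>snd p - dot d (\<beta> T) p\<bar>" by linarith
  then show ?thesis unfolding dens_def flat_def normal_density_shift[of "dot d (\<beta> T) p"] by (rule normal_density_antimono[OF \<sigma>])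
qed

lemma lin_model_dens: "lin_model d S \<sigma> (\<beta> T) = density (base d S) (dens T)"
  unfolding lin_model_density[OF \<sigma>] dens_def ..

lemma dens_mass: "(\<integral>\<^sup>+p. ennreal (dens T p) \<partial>base d S) = 1"
proof -
  have "emeasure (density (base d S) (dens T)) (space (obs_space d)) = 1"
    using prob_space.emeasure_space_1[OF prob_space_lin_model[OF \<sigma>, of d S "\<beta> T"]] unfolding lin_model_dens by simp
  then show ?thesis unfolding emeasure_density_base_space[OF measurable_dens] .
qed

text \<open>Given the covariate, the excess over mass 1 is at most width / \<sigma>. Its expectation
  is at most k b = t, because each of the k linear forms is standard normal.\<close>

lemma flat_mass: "(\<integral>\<^sup>+p. ennreal (flat p) \<partial>base d S) \<le> ennreal (1 + t)"
proof -
  interpret G: prob_space "gauss_vec d S" by (rule prob_space_gauss_vec)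
  have W: "width (w, y) = a * (\<Sum>j<k. \<bar>\<Sum>i<d. f j i * w i\<bar>)" for w y by (simp add: width_def)
  have "(\<integral>\<^sup>+p. ennreal (flat p) \<partial>base d S) = (\<integral>\<^sup>+w. \<integral>\<^sup>+y. ennreal (flat (w, y)) \<partial>lborel \<partial>gauss_vec d S)"
    by (rule nn_integral_base) simp
  also have "\<dots> \<le> (\<integral>\<^sup>+w. ennreal (1 + width (w, 0) / \<sigma>) \<partial>gauss_vec d S)"
  proof (rule nn_integral_mono)
    fix w
    have "0 \<le> width (w, 0)" unfolding width_def using a_pos by (intro mult_nonneg_nonneg sum_nonneg) auto
    from flat_top_mass[OF \<sigma> this] show "(\<integral>\<^sup>+y. ennreal (flat (w, y)) \<partial>lborel) \<le> ennreal (1 + width (w, 0) / \<sigma>)"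
      by (simp add: flat_def W)
  qed
  also have "\<dots> = (\<integral>\<^sup>+w. 1 + ennreal b * (\<Sum>j<k. ennreal \<bar>\<Sum>i<d. f j i * w i\<bar>) \<partial>gauss_vec d S)"
  proof (rule nn_integral_cong)
    fix w
    have "1 + width (w, 0) / \<sigma> = 1 + b * (\<Sum>j<k. \<bar>\<Sum>i<d. f j i * w i\<bar>)" unfolding W a_def using \<sigma> by simp
    moreover have "ennreal (1 + b * (\<Sum>j<k. \<bar>\<Sum>i<d. f j i * w i\<bar>)) = 1 + ennreal (b * (\<Sum>j<k. \<bar>\<Sum>i<d. f j i * w i\<bar>))"
      using b_pos ennreal_plus[of 1 "b * (\<Sum>j<k. \<bar>\<Sum>i<d. f j i * w i\<bar>)"] by (simp add: sum_nonneg)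
    ultimately show "ennreal (1 + width (w, 0) / \<sigma>) = 1 + ennreal b * (\<Sum>j<k. ennreal \<bar>\<Sum>i<d. f j i * w i\<bar>)"
      using b_pos by (simp add: ennreal_mult' sum_ennreal sum_nonneg)
  qed
  also have "\<dots> = 1 + ennreal b * (\<Sum>j<k. \<integral>\<^sup>+w. ennreal \<bar>\<Sum>i<d. f j i * w i\<bar> \<partial>gauss_vec d S)"
    using G.emeasure_space_1 by (simp add: nn_integral_add nn_integral_cmult nn_integral_sum del: sum_ennreal)
  also have "\<dots> \<le> 1 + ennreal b * (\<Sum>j<k. 1)"
    using gauss_vec_unit_moments(1)[OF S sqnormS_f] by (intro add_left_mono mult_left_mono sum_mono) auto
  also have "\<dots> = ennreal (1 + t)"
  proof -
    have "ennreal b * (\<Sum>j<k. 1) = ennreal (b * real k)" using b_pos by (simp add: ennreal_mult' ennreal_of_nat_eq_real_of_nat)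
    also have "b * real k = t" using k by (simp add: b_def)
    finally show ?thesis using t ennreal_plus[of 1 t] by simp
  qed
  finally show ?thesis .
qed

lemma Z: "1 \<le> Z" "Z \<le> 1 + t" "(\<integral>\<^sup>+p. ennreal (flat p) \<partial>base d S) = ennreal Z"
proof -
  have fin: "(\<integral>\<^sup>+p. ennreal (flat p) \<partial>base d S) < \<infinity>" using flat_mass le_less_trans by fastforce
  then show eq: "(\<integral>\<^sup>+p. ennreal (flat p) \<partial>base d S) = ennreal Z" unfolding Z_def by simp
  have "(\<integral>\<^sup>+p. ennreal (dens {} p) \<partial>base d S) \<le> (\<integral>\<^sup>+p. ennreal (flat p) \<partial>base d S)"
    by (intro nn_integral_mono ennreal_leI dens_le_flat)
  then show "1 \<le> Z" unfolding dens_mass eq by simp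
  show "Z \<le> 1 + t" using flat_mass t unfolding eq by (subst (asm) ennreal_le_iff) auto
qed

lemma mask_nonneg: "0 \<le> mask p"
  using Z(1) flat_nonneg by (simp add: mask_def)

lemma mask_mass: "(\<integral>\<^sup>+p. ennreal (mask p) \<partial>base d S) = 1"
proof -
  have "(\<integral>\<^sup>+p. ennreal (mask p) \<partial>base d S) = (\<integral>\<^sup>+p. ennreal (1 / Z) * ennreal (flat p) \<partial>base d S)"
    using Z(1) by (intro nn_integral_cong) (simp add: mask_def ennreal_mult'[symmetric])
  also have "\<dots> = ennreal (1 / Z) * ennreal Z"
    unfolding Z(3)[symmetric] by (intro nn_integral_cmult) (simp add: measurable_cong_sets[OF sets_base refl])
  also have "\<dots> = 1" using Z(1) by (simp add: ennreal_mult'[symmetric])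
  finally show ?thesis .
qed

text \<open>Here the choice of the side takes effect: (1 - lam i) Z \<le> (1 - t) (1 + t) \<le> 1,
  so the normalized envelope dominates the uncorrupted part of the mixture.\<close>

lemma fill_nonneg: "i < n \<Longrightarrow> t < lam i \<Longrightarrow> 0 \<le> fill T i p"
proof -
  assume i: "i < n" "t < lam i"
  have "(1 - lam i) * Z \<le> (1 - t) * (1 + t)" using i Z lam t by (intro mult_mono) auto
  also have "\<dots> \<le> 1" using t by (simp add: algebra_simps power2_eq_square[symmetric])
  finally have "(1 - lam i) * Z \<le> 1" .
  then have "1 - lam i \<le> 1 / Z" using Z(1) by (simp add: field_simps)
  then have "(1 - lam i) * dens T p \<le> 1 / Z * flat p"
    using lam i dens_le_flat Z(1) dens_nonneg by (intro mult_mono) auto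
  then show ?thesis using i t by (simp add: fill_def mask_def)
qed

lemma mixture_density: "i < n \<Longrightarrow> t < lam i \<Longrightarrow>
  ennreal (lam i) * ennreal (fill T i p) + ennreal (1 - lam i) * ennreal (dens T p) = ennreal (mask p)"
proof -
  assume i: "i < n" "t < lam i"
  have l: "0 \<le> 1 - lam i" "0 < lam i" using i lam t by auto
  have "lam i * fill T i p + (1 - lam i) * dens T p = mask p" using l by (simp add: fill_def)
  then show ?thesis using l fill_nonneg[OF i] dens_nonneg[of T p]
    by (simp add: ennreal_mult'[symmetric] flip: ennreal_plus)
qed

lemma mixture_emeasure:
  assumes i: "i < n" "t < lam i" and A: "A \<in> sets (obs_space d)"
  shows "ennreal (lam i) * emeasure (density (base d S) (fill T i)) A + ennreal (1 - lam i) * emeasure (density (base d S) (dens T)) A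
    = emeasure (density (base d S) mask) A"
proof -
  have m[simp]: "(\<lambda>p. ennreal (g p)) \<in> borel_measurable (base d S)" if "g \<in> borel_measurable (obs_space d)" for g
    using that by (simp add: measurable_cong_sets[OF sets_base refl])
  have A': "A \<in> sets (base d S)" using A by simp
  have "ennreal (lam i) * emeasure (density (base d S) (fill T i)) A + ennreal (1 - lam i) * emeasure (density (base d S) (dens T)) A =
     (\<integral>\<^sup>+p. ennreal (lam i) * (ennreal (fill T i p) * indicator A p) + ennreal (1 - lam i) * (ennreal (dens T p) * indicator A p) \<partial>base d S)"
    using A' by (simp add: emeasure_density nn_integral_add nn_integral_cmult)
  also have "\<dots> = (\<integral>\<^sup>+p. ennreal (mask p) * indicator A p \<partial>base d S)"
  proof (rule nn_integral_cong)
    fix p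
    show "ennreal (lam i) * (ennreal (fill T i p) * indicator A p) + ennreal (1 - lam i) * (ennreal (dens T p) * indicator A p) =
      ennreal (mask p) * indicator A p"
      unfolding mixture_density[OF i, of T p, symmetric] by (simp add: distrib_right mult.assoc)
  qed
  also have "\<dots> = emeasure (density (base d S) mask) A" using A' by (simp add: emeasure_density)
  finally show ?thesis .
qed

section \<open>Laws of the observed points and the masking adversary\<close>

definition law :: "nat set \<Rightarrow> nat \<Rightarrow> obs \<Rightarrow> real" where
  "law T i = (if i < n \<and> t < lam i then mask else dens T)"

text \<open>At the remaining indices \<open>dens T\<close> is a default that keeps every factor of
  the product measure a probability measure.\<close>

definition outlier :: "nat set \<Rightarrow> nat \<Rightarrow> obs measure" where
  "outlier T i = density (base d S) (if i < n \<and> t < lam i then fill T i else dens T)"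

lemma prob_space_density_base:
  assumes "g \<in> borel_measurable (obs_space d)" "(\<integral>\<^sup>+p. ennreal (g p) \<partial>base d S) = 1"
  shows "prob_space (density (base d S) g)"
proof (rule prob_spaceI)
  show "emeasure (density (base d S) g) (space (density (base d S) g)) = 1"
    using emeasure_density_base_space[OF assms(1), of S] assms(2) by simp
qed

lemma prob_space_law: "prob_space (density (base d S) (law T i))"
  unfolding law_def using dens_mass mask_mass by (auto intro!: prob_space_density_base)

text \<open>The mass X of \<open>fill\<close> is read off the mixture identity instead of being
  integrated: lam i X + (1 - lam i) = 1 forces X = 1.\<close>

lemma prob_space_outlier: "prob_space (outlier T i)"
proof (cases "i < n \<and> t < lam i")
  case True
  then have l: "0 \<le> 1 - lam i" "0 < lam i" using lam t by auto
  have sp: "space (obs_space d) \<in> sets (obs_space d)" by simp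
  have 1: "emeasure (density (base d S) (dens T)) (space (obs_space d)) = 1"
    using prob_space.emeasure_space_1[OF prob_space_density_base[OF measurable_dens dens_mass]] by simp
  have 2: "emeasure (density (base d S) mask) (space (obs_space d)) = 1"
    using prob_space.emeasure_space_1[OF prob_space_density_base[OF measurable_mask mask_mass]] by simp
  have eq: "ennreal (lam i) * emeasure (density (base d S) (fill T i)) (space (obs_space d)) + ennreal (1 - lam i) = 1"
    using mixture_emeasure[of i "space (obs_space d)" T] True sp unfolding 1 2 by simp
  define X where "X = emeasure (density (base d S) (fill T i)) (space (obs_space d))"
  have "X = 1"
  proof (cases X)
    case (real x)
    have "ennreal (lam i * x + (1 - lam i)) = ennreal (lam i) * ennreal x + ennreal (1 - lam i)"
      using l real by (simp add: ennreal_mult' ennreal_plus)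
    also have "\<dots> = ennreal 1" using eq real unfolding X_def by simp
    finally have "lam i * x + (1 - lam i) = 1" using l real by (subst (asm) ennreal_inj) auto
    then have "x = 1" using l by simp
    then show ?thesis using real by simp
  next
    case top
    then show ?thesis using eq l unfolding X_def[symmetric] by (simp add: ennreal_mult_top)
  qed
  then show ?thesis unfolding outlier_def X_def using True by (intro prob_spaceI) simp
next
  case False
  then show ?thesis unfolding outlier_def using prob_space_density_base[OF measurable_dens dens_mass, of T] by auto
qed

lemma sets_outlier[simp, measurable_cong]: "sets (outlier T i) = sets (obs_space d)"
  by (simp add: outlier_def)

text \<open>Where \<open>lam i\<close> is at most \<open>t\<close> the adversary repeats the clean
  point, so corruption leaves no trace. Elsewhere it draws from \<open>fill\<close>, independently
  of data and bits.\<close>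

definition adv :: "nat set \<Rightarrow> (nat \<Rightarrow> obs) \<times> (nat \<Rightarrow> bool) \<Rightarrow> (nat \<Rightarrow> obs) measure" where
  "adv T xb = distr (PiM {..<n} (outlier T)) (sample_space d n) (\<lambda>q. \<lambda>i\<in>{..<n}. if t < lam i then q i else fst xb i)"

lemma sets_PiM_outlier[simp, measurable_cong]: "sets (PiM {..<n} (outlier T)) = sets (sample_space d n)"
  unfolding sample_space_def by (intro sets_PiM_cong) auto

lemma prob_space_PiM_outlier: "prob_space (PiM {..<n} (outlier T))"
  by (intro prob_space_PiM prob_space_outlier)

lemma measurable_sample_component: "i \<in> {..<n} \<Longrightarrow> (\<lambda>z. z i) \<in> sample_space d n \<rightarrow>\<^sub>M obs_space d"
  unfolding sample_space_def by (rule measurable_component_singleton)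

lemma measurable_adv_map:
  "(\<lambda>(xb, q). \<lambda>i\<in>{..<n}. if t < lam i then q i else fst xb i) \<in>
    (sample_space d n \<Otimes>\<^sub>M bit_space n) \<Otimes>\<^sub>M sample_space d n \<rightarrow>\<^sub>M sample_space d n"
proof -
  have "(\<lambda>p. \<lambda>i\<in>{..<n}. if t < lam i then snd p i else fst (fst p) i) \<in>
    (sample_space d n \<Otimes>\<^sub>M bit_space n) \<Otimes>\<^sub>M sample_space d n \<rightarrow>\<^sub>M PiM {..<n} (\<lambda>_. obs_space d)"
  proof (rule measurable_restrict)
    fix i assume i: "i \<in> {..<n}"
    note [measurable] = measurable_sample_component[OF i]
    show "(\<lambda>p. if t < lam i then snd p i else fst (fst p) i) \<in> (sample_space d n \<Otimes>\<^sub>M bit_space n) \<Otimes>\<^sub>M sample_space d n \<rightarrow>\<^sub>M obs_space d"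
      by measurable
  qed
  then show ?thesis unfolding sample_space_def[symmetric] by (simp add: case_prod_beta')
qed

lemma adversary_adv: "adversary d n (adv T)"
  unfolding adversary_def adv_def[abs_def]
proof (rule measurable_distr_prob_space2)
  show "(\<lambda>xb. PiM {..<n} (outlier T)) \<in> sample_space d n \<Otimes>\<^sub>M bit_space n \<rightarrow>\<^sub>M prob_algebra (sample_space d n)"
    using prob_space_PiM_outlier by (intro measurable_const) (simp add: space_prob_algebra)
  show "(\<lambda>(xb, q). \<lambda>i\<in>{..<n}. if t < lam i then q i else fst xb i) \<in>
    (sample_space d n \<Otimes>\<^sub>M bit_space n) \<Otimes>\<^sub>M sample_space d n \<rightarrow>\<^sub>M sample_space d n" by (rule measurable_adv_map)
qed

end

section \<open>Assouad's argument\<close>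

lemma measurable_observed: "observed n \<in> contam_space d n \<rightarrow>\<^sub>M sample_space d n"
proof -
  have "(\<lambda>\<omega>. \<lambda>i\<in>{..<n}. if snd (fst \<omega>) i then snd \<omega> i else fst (fst \<omega>) i) \<in> contam_space d n \<rightarrow>\<^sub>M PiM {..<n} (\<lambda>_. obs_space d)"
  proof (rule measurable_restrict)
    fix i assume i: "i \<in> {..<n}"
    have [measurable]: "(\<lambda>z. z i) \<in> sample_space d n \<rightarrow>\<^sub>M obs_space d"
      using i unfolding sample_space_def by (rule measurable_component_singleton)
    have [measurable]: "(\<lambda>z. z i) \<in> bit_space n \<rightarrow>\<^sub>M count_space UNIV"
      using i unfolding bit_space_def by (rule measurable_component_singleton)
    show "(\<lambda>\<omega>. if snd (fst \<omega>) i then snd \<omega> i else fst (fst \<omega>) i) \<in> contam_space d n \<rightarrow>\<^sub>M obs_space d"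
      unfolding contam_space_def by measurable
  qed
  moreover have "observed n = (\<lambda>\<omega>. \<lambda>i\<in>{..<n}. if snd (fst \<omega>) i then snd \<omega> i else fst (fst \<omega>) i)"
    by (simp add: observed_def fun_eq_iff split: prod.split)
  ultimately show ?thesis by (simp add: sample_space_def)
qed

lemma sqrt_prod: "sqrt (\<Prod>i\<in>I. g i) = (\<Prod>i\<in>I. sqrt (g i))"
  by (induction I rule: infinite_finite_induct) (auto simp: real_sqrt_mult)

lemma prod_mono_ennreal:
  fixes g h :: "'a \<Rightarrow> ennreal"
  shows "(\<And>i. i \<in> I \<Longrightarrow> g i \<le> h i) \<Longrightarrow> prod g I \<le> prod h I"
  by (induction I rule: infinite_finite_induct) (auto intro!: mult_mono)

lemma ennreal_diff_le:
  assumes "1 \<le> X + ennreal y" "0 \<le> y" shows "ennreal (1 - y) \<le> X"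
proof (cases X)
  case (real x)
  then have "ennreal 1 \<le> ennreal (x + y)" using assms by (simp add: ennreal_plus)
  then have "1 \<le> x + y" using real assms by (subst (asm) ennreal_le_iff) auto
  then show ?thesis using real by (simp add: ennreal_leI)
qed simp

context hypercube_design
begin

text \<open>One coordinate of the observed sample under \<open>adv\<close>, as a function of the
  clean point, the bit and the outlier of this coordinate alone. In this form
  \<open>distr_PiM_pair\<close> yields a product law.\<close>

definition mix :: "nat \<Rightarrow> (obs \<times> bool) \<times> obs \<Rightarrow> obs" where
  "mix i y = (if snd (fst y) then (if t < lam i then snd y else fst (fst y)) else fst (fst y))"

abbreviation bern :: "nat \<Rightarrow> bool measure" where
  "bern i \<equiv> measure_pmf (bernoulli_pmf (lam i))"

lemma measurable_mix: "mix i \<in> (lin_model d S \<sigma> (\<beta> T) \<Otimes>\<^sub>M bern i) \<Otimes>\<^sub>M outlier T i \<rightarrow>\<^sub>M obs_space d"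
  unfolding mix_def[abs_def] by measurable

lemma distr_mix:
  assumes i: "i < n"
  shows "distr ((lin_model d S \<sigma> (\<beta> T) \<Otimes>\<^sub>M bern i) \<Otimes>\<^sub>M outlier T i) (obs_space d) (mix i) = density (base d S) (law T i)"
proof (rule measure_eqI)
  let ?P = "lin_model d S \<sigma> (\<beta> T)" and ?O = "outlier T i"
  interpret P: prob_space ?P by (rule prob_space_lin_model[OF \<sigma>])
  interpret O: prob_space ?O by (rule prob_space_outlier)
  show "sets (distr ((?P \<Otimes>\<^sub>M bern i) \<Otimes>\<^sub>M ?O) (obs_space d) (mix i)) = sets (density (base d S) (law T i))" by simp
  fix A assume "A \<in> sets (distr ((?P \<Otimes>\<^sub>M bern i) \<Otimes>\<^sub>M ?O) (obs_space d) (mix i))"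
  then have A: "A \<in> sets (obs_space d)" by simp
  have im: "(\<lambda>y. indicator A (mix i y) :: ennreal) \<in> borel_measurable ((?P \<Otimes>\<^sub>M bern i) \<Otimes>\<^sub>M ?O)"
    by (rule measurable_compose[OF measurable_mix]) (use A in simp)
  have "emeasure (distr ((?P \<Otimes>\<^sub>M bern i) \<Otimes>\<^sub>M ?O) (obs_space d) (mix i)) A = (\<integral>\<^sup>+y. indicator A (mix i y) \<partial>((?P \<Otimes>\<^sub>M bern i) \<Otimes>\<^sub>M ?O))"
    using A measurable_mix by (simp add: nn_integral_distr flip: nn_integral_indicator)
  also have "\<dots> = (\<integral>\<^sup>+xb. \<integral>\<^sup>+q. indicator A (mix i (xb, q)) \<partial>?O \<partial>(?P \<Otimes>\<^sub>M bern i))"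
    by (rule O.nn_integral_fst[OF im, symmetric])
  also have "\<dots> = (\<integral>\<^sup>+x. \<integral>\<^sup>+c. \<integral>\<^sup>+q. indicator A (mix i ((x, c), q)) \<partial>?O \<partial>bern i \<partial>?P)"
    by (rule measure_pmf.nn_integral_fst[symmetric, OF O.borel_measurable_nn_integral_fst[OF im]])
  also have "\<dots> = emeasure (density (base d S) (law T i)) A"
  proof (cases "t < lam i")
    case True
    have l: "0 \<le> lam i" "lam i \<le> 1" using lam i by auto
    have "(\<integral>\<^sup>+x. \<integral>\<^sup>+c. \<integral>\<^sup>+q. indicator A (mix i ((x, c), q)) \<partial>?O \<partial>bern i \<partial>?P) =
       (\<integral>\<^sup>+x. emeasure ?O A * ennreal (lam i) + indicator A x * ennreal (1 - lam i) \<partial>?P)"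
      using l True A by (intro nn_integral_cong) (simp add: mix_def O.emeasure_space_1 nn_integral_indicator)
    also have "\<dots> = emeasure ?O A * ennreal (lam i) + emeasure ?P A * ennreal (1 - lam i)"
      using A P.emeasure_space_1 by (simp add: nn_integral_add nn_integral_multc)
    also have "\<dots> = emeasure (density (base d S) (law T i)) A"
      using mixture_emeasure[OF i True A, of T] True i by (simp add: law_def outlier_def lin_model_dens mult.commute)
    finally show ?thesis .
  next
    case False
    have "(\<integral>\<^sup>+x. \<integral>\<^sup>+c. \<integral>\<^sup>+q. indicator A (mix i ((x, c), q)) \<partial>?O \<partial>bern i \<partial>?P) = (\<integral>\<^sup>+x. indicator A x \<partial>?P)"
    proof (rule nn_integral_cong)
      fix x
      have mx: "mix i ((x, c), q) = x" for c q using False by (simp add: mix_def)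
      have "(\<integral>\<^sup>+c. \<integral>\<^sup>+q. indicator A (mix i ((x, c), q)) \<partial>?O \<partial>bern i) = (\<integral>\<^sup>+c. indicator A x \<partial>bern i)"
        unfolding mx using O.emeasure_space_1 by simp
      then show "(\<integral>\<^sup>+c. \<integral>\<^sup>+q. indicator A (mix i ((x, c), q)) \<partial>?O \<partial>bern i) = indicator A x" by simp
    qed
    then show ?thesis using False A by (simp add: law_def lin_model_dens)
  qed
  finally show "emeasure (distr ((?P \<Otimes>\<^sub>M bern i) \<Otimes>\<^sub>M ?O) (obs_space d) (mix i)) A = emeasure (density (base d S) (law T i)) A" .
qed

definition Law :: "nat set \<Rightarrow> (nat \<Rightarrow> obs) measure" where
  "Law T = PiM {..<n} (\<lambda>i. density (base d S) (law T i))"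

lemma sets_Law[simp, measurable_cong]: "sets (Law T) = sets (sample_space d n)"
  unfolding Law_def sample_space_def by (intro sets_PiM_cong) auto

lemma space_Law[simp]: "space (Law T) = space (sample_space d n)"
  by (rule sets_eq_imp_space_eq) simp

lemma prob_space_Law: "prob_space (Law T)"
  unfolding Law_def by (intro prob_space_PiM prob_space_law)

text \<open>The map \<pi> zips data with bits and \<Lambda> adds the outliers. Both act
  coordinatewise, and the outliers are independent of data and bits, so the integral over the kernel
  becomes a product measure and the observed points are independent.\<close>

lemma emeasure_observed:
  assumes E: "E \<in> sets (sample_space d n)"
  shows "emeasure (contam_prob d n S \<sigma> lam (\<beta> T) (adv T)) {\<omega> \<in> space (contam_space d n). observed n \<omega> \<in> E} = emeasure (Law T) E"
proof -
  let ?P = "lin_model d S \<sigma> (\<beta> T)"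
  let ?\<mu> = "PiM {..<n} (\<lambda>_. ?P) \<Otimes>\<^sub>M PiM {..<n} bern"
  let ?PB = "PiM {..<n} (\<lambda>i. ?P \<Otimes>\<^sub>M bern i)" and ?PO = "PiM {..<n} (outlier T)"
  have P: "prob_space ?P" by (rule prob_space_lin_model[OF \<sigma>])
  have PBi: "prob_space (?P \<Otimes>\<^sub>M bern i)" for i by (intro prob_space_pair P measure_pmf.prob_space_axioms)
  interpret PO: prob_space ?PO by (rule prob_space_PiM_outlier)
  define \<pi> where "\<pi> p = (\<lambda>i\<in>{..<n}. (\<lambda>q. q) (fst p i, snd p i))" for p :: "(nat \<Rightarrow> obs) \<times> (nat \<Rightarrow> bool)"
  define \<Lambda> where "\<Lambda> p = (\<lambda>i\<in>{..<n}. mix i (fst p i, snd p i))" for p :: "(nat \<Rightarrow> obs \<times> bool) \<times> (nat \<Rightarrow> obs)"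
  have d1: "distr ?\<mu> ?PB \<pi> = ?PB"
  proof -
    have "distr ?\<mu> ?PB \<pi> = PiM {..<n} (\<lambda>i. distr (?P \<Otimes>\<^sub>M bern i) (?P \<Otimes>\<^sub>M bern i) (\<lambda>q. q))"
      unfolding \<pi>_def[abs_def] by (rule distr_PiM_pair[OF finite_lessThan P measure_pmf.prob_space_axioms]) simp
    then show ?thesis by (simp only: distr_id)
  qed
  have m\<pi>: "\<pi> \<in> ?\<mu> \<rightarrow>\<^sub>M ?PB" unfolding \<pi>_def[abs_def]
  proof (rule measurable_restrict)
    fix i assume i: "i \<in> {..<n}"
    have [measurable]: "(\<lambda>x. x i) \<in> PiM {..<n} (\<lambda>_. ?P) \<rightarrow>\<^sub>M ?P" "(\<lambda>x. x i) \<in> PiM {..<n} bern \<rightarrow>\<^sub>M bern i"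
      using i by (auto intro: measurable_component_singleton)
    show "(\<lambda>p. (\<lambda>q. q) (fst p i, snd p i)) \<in> ?\<mu> \<rightarrow>\<^sub>M ?P \<Otimes>\<^sub>M bern i" by measurable
  qed
  have m\<Lambda>: "\<Lambda> \<in> ?PB \<Otimes>\<^sub>M ?PO \<rightarrow>\<^sub>M PiM {..<n} (\<lambda>_. obs_space d)" unfolding \<Lambda>_def[abs_def]
  proof (rule measurable_restrict)
    fix i assume i: "i \<in> {..<n}"
    have [measurable]: "(\<lambda>x. x i) \<in> ?PB \<rightarrow>\<^sub>M ?P \<Otimes>\<^sub>M bern i" "(\<lambda>x. x i) \<in> ?PO \<rightarrow>\<^sub>M outlier T i"
      using i by (auto intro: measurable_component_singleton)
    note [measurable] = measurable_mix[of i T]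
    show "(\<lambda>p. mix i (fst p i, snd p i)) \<in> ?PB \<Otimes>\<^sub>M ?PO \<rightarrow>\<^sub>M obs_space d" by measurable
  qed
  have d2: "distr (?PB \<Otimes>\<^sub>M ?PO) (PiM {..<n} (\<lambda>_. obs_space d)) \<Lambda> = Law T"
  proof -
    have "distr (?PB \<Otimes>\<^sub>M ?PO) (PiM {..<n} (\<lambda>_. obs_space d)) \<Lambda> =
       PiM {..<n} (\<lambda>i. distr ((?P \<Otimes>\<^sub>M bern i) \<Otimes>\<^sub>M outlier T i) (obs_space d) (mix i))"
      unfolding \<Lambda>_def[abs_def] by (rule distr_PiM_pair[OF finite_lessThan PBi prob_space_outlier measurable_mix])
    also have "\<dots> = Law T" unfolding Law_def by (intro PiM_cong refl distr_mix) simp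
    finally show ?thesis .
  qed
  define X where "X = \<Lambda> -` E \<inter> space (?PB \<Otimes>\<^sub>M ?PO)"
  have E': "E \<in> sets (PiM {..<n} (\<lambda>_. obs_space d))" using E by (simp add: sample_space_def)
  have X: "X \<in> sets (?PB \<Otimes>\<^sub>M ?PO)" unfolding X_def by (rule measurable_sets[OF m\<Lambda> E'])
  define A where "A = {\<omega> \<in> space (contam_space d n). observed n \<omega> \<in> E}"
  have A: "A \<in> sets (contam_space d n)"
    using measurable_sets[OF measurable_observed E] by (simp add: A_def vimage_def Int_def conj_commute)
  have "emeasure (contam_prob d n S \<sigma> lam (\<beta> T) (adv T)) A =
    (\<integral>\<^sup>+xb. emeasure (adv T xb) {xt \<in> space (sample_space d n). (xb, xt) \<in> A} \<partial>?\<mu>)"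
    by (rule emeasure_contam_prob[OF \<sigma> adversary_adv A])
  also have "\<dots> = (\<integral>\<^sup>+xb. emeasure ?PO (Pair (\<pi> xb) -` X) \<partial>?\<mu>)"
  proof (rule nn_integral_cong)
    fix xb assume xb: "xb \<in> space ?\<mu>"
    then have xb': "xb \<in> space (sample_space d n \<Otimes>\<^sub>M bit_space n)" by simp
    let ?g = "\<lambda>q. \<lambda>i\<in>{..<n}. if t < lam i then q i else fst xb i"
    have g: "?g \<in> sample_space d n \<rightarrow>\<^sub>M sample_space d n"
      using measurable_compose[OF measurable_Pair1'[OF xb'] measurable_adv_map] by simp
    have gO: "?g \<in> ?PO \<rightarrow>\<^sub>M sample_space d n" using g by (simp add: measurable_cong_sets[OF sets_PiM_outlier refl])
    have sPO: "space ?PO = space (sample_space d n)" by (rule sets_eq_imp_space_eq) simp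
    have SA: "{xt \<in> space (sample_space d n). (xb, xt) \<in> A} \<in> sets (sample_space d n)"
    proof -
      have "(\<lambda>xt. (xb, xt)) \<in> sample_space d n \<rightarrow>\<^sub>M contam_space d n" unfolding contam_space_def by (rule measurable_Pair1'[OF xb'])
      from measurable_sets[OF this A] show ?thesis by (simp add: vimage_def Int_def conj_commute)
    qed
    have "emeasure (adv T xb) {xt \<in> space (sample_space d n). (xb, xt) \<in> A} =
      emeasure ?PO (?g -` {xt \<in> space (sample_space d n). (xb, xt) \<in> A} \<inter> space ?PO)"
      unfolding adv_def by (rule emeasure_distr[OF gO SA])
    also have "?g -` {xt \<in> space (sample_space d n). (xb, xt) \<in> A} \<inter> space ?PO = Pair (\<pi> xb) -` X"
    proof (rule set_eqI)
      fix q
      have "observed n (xb, ?g q) = \<Lambda> (\<pi> xb, q)"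
        by (simp add: observed_def \<Lambda>_def \<pi>_def mix_def fun_eq_iff split: prod.split)
      moreover have "\<pi> xb \<in> space ?PB" by (rule measurable_space[OF m\<pi> xb])
      moreover have "?g q \<in> space (sample_space d n)" if "q \<in> space (sample_space d n)"
        by (rule measurable_space[OF g that])
      ultimately show "q \<in> ?g -` {xt \<in> space (sample_space d n). (xb, xt) \<in> A} \<inter> space ?PO \<longleftrightarrow> q \<in> Pair (\<pi> xb) -` X"
        using xb' unfolding X_def A_def sPO[symmetric] by (auto simp: space_pair_measure contam_space_def sPO)
    qed
    finally show "emeasure (adv T xb) {xt \<in> space (sample_space d n). (xb, xt) \<in> A} = emeasure ?PO (Pair (\<pi> xb) -` X)" .
  qed
  also have "\<dots> = (\<integral>\<^sup>+y. emeasure ?PO (Pair y -` X) \<partial>(distr ?\<mu> ?PB \<pi>))"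
    by (subst nn_integral_distr[OF m\<pi>]) (simp_all add: PO.measurable_emeasure_Pair[OF X])
  also have "\<dots> = (\<integral>\<^sup>+y. emeasure ?PO (Pair y -` X) \<partial>?PB)" by (simp only: d1)
  also have "\<dots> = emeasure (?PB \<Otimes>\<^sub>M ?PO) X" by (rule PO.emeasure_pair_measure_alt[OF X, symmetric])
  also have "\<dots> = emeasure (distr (?PB \<Otimes>\<^sub>M ?PO) (PiM {..<n} (\<lambda>_. obs_space d)) \<Lambda>) E"
    unfolding X_def by (rule emeasure_distr[OF m\<Lambda> E', symmetric])
  also have "\<dots> = emeasure (Law T) E" by (simp only: d2)
  finally show ?thesis unfolding A_def .
qed

definition flip :: "nat \<Rightarrow> nat set \<Rightarrow> nat set" where
  "flip j T = (if j \<in> T then T - {j} else insert j T)"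

lemma flip: "flip j (flip j T) = T" "j \<in> flip j T \<longleftrightarrow> j \<notin> T" "l \<noteq> j \<Longrightarrow> l \<in> flip j T \<longleftrightarrow> l \<in> T"
  by (auto simp: flip_def)

lemma measurable_law: "law T i \<in> borel_measurable (obs_space d)"
  by (simp add: law_def)

lemma law_nonneg: "0 \<le> law T i p"
  by (simp add: law_def mask_nonneg dens_nonneg)

lemma dot_\<beta>_flip:
  assumes j: "j < k" shows "(dot d (\<beta> T) p - dot d (\<beta> (flip j T)) p)\<^sup>2 = 4 * a\<^sup>2 * (dot d (f j) p)\<^sup>2"
proof -
  have "dot d (\<beta> T) p - dot d (\<beta> (flip j T)) p =
     (\<Sum>l<k. (if l \<in> T then a else - a) * dot d (f l) p - (if l \<in> flip j T then a else - a) * dot d (f l) p)"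
    unfolding dot_\<beta> by (rule sum_subtractf[symmetric])
  also have "\<dots> = (\<Sum>l<k. if l = j then (if j \<in> T then 2 * a else - (2 * a)) * dot d (f j) p else 0)"
    by (intro sum.cong refl) (simp add: flip left_diff_distrib[symmetric])
  also have "\<dots> = (if j \<in> T then 2 * a else - (2 * a)) * dot d (f j) p" using j by simp
  finally show ?thesis by (simp add: power_mult_distrib)
qed

text \<open>Given the covariate, the affinity of the two normal laws is exp (- h) \<ge> 1 - h.
  Flipping one coordinate moves the mean by 2 a times a standard normal variable, so h has
  expectation b^2 / 2.\<close>

lemma dens_affinity:
  assumes j: "j < k"
  shows "ennreal (1 - b\<^sup>2 / 2) \<le> (\<integral>\<^sup>+p. ennreal (sqrt (dens T p * dens (flip j T) p)) \<partial>base d S)"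
proof -
  interpret G: prob_space "gauss_vec d S" by (rule prob_space_gauss_vec)
  define h where "h w = b\<^sup>2 / 2 * (\<Sum>i<d. f j i * w i)\<^sup>2" for w
  have inner: "(\<integral>\<^sup>+y. ennreal (sqrt (dens T (w, y) * dens (flip j T) (w, y))) \<partial>lborel) = ennreal (exp (- h w))" for w
  proof -
    let ?m = "dot d (\<beta> T) (w, 0)" and ?m' = "dot d (\<beta> (flip j T)) (w, 0)"
    have "(?m - ?m')\<^sup>2 / (8 * \<sigma>\<^sup>2) = h w"
      unfolding dot_\<beta>_flip[OF j] h_def a_def using \<sigma> by (simp add: power_mult_distrib)
    then have "sqrt (dens T (w, y) * dens (flip j T) (w, y)) = exp (- h w) * normal_density ((?m + ?m') / 2) \<sigma> y" for y
      unfolding dens_def using sqrt_normal_density_mult[OF \<sigma>, of ?m y ?m'] by (simp add: mult.commute)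
    then have "(\<integral>\<^sup>+y. ennreal (sqrt (dens T (w, y) * dens (flip j T) (w, y))) \<partial>lborel) =
       (\<integral>\<^sup>+y. ennreal (exp (- h w)) * ennreal (normal_density ((?m + ?m') / 2) \<sigma> y) \<partial>lborel)"
      by (simp add: ennreal_mult')
    also have "\<dots> = ennreal (exp (- h w)) * (\<integral>\<^sup>+y. ennreal (normal_density ((?m + ?m') / 2) \<sigma> y) \<partial>lborel)"
      by (intro nn_integral_cmult) simp
    also have "(\<integral>\<^sup>+y. ennreal (normal_density ((?m + ?m') / 2) \<sigma> y) \<partial>lborel) = 1"
      using \<sigma> by (simp add: nn_integral_eq_integral)
    finally show ?thesis by simp
  qed
  have [measurable]: "h \<in> borel_measurable (gauss_vec d S)" unfolding h_def[abs_def] by measurable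
  have "(\<integral>\<^sup>+w. ennreal (h w) \<partial>gauss_vec d S) = ennreal (b\<^sup>2 / 2) * (\<integral>\<^sup>+w. ennreal ((\<Sum>i<d. f j i * w i)\<^sup>2) \<partial>gauss_vec d S)"
  proof -
    have "ennreal (h w) = ennreal (b\<^sup>2 / 2) * ennreal ((\<Sum>i<d. f j i * w i)\<^sup>2)" for w
      unfolding h_def by (rule ennreal_mult) auto
    then show ?thesis by (simp only:) (rule nn_integral_cmult, measurable)
  qed
  then have H: "(\<integral>\<^sup>+w. ennreal (h w) \<partial>gauss_vec d S) = ennreal (b\<^sup>2 / 2)"
    unfolding gauss_vec_unit_moments(2)[OF S sqnormS_f[OF j]] by simp
  have "1 = (\<integral>\<^sup>+w. 1 \<partial>gauss_vec d S)" using G.emeasure_space_1 by simp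
  also have "\<dots> \<le> (\<integral>\<^sup>+w. ennreal (exp (- h w)) + ennreal (h w) \<partial>gauss_vec d S)"
  proof (rule nn_integral_mono)
    fix w
    have "1 \<le> exp (- h w) + h w" using exp_ge_add_one_self[of "- h w"] by simp
    then have "ennreal 1 \<le> ennreal (exp (- h w) + h w)" by (rule ennreal_leI)
    also have "\<dots> = ennreal (exp (- h w)) + ennreal (h w)" by (rule ennreal_plus) (auto simp: h_def)
    finally show "1 \<le> ennreal (exp (- h w)) + ennreal (h w)" by simp
  qed
  also have "\<dots> = (\<integral>\<^sup>+w. ennreal (exp (- h w)) \<partial>gauss_vec d S) + ennreal (b\<^sup>2 / 2)"
    unfolding H[symmetric] by (rule nn_integral_add) auto
  finally have "ennreal (1 - b\<^sup>2 / 2) \<le> (\<integral>\<^sup>+w. ennreal (exp (- h w)) \<partial>gauss_vec d S)" by (rule ennreal_diff_le) simp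
  also have "\<dots> = (\<integral>\<^sup>+p. ennreal (sqrt (dens T p * dens (flip j T) p)) \<partial>base d S)"
    by (subst nn_integral_base) (auto simp: inner)
  finally show ?thesis .
qed

text \<open>Masked observations have equal laws and contribute affinity 1; each of the others
  contributes at least 1 - b^2 / 2. Bernoulli's inequality gives 19/20 for the product, and (19/20 -
  1/2) * (4/3) = 3/5.\<close>

lemma pair_testing:
  assumes j: "j < k" and E: "E \<in> sets (sample_space d n)"
    and small: "real (Ncount n lam t) * b\<^sup>2 \<le> 1/10"
  shows "3/5 \<le> measure (Law T) E + measure (Law (flip j T)) (space (sample_space d n) - E)"
proof -
  let ?N = "PiM {..<n} (\<lambda>_. base d S)"
  define F where "F T x = (\<Prod>i<n. law T i (x i))" for T and x :: "nat \<Rightarrow> obs"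
  interpret PN: product_sigma_finite "\<lambda>_::nat. base d S" by (rule product_sigma_finite.intro[OF sigma_finite_base])
  have lm: "law T i \<in> borel_measurable (base d S)" for T i
    using measurable_law by (simp add: measurable_cong_sets[OF sets_base refl])
  have F0: "0 \<le> F T x" for T x unfolding F_def by (intro prod_nonneg) (auto simp: law_nonneg)
  have Fm: "F T \<in> borel_measurable ?N" for T
    unfolding F_def[abs_def] by (intro borel_measurable_prod measurable_compose[OF _ lm] measurable_component_singleton)
  have LF: "Law T = density ?N (F T)" for T
  proof -
    have "Law T = density ?N (\<lambda>x. \<Prod>i<n. ennreal (law T i (x i)))"
      unfolding Law_def using lm prob_space_law by (intro PiM_density sigma_finite_base) auto
    also have "(\<lambda>x. \<Prod>i<n. ennreal (law T i (x i))) = (\<lambda>x. ennreal (F T x))"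
      unfolding F_def by (simp add: prod_ennreal law_nonneg)
    finally show ?thesis .
  qed
  have sN: "sets ?N = sets (sample_space d n)" unfolding sample_space_def by (intro sets_PiM_cong) auto
  have spN: "space ?N = space (sample_space d n)" by (rule sets_eq_imp_space_eq[OF sN])
  let ?c = "\<lambda>i. if t < lam i then 1 else 1 - b\<^sup>2 / 2"
  have b2: "0 \<le> 1 - b\<^sup>2 / 2" using b_pos power_le_one[of b 2] by simp
  have "real (Ncount n lam t) * (- (b\<^sup>2 / 2)) \<ge> -1/20" using small by simp
  then have "19/20 \<le> 1 + real (Ncount n lam t) * (- (b\<^sup>2 / 2))" by simp
  also have "\<dots> \<le> (1 + - (b\<^sup>2 / 2)) ^ Ncount n lam t" using b2 by (intro Bernoulli_inequality) simp
  also have "\<dots> = (\<Prod>i\<in>{i. i < n \<and> lam i \<le> t}. 1 - b\<^sup>2 / 2)" by (simp add: Ncount_def)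
  also have "\<dots> = (\<Prod>i<n. ?c i)"
    by (rule prod.mono_neutral_cong_left) auto
  finally have "ennreal (19/20) \<le> ennreal (\<Prod>i<n. ?c i)" by (rule ennreal_leI)
  also have "\<dots> = (\<Prod>i<n. ennreal (?c i))" using b2 by (intro prod_ennreal[symmetric]) auto
  also have "\<dots> \<le> (\<Prod>i<n. \<integral>\<^sup>+p. ennreal (sqrt (law T i p * law (flip j T) i p)) \<partial>base d S)"
  proof (rule prod_mono_ennreal)
    fix i assume i: "i \<in> {..<n}"
    show "ennreal (?c i) \<le> (\<integral>\<^sup>+p. ennreal (sqrt (law T i p * law (flip j T) i p)) \<partial>base d S)"
    proof (cases "t < lam i")
      case True
      then have "(\<integral>\<^sup>+p. ennreal (sqrt (law T i p * law (flip j T) i p)) \<partial>base d S) = (\<integral>\<^sup>+p. ennreal (mask p) \<partial>base d S)"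
        using i mask_nonneg by (intro nn_integral_cong) (simp add: law_def)
      then show ?thesis using True mask_mass by simp
    next
      case False
      then show ?thesis using dens_affinity[OF j, of T] by (simp add: law_def)
    qed
  qed
  also have "\<dots> = (\<integral>\<^sup>+x. (\<Prod>i<n. ennreal (sqrt (law T i (x i) * law (flip j T) i (x i)))) \<partial>?N)"
  proof (rule PN.product_nn_integral_prod[symmetric, OF finite_lessThan])
    show "(\<lambda>p. ennreal (sqrt (law T i p * law (flip j T) i p))) \<in> borel_measurable (base d S)" for i
      using lm[of T i] lm[of "flip j T" i] by measurable
  qed
  also have "\<dots> = (\<integral>\<^sup>+x. ennreal (sqrt (F T x * F (flip j T) x)) \<partial>?N)"
    unfolding F_def prod.distrib[symmetric] sqrt_prod by (simp add: prod_ennreal law_nonneg)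
  finally have aff: "ennreal (19/20) \<le> (\<integral>\<^sup>+x. ennreal (sqrt (F T x * F (flip j T) x)) \<partial>?N)" .
  have "(19/20 - 1/2) * (4/3) \<le> measure (density ?N (F T)) E + measure (density ?N (F (flip j T))) (space ?N - E)"
  proof (rule two_point_testing[OF Fm F0 Fm F0 _ _ aff])
    show "E \<in> sets ?N" using E sN by simp
    show "prob_space (density ?N (F T))" "prob_space (density ?N (F (flip j T)))"
      unfolding LF[symmetric] by (rule prob_space_Law)+
  qed
  then show ?thesis unfolding LF[symmetric] spN by simp
qed

text \<open>The first k whitened coordinates of \<open>\<beta> T\<close> are \<open>a\<close> or
  \<open>- a\<close>. The signs of the whitened vector \<open>x\<close> propose a vertex, and each
  wrong sign costs at least a^2.\<close>

lemma sqnormS_ge_wrong_signs: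
  "a\<^sup>2 * real (card {j. j < k \<and> (0 < (\<Sum>i<d. x i * sqrt_cov d S i j)) \<noteq> (j \<in> T)}) \<le> sqnormS d S (\<lambda>i. x i - \<beta> T i)"
proof -
  let ?u = "\<lambda>l. \<Sum>i<d. x i * sqrt_cov d S i l"
  have \<beta>l: "(\<Sum>i<d. \<beta> T i * sqrt_cov d S i l) = (if l \<in> T then a else - a)" if l: "l < k" for l
  proof -
    have "(\<Sum>i<d. \<beta> T i * sqrt_cov d S i l) = (\<Sum>j<k. (if j \<in> T then a else - a) * (\<Sum>i<d. f j i * sqrt_cov d S i l))"
      unfolding \<beta>_def sum_distrib_right sum_distrib_left by (subst sum.swap) (simp add: mult.assoc)
    also have "\<dots> = (\<Sum>j<k. if j = l then (if l \<in> T then a else - a) else 0)"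
      using f l k by (intro sum.cong refl) auto
    finally show ?thesis using l by simp
  qed
  have "a\<^sup>2 * real (card {j. j < k \<and> (0 < ?u j) \<noteq> (j \<in> T)}) = (\<Sum>j\<in>{j\<in>{..<k}. (0 < ?u j) \<noteq> (j \<in> T)}. a\<^sup>2)"
    by simp
  also have "\<dots> \<le> (\<Sum>j\<in>{j\<in>{..<k}. (0 < ?u j) \<noteq> (j \<in> T)}. (\<Sum>i<d. (x i - \<beta> T i) * sqrt_cov d S i j)\<^sup>2)"
  proof (rule sum_mono)
    fix j assume j: "j \<in> {j\<in>{..<k}. (0 < ?u j) \<noteq> (j \<in> T)}"
    have "(\<Sum>i<d. (x i - \<beta> T i) * sqrt_cov d S i j) = ?u j - (if j \<in> T then a else - a)"
      using \<beta>l[of j] j by (simp add: left_diff_distrib sum_subtractf)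
    moreover have "\<bar>a\<bar> \<le> \<bar>?u j - (if j \<in> T then a else - a)\<bar>" using j a_pos by (cases "j \<in> T") auto
    ultimately show "a\<^sup>2 \<le> (\<Sum>i<d. (x i - \<beta> T i) * sqrt_cov d S i j)\<^sup>2" by (simp only: abs_le_square_iff)
  qed
  also have "\<dots> \<le> (\<Sum>j<d. (\<Sum>i<d. (x i - \<beta> T i) * sqrt_cov d S i j)\<^sup>2)"
    using k by (intro sum_mono2) auto
  also have "\<dots> = sqnormS d S (\<lambda>i. x i - \<beta> T i)" by (rule sqnormS_eq_sum_sq[OF S, symmetric])
  finally show ?thesis .
qed

text \<open>Averaging over all vertices produces one at which the expected number \<open>W\<close>
  of wrong signs is at least 3 k / 10. As \<open>W\<close> never exceeds k, the reverse Markov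
  inequality gives W \<ge> k / 20 with probability at least 3/10 - 1/20 = 1/4. A bound in
  probability is needed because \<open>Lreg\<close> is defined by a quantile, not by an
  expectation.\<close>

theorem assouad_lower_bound:
  assumes small: "real (Ncount n lam t) * b\<^sup>2 \<le> 1/10" and M: "M \<in> sample_space d n \<rightarrow>\<^sub>M Rd d"
    and s: "s < a\<^sup>2 * (real k / 20)"
  shows "\<exists>T. 1/4 \<le> outer_prob (contam_prob d n S \<sigma> lam (\<beta> T) (adv T))
    (\<lambda>\<omega>. s < sqnormS d S (\<lambda>i. M (observed n \<omega>) i - \<beta> T i))"
proof -
  let ?u = "\<lambda>z l. \<Sum>i<d. M z i * sqrt_cov d S i l"
  let ?Sp = "sample_space d n"
  define E where "E T j = {z \<in> space ?Sp. (0 < ?u z j) \<noteq> (j \<in> T)}" for T j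
  have um: "(\<lambda>z. ?u z j) \<in> borel_measurable ?Sp" for j
    by (intro borel_measurable_sum borel_measurable_times measurable_compose[OF M measurable_Rd_component]) auto
  have Es: "E T j \<in> sets ?Sp" for T j
    using um[of j] unfolding E_def by measurable
  have Ef: "E (flip j T) j = space ?Sp - E T j" for T j by (auto simp: E_def flip)
  have "(\<Sum>T\<in>Pow {..<k}. measure (Law T) (E T j)) \<ge> 3/10 * 2 ^ k" if j: "j < k" for j
  proof -
    \<comment> \<open>Flipping coordinate \<open>j\<close> is an involution of the vertices, so the
      sum of the paired errors over all vertices counts every error twice.\<close>
    have "(\<Sum>T\<in>Pow {..<k}. measure (Law T) (E T j)) = (\<Sum>T\<in>Pow {..<k}. measure (Law (flip j T)) (E (flip j T) j))"
      by (rule sum.reindex_bij_witness[of _ "flip j" "flip j"]) (use j in \<open>auto simp: flip, auto simp: flip_def split: if_splits\<close>)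
    then have "2 * (\<Sum>T\<in>Pow {..<k}. measure (Law T) (E T j)) =
      (\<Sum>T\<in>Pow {..<k}. measure (Law T) (E T j) + measure (Law (flip j T)) (space ?Sp - E T j))"
      by (simp add: sum.distrib Ef)
    also have "\<dots> \<ge> (\<Sum>T\<in>Pow {..<k}. 3/5)" by (intro sum_mono pair_testing j Es small)
    finally show ?thesis by (simp add: card_Pow)
  qed
  then have "(\<Sum>j<k. \<Sum>T\<in>Pow {..<k}. measure (Law T) (E T j)) \<ge> (\<Sum>j<k. 3/10 * 2 ^ k)" by (intro sum_mono) auto
  then have tot: "real k * (3/10 * 2 ^ k) \<le> (\<Sum>T\<in>Pow {..<k}. \<Sum>j<k. measure (Law T) (E T j))"
    by (subst sum.swap) simp
  obtain T where T: "3/10 * real k \<le> (\<Sum>j<k. measure (Law T) (E T j))"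
  proof (rule ccontr)
    assume n: "\<not> thesis"
    have "(\<Sum>T\<in>Pow {..<k}. \<Sum>j<k. measure (Law T) (E T j)) < (\<Sum>T\<in>Pow {..<k}. 3/10 * real k)"
      using n that by (intro sum_strict_mono) (auto simp: not_le[symmetric])
    then show False using tot by (simp add: card_Pow algebra_simps)
  qed
  interpret L: prob_space "Law T" by (rule prob_space_Law)
  define W where "W z = (\<Sum>j<k. indicator (E T j) z :: real)" for z
  define U where "U = {z \<in> space ?Sp. real k / 20 \<le> W z}"
  have Wm: "W \<in> borel_measurable ?Sp" unfolding W_def[abs_def] using Es by (intro borel_measurable_sum borel_measurable_indicator) auto
  have U: "U \<in> sets ?Sp" unfolding U_def using Wm by measurable
  have Wi: "integrable (Law T) W" unfolding W_def[abs_def] using Es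
    by (intro Bochner_Integration.integrable_sum) (auto simp: integrable_indicator_iff L.emeasure_finite less_top[symmetric])
  have Wk: "W z \<le> real k" for z
    unfolding W_def using sum_mono[of "{..<k}" "\<lambda>j. indicator (E T j) z :: real" "\<lambda>_. 1"] by (simp add: indicator_le_1)
  have "3/10 * real k \<le> (\<integral>z. W z \<partial>Law T)"
  proof -
    have "(\<integral>z. W z \<partial>Law T) = (\<Sum>j<k. \<integral>z. indicator (E T j) z \<partial>Law T)"
      unfolding W_def using Es by (intro Bochner_Integration.integral_sum) (auto simp: integrable_indicator_iff L.emeasure_finite less_top[symmetric])
    also have "\<dots> = (\<Sum>j<k. measure (Law T) (E T j))" using Es by simp
    finally show ?thesis using T by simp
  qed
  also have "\<dots> \<le> (\<integral>z. real k * indicator U z + real k / 20 \<partial>Law T)"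
  proof (rule integral_mono[OF Wi])
    show "integrable (Law T) (\<lambda>z. real k * indicator U z + real k / 20)"
      using U by (intro Bochner_Integration.integrable_add integrable_mult_right) (auto simp: integrable_indicator_iff L.emeasure_finite less_top[symmetric])
    fix z assume "z \<in> space (Law T)"
    then show "W z \<le> real k * indicator U z + real k / 20"
      using Wk[of z] by (cases "z \<in> U") (auto simp: U_def intro: add_increasing2)
  qed
  also have "\<dots> = real k * L.prob U + real k / 20"
    using U L.prob_space by (subst Bochner_Integration.integral_add)
      (auto simp: integrable_indicator_iff L.emeasure_finite less_top[symmetric] intro!: integrable_mult_right)
  finally have pU: "1/4 \<le> L.prob U" using k by (simp add: field_simps)
  let ?C = "contam_prob d n S \<sigma> lam (\<beta> T) (adv T)"
  interpret C: prob_space ?C by (rule prob_space_contam_prob[OF \<sigma> adversary_adv])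
  note sC = sets_contam_prob[OF \<sigma> adversary_adv[of T], of S lam "\<beta> T"]
  note spC = sets_eq_imp_space_eq[OF sC]
  have "1/4 \<le> outer_prob ?C (\<lambda>\<omega>. s < sqnormS d S (\<lambda>i. M (observed n \<omega>) i - \<beta> T i))"
    unfolding outer_prob_def
  proof (rule cInf_greatest)
    show "{measure ?C A |A. A \<in> sets ?C \<and> {\<omega> \<in> space ?C. s < sqnormS d S (\<lambda>i. M (observed n \<omega>) i - \<beta> T i)} \<subseteq> A} \<noteq> {}"
      by (auto intro!: exI[of _ "space ?C"])
    fix r assume "r \<in> {measure ?C A |A. A \<in> sets ?C \<and> {\<omega> \<in> space ?C. s < sqnormS d S (\<lambda>i. M (observed n \<omega>) i - \<beta> T i)} \<subseteq> A}"
    then obtain A where A: "r = measure ?C A" "A \<in> sets ?C"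
      "{\<omega> \<in> space ?C. s < sqnormS d S (\<lambda>i. M (observed n \<omega>) i - \<beta> T i)} \<subseteq> A" by blast
    \<comment> \<open>Outer probability is an infimum over measurable supersets. Each of them
      contains the measurable event that the observed sample lies in \<open>U\<close>, whose
      probability is that of \<open>U\<close> under \<open>Law T\<close>.\<close>
    have "{\<omega> \<in> space (contam_space d n). observed n \<omega> \<in> U} \<subseteq> A"
    proof
      fix \<omega> assume w: "\<omega> \<in> {\<omega> \<in> space (contam_space d n). observed n \<omega> \<in> U}"
      let ?z = "observed n \<omega>"
      have "W ?z = (\<Sum>j<k. if (0 < ?u ?z j) \<noteq> (j \<in> T) then 1 else 0)"
        unfolding W_def using w by (intro sum.cong refl) (auto simp: E_def U_def indicator_def)
      also have "\<dots> = real (card {j\<in>{..<k}. (0 < ?u ?z j) \<noteq> (j \<in> T)})"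
        by (subst sum.inter_filter[symmetric]) auto
      finally have "W ?z = real (card {j. j < k \<and> (0 < ?u ?z j) \<noteq> (j \<in> T)})" by simp
      then have "a\<^sup>2 * (real k / 20) \<le> a\<^sup>2 * real (card {j. j < k \<and> (0 < ?u ?z j) \<noteq> (j \<in> T)})"
        using w by (intro mult_left_mono) (auto simp: U_def)
      also have "\<dots> \<le> sqnormS d S (\<lambda>i. M ?z i - \<beta> T i)" by (rule sqnormS_ge_wrong_signs)
      finally have "s < sqnormS d S (\<lambda>i. M ?z i - \<beta> T i)" using s by simp
      then show "\<omega> \<in> A" using A(3) w spC by blast
    qed
    then have "C.prob {\<omega> \<in> space (contam_space d n). observed n \<omega> \<in> U} \<le> C.prob A"
      using A(2) by (rule C.finite_measure_mono)
    moreover have "C.prob {\<omega> \<in> space (contam_space d n). observed n \<omega> \<in> U} = L.prob U"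
      unfolding measure_def emeasure_observed[OF U] ..
    ultimately show "1/4 \<le> r" using pU A(1) by simp
  qed
  then show ?thesis by blast
qed

end

section \<open>The minimax rate\<close>

lemma outer_prob_mono:
  assumes "\<And>\<omega>. \<omega> \<in> space M \<Longrightarrow> E \<omega> \<Longrightarrow> F \<omega>"
  shows "outer_prob M E \<le> outer_prob M F"
  unfolding outer_prob_def
proof (rule cInf_superset_mono)
  show "{measure M A |A. A \<in> sets M \<and> {\<omega> \<in> space M. F \<omega>} \<subseteq> A} \<noteq> {}"
    by (auto intro!: exI[of _ "space M"])
  show "bdd_below {measure M A |A. A \<in> sets M \<and> {\<omega> \<in> space M. E \<omega>} \<subseteq> A}"
    by (auto intro!: bdd_belowI[of _ 0])
  show "{measure M A |A. A \<in> sets M \<and> {\<omega> \<in> space M. F \<omega>} \<subseteq> A} \<subseteq> {measure M A |A. A \<in> sets M \<and> {\<omega> \<in> space M. E \<omega>} \<subseteq> A}"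
    using assms by blast
qed

text \<open>Provides positivity of the infimum \<open>md\<close>, which both
  \<open>Lreg_upper\<close> and \<open>Lreg_lower\<close> assume.\<close>

lemma md_lower:
  assumes "1 \<le> d" "1 \<le> n" shows "ereal (real d / real n) \<le> md d n lam"
  unfolding md_def
proof (rule INF_greatest)
  fix t
  have "Ncount n lam t \<le> card {..<n}" unfolding Ncount_def by (rule card_mono) auto
  then have "real d / real n \<le> real d / real (Ncount n lam t)" if "Ncount n lam t \<noteq> 0"
    using that by (intro divide_left_mono) auto
  then show "ereal (real d / real n) \<le> mobj d n lam t" by (auto simp: mobj_def intro: add_increasing)
qed

text \<open>Any threshold with objective below 2 m will do, hence 72000000000000 = 2 * 6000000^2.
  The bound on m makes r at most 1 / 6000000, the range of
  \<open>measurable_estimator_error\<close>.\<close>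

lemma Lreg_upper:
  assumes d: "1 \<le> d" and S: "pos_def d S" and \<sigma>: "0 < \<sigma>" and lam: "\<forall>i<n. 0 \<le> lam i \<and> lam i \<le> 1"
    and m: "md d n lam = ereal m" "0 < m" "m \<le> 1 / 72000000000000"
  shows "Lreg d n S \<sigma> lam \<le> ereal (72000000000000 * \<sigma>\<^sup>2 * m)"
proof -
  have "md d n lam < ereal (2 * m)" using m by simp
  then obtain t where t: "t \<in> {0..1}" "mobj d n lam t < ereal (2 * m)" unfolding md_def INF_less_iff by blast
  have N: "0 < Ncount n lam t" using t(2) by (auto simp: mobj_def split: if_splits)
  define q where "q = t\<^sup>2 + real d / real (Ncount n lam t)"
  have q2: "q < 2 * m" using t(2) N by (simp add: mobj_def q_def)
  define r where "r = sqrt q"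
  have dN: "0 < real d / real (Ncount n lam t)" using d N by simp
  then have q0: "0 < q" unfolding q_def by (intro add_nonneg_pos) auto
  have r: "0 < r" "t \<le> r" "real d / real (Ncount n lam t) \<le> r\<^sup>2" "6000000 * r \<le> 1"
  proof -
    show "0 < r" using q0 by (simp add: r_def)
    show "t \<le> r" unfolding r_def using dN by (intro real_le_rsqrt) (simp add: q_def)
    show "real d / real (Ncount n lam t) \<le> r\<^sup>2" using q0 by (simp add: r_def q_def)
    have "r \<le> 1 / 6000000" unfolding r_def using q2 m(3) by (intro real_le_lsqrt) (auto simp: power2_eq_square)
    then show "6000000 * r \<le> 1" by simp
  qed
  obtain M where M: "M \<in> sample_space d n \<rightarrow>\<^sub>M Rd d" "\<forall>\<beta> K. adversary d n K \<longrightarrow>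
    outer_prob (contam_prob d n S \<sigma> lam \<beta> K)
      (\<lambda>\<omega>. (6000000 * r * \<sigma>)\<^sup>2 \<le> sqnormS d S (\<lambda>i. M (observed n \<omega>) i - \<beta> i)) \<le> 1/5"
    using measurable_estimator_error[OF d S \<sigma> lam N r] by (elim bexE)
  let ?s = "(6000000 * r * \<sigma>)\<^sup>2"
  have "(INF M \<in> (sample_space d n \<rightarrow>\<^sub>M Rd d). SUP \<beta>K \<in> {(\<beta>, K). adversary d n K}.
      ereal (outer_prob (contam_prob d n S \<sigma> lam (fst \<beta>K) (snd \<beta>K))
        (\<lambda>\<omega>. ?s < sqnormS d S (\<lambda>i. M (observed n \<omega>) i - fst \<beta>K i)))) \<le> ereal (1/5)"
  proof (rule INF_lower2[OF M(1)], rule SUP_least)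
    fix \<beta>K assume "\<beta>K \<in> {(\<beta> :: nat \<Rightarrow> real, K). adversary d n K}"
    then have K: "adversary d n (snd \<beta>K)" by auto
    have "outer_prob (contam_prob d n S \<sigma> lam (fst \<beta>K) (snd \<beta>K))
        (\<lambda>\<omega>. ?s < sqnormS d S (\<lambda>i. M (observed n \<omega>) i - fst \<beta>K i)) \<le>
      outer_prob (contam_prob d n S \<sigma> lam (fst \<beta>K) (snd \<beta>K))
        (\<lambda>\<omega>. ?s \<le> sqnormS d S (\<lambda>i. M (observed n \<omega>) i - fst \<beta>K i))"
      by (rule outer_prob_mono) simp
    also have "\<dots> \<le> 1/5" using M(2) K by blast
    finally show "ereal (outer_prob (contam_prob d n S \<sigma> lam (fst \<beta>K) (snd \<beta>K))
        (\<lambda>\<omega>. ?s < sqnormS d S (\<lambda>i. M (observed n \<omega>) i - fst \<beta>K i))) \<le> ereal (1/5)" by simp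
  qed
  then have "Lreg d n S \<sigma> lam \<le> ereal ?s" unfolding Lreg_def by (intro Inf_lower) blast
  also have "?s = 36000000000000 * \<sigma>\<^sup>2 * q" using q0 by (simp add: power_mult_distrib r_def)
  also have "ereal \<dots> \<le> ereal (72000000000000 * \<sigma>\<^sup>2 * m)"
    using q2 \<sigma> mult_left_mono[of q "2 * m" "36000000000000 * \<sigma>\<^sup>2"] by simp
  finally show ?thesis .
qed

text \<open>The threshold satisfies t^2 = m / 20. As m is at most the objective at t, d / N(t) is at
  least 19 m / 20 when N(t) is positive, and k^2 \<ge> d gives N(t) b^2 \<le> 1/19. The bound k
  \<le> 2 sqrt d turns a^2 k / 20 = \<sigma>^2 m / (400 k) into the constant 800.\<close>

lemma Lreg_lower:
  assumes d: "1 \<le> d" and S: "pos_def d S" and \<sigma>: "0 < \<sigma>" and lam: "\<forall>i<n. 0 \<le> lam i \<and> lam i \<le> 1"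
    and m: "md d n lam = ereal m" "0 < m" "m \<le> 1"
  shows "ereal (\<sigma>\<^sup>2 * m / (800 * sqrt (real d))) \<le> Lreg d n S \<sigma> lam"
proof -
  define k where "k = nat \<lceil>sqrt (real d)\<rceil>"
  define t where "t = sqrt (m / 20)"
  have sd: "1 \<le> sqrt (real d)" using d by simp
  have k: "sqrt (real d) \<le> real k" "real k \<le> 2 * sqrt (real d)" "1 \<le> k" "k \<le> d"
  proof -
    show 1: "sqrt (real d) \<le> real k" unfolding k_def by linarith
    show "real k \<le> 2 * sqrt (real d)" unfolding k_def using sd by linarith
    show "1 \<le> k" using 1 sd by linarith
    have "sqrt (real d) \<le> real d" using d by (intro real_le_lsqrt) (auto simp: power2_eq_square)
    then have "\<lceil>sqrt (real d)\<rceil> \<le> int d" by (simp add: ceiling_le_iff)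
    then show "k \<le> d" unfolding k_def by linarith
  qed
  have t2: "t\<^sup>2 = m / 20" using m by (simp add: t_def)
  have t: "0 < t" "t \<le> 1" using m by (auto simp: t_def intro!: real_le_lsqrt)
  have "\<forall>j. \<exists>\<beta>. \<forall>l<d. (\<Sum>i<d. \<beta> i * sqrt_cov d S i l) = (if l = j then 1 else 0)"
    by (intro allI sqrt_cov_transpose_solvable[OF S])
  from choice[OF this] obtain f where f: "\<forall>j. \<forall>l<d. (\<Sum>i<d. f j i * sqrt_cov d S i l) = (if l = j then 1 else 0)" by (elim exE)
  interpret H: hypercube_design d n k S \<sigma> t lam f
    by unfold_locales (use S \<sigma> k t lam f in auto)
  have small: "real (Ncount n lam t) * H.b\<^sup>2 \<le> 1/10"
  proof (cases "Ncount n lam t = 0")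
    case False
    let ?N = "real (Ncount n lam t)"
    have N: "0 < ?N" using False by simp
    have "ereal m \<le> mobj d n lam t" unfolding m(1)[symmetric] md_def using t by (intro INF_lower) auto
    then have "m \<le> m / 20 + real d / ?N" using False by (simp add: mobj_def t2)
    then have Nm: "?N * m \<le> 20/19 * real d" using N by (simp add: field_simps)
    have kd: "real d \<le> (real k)\<^sup>2" using k(1) by (metis real_sqrt_le_iff real_sqrt_pow2 of_nat_0_le_iff power_mono real_sqrt_ge_zero)
    have k0: "0 < (real k)\<^sup>2" using k(3) by simp
    have "?N * H.b\<^sup>2 = ?N * m / (20 * (real k)\<^sup>2)" by (simp add: H.b_def power_divide t2)
    also have "\<dots> \<le> (20/19 * (real k)\<^sup>2) / (20 * (real k)\<^sup>2)"
      by (rule divide_right_mono[OF order.trans[OF Nm mult_left_mono[OF kd]]]) auto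
    also have "\<dots> \<le> 1/10" using k0 by simp
    finally show ?thesis .
  qed simp
  have rate: "\<sigma>\<^sup>2 * m / (800 * sqrt (real d)) \<le> H.a\<^sup>2 * (real k / 20)"
  proof -
    have k0: "0 < real k" using k(3) by simp
    have "H.a\<^sup>2 * (real k / 20) = \<sigma>\<^sup>2 * m / (400 * real k)"
    proof -
      have "H.a\<^sup>2 = \<sigma>\<^sup>2 * (m / 20) / (real k)\<^sup>2"
        by (simp add: H.a_def H.b_def power_mult_distrib power_divide t2)
      then show ?thesis using k0 by (simp add: power2_eq_square[of "real k"])
    qed
    also have "\<dots> \<ge> \<sigma>\<^sup>2 * m / (400 * (2 * sqrt (real d)))"
    proof -
      have "0 < sqrt (real d)" using sd by linarith
      then show ?thesis
        using k(2) k0 m(2) by (intro divide_left_mono mult_pos_pos mult_left_mono mult_nonneg_nonneg) simp_all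
    qed
    finally show ?thesis by simp
  qed
  show ?thesis unfolding Lreg_def
  proof (rule Inf_greatest)
    fix x assume "x \<in> {ereal s |s. (INF M \<in> (sample_space d n \<rightarrow>\<^sub>M Rd d). SUP \<beta>K \<in> {(\<beta>, K). adversary d n K}.
      ereal (outer_prob (contam_prob d n S \<sigma> lam (fst \<beta>K) (snd \<beta>K))
        (\<lambda>\<omega>. s < sqnormS d S (\<lambda>i. M (observed n \<omega>) i - fst \<beta>K i)))) \<le> ereal (1/5)}"
    then obtain s where x: "x = ereal s" and le: "(INF M \<in> (sample_space d n \<rightarrow>\<^sub>M Rd d). SUP \<beta>K \<in> {(\<beta>, K). adversary d n K}.
      ereal (outer_prob (contam_prob d n S \<sigma> lam (fst \<beta>K) (snd \<beta>K))
        (\<lambda>\<omega>. s < sqnormS d S (\<lambda>i. M (observed n \<omega>) i - fst \<beta>K i)))) \<le> ereal (1/5)" by blast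
    have "\<sigma>\<^sup>2 * m / (800 * sqrt (real d)) \<le> s"
    proof (rule ccontr)
      assume "\<not> ?thesis"
      then have "s < \<sigma>\<^sup>2 * m / (800 * sqrt (real d))" by (simp only: not_le)
      then have s: "s < H.a\<^sup>2 * (real k / 20)" using rate by (rule less_le_trans)
      \<comment> \<open>The bound 1/4 holds for every estimator, so their infimum exceeds the level
        1/5 in the definition of \<open>Lreg\<close>.\<close>
      have "ereal (1/4) \<le> (INF M \<in> (sample_space d n \<rightarrow>\<^sub>M Rd d). SUP \<beta>K \<in> {(\<beta>, K). adversary d n K}.
        ereal (outer_prob (contam_prob d n S \<sigma> lam (fst \<beta>K) (snd \<beta>K))
          (\<lambda>\<omega>. s < sqnormS d S (\<lambda>i. M (observed n \<omega>) i - fst \<beta>K i))))"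
      proof (rule INF_greatest)
        fix M assume M: "M \<in> sample_space d n \<rightarrow>\<^sub>M Rd d"
        obtain T where T: "1/4 \<le> outer_prob (contam_prob d n S \<sigma> lam (H.\<beta> T) (H.adv T))
            (\<lambda>\<omega>. s < sqnormS d S (\<lambda>i. M (observed n \<omega>) i - H.\<beta> T i))"
          using H.assouad_lower_bound[OF small M s] by (elim exE)
        have mem: "(H.\<beta> T, H.adv T) \<in> {(\<beta>, K). adversary d n K}" using H.adversary_adv by simp
        show "ereal (1/4) \<le> (SUP \<beta>K \<in> {(\<beta>, K). adversary d n K}.
          ereal (outer_prob (contam_prob d n S \<sigma> lam (fst \<beta>K) (snd \<beta>K))
            (\<lambda>\<omega>. s < sqnormS d S (\<lambda>i. M (observed n \<omega>) i - fst \<beta>K i))))"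
          by (rule SUP_upper2[OF mem]) (use T in simp)
      qed
      then have "ereal (1/4) \<le> ereal (1/5)" using le by (rule order.trans)
      then show False by simp
    qed
    then show "ereal (\<sigma>\<^sup>2 * m / (800 * sqrt (real d))) \<le> x" by (simp add: x)
  qed
qed

text \<open>Here the threshold has objective exactly m, so r = sqrt m and the squared error radius
  is 36000000000000 \<sigma>^2 m. This lies below the bound, whose constant is shared with
  \<open>Lreg_upper\<close>.\<close>

lemma depth_estimator_upper:
  assumes d: "1 \<le> d" and S: "pos_def d S" and \<sigma>: "0 < \<sigma>" and lam: "\<forall>i<n. 0 \<le> lam i \<and> lam i \<le> 1"
    and m: "mobj d n lam t = ereal m" "m \<le> 1 / 72000000000000"
    and est: "\<And>z \<eta>. depth d n (thr_weights n lam t) \<eta> z \<le> depth d n (thr_weights n lam t) (est z) z"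
    and K: "adversary d n K"
  shows "outer_prob (contam_prob d n S \<sigma> lam \<beta> K)
    (\<lambda>\<omega>. 72000000000000 * \<sigma>\<^sup>2 * m \<le> sqnormS d S (\<lambda>i. est (observed n \<omega>) i - \<beta> i)) \<le> 1/5"
proof -
  have N: "0 < Ncount n lam t" using m by (auto simp: mobj_def split: if_splits)
  have q: "m = t\<^sup>2 + real d / real (Ncount n lam t)" using m N by (simp add: mobj_def)
  define r where "r = sqrt m"
  have dN: "0 < real d / real (Ncount n lam t)" using d N by simp
  then have q0: "0 < m" unfolding q by (intro add_nonneg_pos) auto
  have r: "0 < r" "t \<le> r" "real d / real (Ncount n lam t) \<le> r\<^sup>2" "6000000 * r \<le> 1"
  proof -
    show "0 < r" using q0 by (simp add: r_def)
    show "t \<le> r" unfolding r_def using dN by (intro real_le_rsqrt) (simp add: q)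
    show "real d / real (Ncount n lam t) \<le> r\<^sup>2" using q0 unfolding r_def by (simp add: q)
    have "r \<le> 1 / 6000000" unfolding r_def using m(2) by (intro real_le_lsqrt) (auto simp: power2_eq_square)
    then show "6000000 * r \<le> 1" by simp
  qed
  have "(6000000 * r * \<sigma>)\<^sup>2 \<le> 72000000000000 * \<sigma>\<^sup>2 * m"
    using q0 by (simp add: power_mult_distrib r_def)
  then have "outer_prob (contam_prob d n S \<sigma> lam \<beta> K)
    (\<lambda>\<omega>. 72000000000000 * \<sigma>\<^sup>2 * m \<le> sqnormS d S (\<lambda>i. est (observed n \<omega>) i - \<beta> i)) \<le>
    outer_prob (contam_prob d n S \<sigma> lam \<beta> K)
    (\<lambda>\<omega>. (6000000 * r * \<sigma>)\<^sup>2 \<le> sqnormS d S (\<lambda>i. est (observed n \<omega>) i - \<beta> i))"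
    by (intro outer_prob_mono) simp
  also have "\<dots> \<le> 1/5" by (rule depth_maximizer_error[OF d S \<sigma> lam N r est K])
  finally show ?thesis .
qed

theorem mainTheorem9:
  shows "\<exists>c C1 C2 :: real. 0 < c \<and> 0 < C1 \<and> 0 < C2 \<and>
    (\<forall>d n S \<sigma> lam. 1 \<le> d \<longrightarrow> pos_def d S \<longrightarrow> 0 < \<sigma> \<longrightarrow> 1 \<le> n \<longrightarrow>
       (\<forall>i<n. 0 \<le> lam i \<and> lam i \<le> 1) \<longrightarrow> md d n lam \<le> ereal c \<longrightarrow>
       ereal (C1 * \<sigma>\<^sup>2 / sqrt (real d)) * md d n lam \<le> Lreg d n S \<sigma> lam \<and>
       Lreg d n S \<sigma> lam \<le> ereal (C2 * \<sigma>\<^sup>2) * md d n lam \<and>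
       (\<forall>ts est \<beta> K. ts \<in> {0..1} \<longrightarrow> mobj d n lam ts = md d n lam \<longrightarrow>
          (\<forall>z \<eta>. depth d n (thr_weights n lam ts) \<eta> z \<le> depth d n (thr_weights n lam ts) (est z) z) \<longrightarrow>
          adversary d n K \<longrightarrow>
          outer_prob (contam_prob d n S \<sigma> lam \<beta> K)
            (\<lambda>\<omega>. ereal (C2 * \<sigma>\<^sup>2) * md d n lam
                   \<le> ereal (sqnormS d S (\<lambda>i. est (observed n \<omega>) i - \<beta> i))) \<le> 1/5))"
\<comment> \<open>\<open>C1\<close> and \<open>C2\<close> are the constants of
  \<open>Lreg_lower\<close> and \<open>Lreg_upper\<close>; \<open>c\<close> is 1 /
  \<open>C2\<close>, the bound on m under which 6000000 r is at most 1.\<close>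
proof (rule exI[of _ "1 / 72000000000000"], rule exI[of _ "1/800"], rule exI[of _ "72000000000000"], intro conjI allI impI)
  fix d n :: nat and S :: "nat \<Rightarrow> nat \<Rightarrow> real" and \<sigma> :: real and lam :: "nat \<Rightarrow> real"
  assume d: "1 \<le> d" and S: "pos_def d S" and \<sigma>: "0 < \<sigma>" and n: "1 \<le> n"
    and lam: "\<forall>i<n. 0 \<le> lam i \<and> lam i \<le> 1" and c: "md d n lam \<le> ereal (1 / 72000000000000)"
  have lo: "ereal (real d / real n) \<le> md d n lam" by (rule md_lower[OF d n])
  \<comment> \<open>The smallness hypothesis excludes the value infinity, and the lower bound d / n
    excludes minus infinity and makes m positive.\<close>
  obtain m where m: "md d n lam = ereal m" using lo c by (cases "md d n lam") auto
  have dn: "0 < real d / real n" using d n by simp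
  have m0: "0 < m" "m \<le> 1 / 72000000000000" using lo c dn unfolding m by auto
  show "ereal (1/800 * \<sigma>\<^sup>2 / sqrt (real d)) * md d n lam \<le> Lreg d n S \<sigma> lam"
    using Lreg_lower[OF d S \<sigma> lam m m0(1)] m0(2) by (simp add: m mult.commute)
  show "Lreg d n S \<sigma> lam \<le> ereal (72000000000000 * \<sigma>\<^sup>2) * md d n lam"
    using Lreg_upper[OF d S \<sigma> lam m m0] by (simp add: m)
  fix ts est \<beta> K
  assume opt: "mobj d n lam ts = md d n lam" and K: "adversary d n K"
    and est: "\<forall>z \<eta>. depth d n (thr_weights n lam ts) \<eta> z \<le> depth d n (thr_weights n lam ts) (est z) z"
  show "outer_prob (contam_prob d n S \<sigma> lam \<beta> K)
      (\<lambda>\<omega>. ereal (72000000000000 * \<sigma>\<^sup>2) * md d n lam \<le> ereal (sqnormS d S (\<lambda>i. est (observed n \<omega>) i - \<beta> i))) \<le> 1/5"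
    using depth_estimator_upper[OF d S \<sigma> lam opt[unfolded m] m0(2) _ K, of est \<beta>] est by (simp add: m)
qed auto

end
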